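(* Let $A=\{a^{(1)},\dots,a^{(N)}\}\subseteq\mathbb{Z}^n$ generate $\mathbb{Z}^n$ as an abelian group, let $\alpha\in\mathbb{C}^n$, and let $f=\sum_{j=1}^N\lambda_jx^{a^{(j)}}$. Suppose $f=x_ng(x_1,\dots,x_{n-1})$ with $g\in\mathbb{C}[\lambda][x_1^{\pm1},\dots,x_{n-1}^{\pm1}]$ (that is, $a^{(j)}_n=1$ for all $j$) and that $\alpha$ is nonresonant for $A$. Then for all $i$ there are $\mathcal{D}$-module isomorphisms $$H^i(\Omega^\bullet_{R'/\mathbb{C}[\lambda]},\nabla_\alpha)\cong H^{i-1}(\Omega^\bullet_{U/\mathbb{C}[\lambda]},\widetilde{\nabla}_\alpha).$$
   Context: Write $a^{(j)}=(a^{(j)}_1,\dots,a^{(j)}_n)$, $\alpha=(\alpha_1,\dots,\alpha_n)$. Let $\mathcal{D}=\mathbb{C}\langle\lambda_1,\dots,\lambda_N,\partial_1,\dots,\partial_N\rangle$ be the Weyl algebra in $\lambda_1,\dots,\lambda_N$, $\partial_j=\partial/\partial\lambda_j$, and $\mathbb{C}[\lambda]=\mathbb{C}[\lambda_1,\dots,\lambda_N]$. Nonresonance. Let $C(A)\subseteq\mathbb{R}^n$ be the real cone generated by $A$, and let $\ell_1,\dots,\ell_s\in\mathbb{Z}[u_1,\dots,u_n]$ be the homogeneous linear forms defining the codimension-one faces of $C(A)$, normalized so that the coefficients of each $\ell_i$ are relatively prime and $\ell_i\ge 0$ on $C(A)$. Then $\alpha$ is nonresonant for $A$ if $\ell_i(\alpha)\notin\mathbb{Z}$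 for all $i$. First complex. Let $R'=\mathbb{C}[\lambda][x_1^{\pm1},\dots,x_n^{\pm1}]$ and let $\Omega^k_{R'/\mathbb{C}[\lambda]}$ be the module of relative $k$-forms, free over $R'$ with basis the forms $\frac{dx_{i_1}}{x_{i_1}}\wedge\cdots\wedge\frac{dx_{i_k}}{x_{i_k}}$, $1\le i_1<\dots<i_k\le n$. The differential is $\nabla_\alpha(\omega)=d\omega+\sum_{i=1}^n\alpha_i\frac{dx_i}{x_i}\wedge\omega+df\wedge\omega$, with $d$ the relative exterior derivative (the $\lambda_j$ are constants). $\mathcal{D}$ acts on the complex: $\lambda_j$ by multiplication, and $\partial_j$ acts on coefficients with respect to the basis forms $\frac{dx_{i_1}}{x_{i_1}}\wedge\cdots\wedge\frac{dx_{i_k}}{x_{i_k}}$ ($1\le i_1<\dots<i_k\le n$) as $\partial_j+x^{a^{(j)}}$. Second complex. Let $\mathbb{T}^{n-1}$ be the $(n-1)$-torus over $\mathbb{C}[\lambda]$ with coordinates $x_1,\dots,x_{n-1}$, and $U\subseteq\mathbb{T}^{n-1}$ the open set where $g$ is nonvanishing, so $U=\mathrm{Spec}\,\mathbb{C}[\lambda][x_1^{\pm1},\dots,x_{n-1}^{\pm1},g^{-1}]$. Let $\Omega^k_{U/\mathbb{C}[\lambda]}$ be the module of relative $k$-forms over the ring of regular functions on $U$, with basis the forms $\frac{dx_{i_1}}{x_{i_1}}\wedge\cdots\wedge\frac{dx_{i_k}}{x_{i_k}}$, $1\le i_1<\dots<i_k\le n-1$. The differential is $\widetilde{\nabla}_\alpha(\omega)=d\omega+\sum_{i=1}^{n-1}\alpha_i\frac{dx_i}{x_i}\wedge\omega-\alpha_n\frac{dg}{g}\wedge\omega$.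 $\mathcal{D}$ acts on the complex: $\lambda_j$ by multiplication, and $\partial_j$ acts on coefficients in this basis as $\partial_j-\alpha_n\frac{g^{\partial_j}}{g}$, where $g^{\partial_j}=\partial g/\partial\lambda_j$. These $\mathcal{D}$-actions commute with the differentials, so cohomology groups are $\mathcal{D}$-modules. *)

theory Defs
  imports
    "HOL-Analysis.Polytope"
    "HOL-Library.Poly_Mapping"
    "HOL-Computational_Algebra.Group_Closure"
    "HOL-Computational_Algebra.Polynomial_Factorial"
    "HOL-Algebra.QuotRing"
    "HOL-Algebra.Module"
begin

text \<open>
  Conventions. The type \<open>'n\<close> (finite, linearly ordered) indexes the torus coordinates
  \<open>x\<^sub>1, \<dots>, x\<^sub>n\<close>, so \<open>n = CARD('n) \<ge> 1\<close>; the index \<open>n\<close> is the largest element \<open>top_idx\<close>.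
  The type \<open>'j\<close> indexes the parameters \<open>\<lambda>\<^sub>1, \<dots>, \<lambda>\<^sub>N\<close>, so \<open>N = CARD('j)\<close>; its order is only
  used to see that the polynomial rings below are integral domains.
\<close>

definition top_idx :: "'n::{finite,linorder}" where
  "top_idx = Max UNIV"


section \<open>Nonresonance\<close>

definition real_cone :: "(int ^ 'n) set \<Rightarrow> (real ^ 'n::finite) set" where
  "real_cone A = convex_cone hull ((\<lambda>v. \<chi> i. real_of_int (v $ i)) ` A)"

text \<open>\<open>l\<close> is the coefficient vector of a linear form, normalized as usual, whose zero locus cuts
  out a codimension-one face.\<close>

definition facet_form :: "(int ^ 'n) set \<Rightarrow> int ^ 'n::finite \<Rightarrow> bool" where
  "facet_form A l \<longleftrightarrow>
     (GCD i\<in>UNIV. l $ i) = 1 \<and>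
     (\<forall>u\<in>real_cone A. (\<Sum>i\<in>UNIV. of_int (l $ i) * u $ i) \<ge> 0) \<and>
     {u \<in> real_cone A. (\<Sum>i\<in>UNIV. of_int (l $ i) * u $ i) = 0} facet_of real_cone A"

definition nonresonant :: "(int ^ 'n) set \<Rightarrow> complex ^ 'n::finite \<Rightarrow> bool" where
  "nonresonant A \<alpha> \<longleftrightarrow> (\<forall>l. facet_form A l \<longrightarrow> (\<Sum>i\<in>UNIV. of_int (l $ i) * \<alpha> $ i) \<notin> \<int>)"


section \<open>Laurent polynomials over the polynomial ring in the parameters\<close>

type_synonym 'j cpoly = "('j \<Rightarrow>\<^sub>0 nat) \<Rightarrow>\<^sub>0 complex"

type_synonym ('n, 'j) laurent = "('n \<Rightarrow>\<^sub>0 int) \<Rightarrow>\<^sub>0 'j cpoly"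

definition lconst :: "complex \<Rightarrow> ('n, 'j) laurent" where
  "lconst c = Poly_Mapping.single 0 (Poly_Mapping.single 0 c)"

definition lparam :: "'j \<Rightarrow> ('n, 'j) laurent" where
  "lparam j = Poly_Mapping.single 0 (Poly_Mapping.single (Poly_Mapping.single j 1) 1)"

definition lmonom :: "int ^ 'n::finite \<Rightarrow> ('n, 'j) laurent" where
  "lmonom v = Poly_Mapping.single (Abs_poly_mapping (vec_nth v)) 1"

definition generic_laurent :: "('j::finite \<Rightarrow> int ^ 'n::finite) \<Rightarrow> ('n, 'j) laurent" where
  "generic_laurent a = (\<Sum>j\<in>UNIV. lparam j * lmonom (a j))"

text \<open>The subring \<open>\<complex>[\<lambda>][x\<^sub>1\<^sup>\<plusminus>\<^sup>1, \<dots>, x\<^sub>n\<^sub>-\<^sub>1\<^sup>\<plusminus>\<^sup>1]\<close>.\<close>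

definition subtorus_ring :: "('n::{finite,linorder}, 'j) laurent set" where
  "subtorus_ring = {r. \<forall>m\<in>Poly_Mapping.keys r. Poly_Mapping.lookup m top_idx = 0}"

text \<open>\<open>\<partial>/\<partial>\<lambda>\<^sub>j\<close> on \<open>\<complex>[\<lambda>]\<close> and coefficientwise on Laurent polynomials. The truncated subtraction of
  exponents is harmless: when it truncates, the coefficient is zero.\<close>

definition poly_diff :: "'j \<Rightarrow> 'j cpoly \<Rightarrow> 'j cpoly" where
  "poly_diff j p = (\<Sum>m\<in>Poly_Mapping.keys p. Poly_Mapping.single (m - Poly_Mapping.single j 1)
     (of_nat (Poly_Mapping.lookup m j) * Poly_Mapping.lookup p m))"

definition param_diff :: "'j \<Rightarrow> ('n, 'j) laurent \<Rightarrow> ('n, 'j) laurent" where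
  "param_diff j r = Poly_Mapping.map (poly_diff j) r"

text \<open>The logarithmic derivative \<open>x\<^sub>i \<partial>/\<partial>x\<^sub>i\<close>.\<close>

definition euler :: "'n \<Rightarrow> ('n, 'j) laurent \<Rightarrow> ('n, 'j) laurent" where
  "euler i r = Poly_Mapping.mapp (\<lambda>m c. of_int (Poly_Mapping.lookup m i) * c) r"

text \<open>Both operators satisfy the Leibniz rule, so that they extend to fractions.\<close>

lemma lookup_poly_diff:
  "Poly_Mapping.lookup (poly_diff j p) m =
     of_nat (Suc (Poly_Mapping.lookup m j)) * Poly_Mapping.lookup p (m + Poly_Mapping.single j 1)"
proof -
  let ?e = "Poly_Mapping.single j (1::nat)"
  have *: "(of_nat (Poly_Mapping.lookup k j) * Poly_Mapping.lookup p k when k - ?e = m) =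
      (of_nat (Suc (Poly_Mapping.lookup m j)) * Poly_Mapping.lookup p (m + ?e) when k = m + ?e)"
    for k
  proof (cases "Poly_Mapping.lookup k j = 0")
    case True
    then have "k \<noteq> m + ?e" by (auto simp: lookup_add)
    then show ?thesis using True by simp
  next
    case False
    have "k - ?e + ?e = k"
      using False by (intro poly_mapping_eqI) (auto simp: lookup_add lookup_minus lookup_single when_def)
    then have "k - ?e = m \<longleftrightarrow> k = m + ?e" by auto
    then show ?thesis by (auto simp: when_def lookup_add)
  qed
  have "Poly_Mapping.lookup (poly_diff j p) m = (\<Sum>k\<in>Poly_Mapping.keys p.
      (of_nat (Poly_Mapping.lookup k j) * Poly_Mapping.lookup p k when k - ?e = m))"
    by (simp add: poly_diff_def lookup_sum lookup_single)
  also have "\<dots> = of_nat (Suc (Poly_Mapping.lookup m j)) * Poly_Mapping.lookup p (m + ?e)"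
    unfolding * by (auto simp: when_def in_keys_iff)
  finally show ?thesis .
qed

lemma poly_diff_add: "poly_diff j (p + q) = poly_diff j p + poly_diff j q"
  by (intro poly_mapping_eqI) (simp only: lookup_poly_diff lookup_add distrib_left)

lemma poly_diff_0 [simp]: "poly_diff j 0 = 0"
  by (simp add: poly_diff_def)

lemma poly_diff_single:
  "poly_diff j (Poly_Mapping.single m c) =
     Poly_Mapping.single (m - Poly_Mapping.single j 1) (of_nat (Poly_Mapping.lookup m j) * c)"
  by (cases "c = 0") (simp_all add: poly_diff_def)

lemma pm_induct [case_names zero add]:
  assumes "P 0" and "\<And>m c p. P p \<Longrightarrow> P (Poly_Mapping.single m c + p)"
  shows "P (p :: 'a \<Rightarrow>\<^sub>0 'b::comm_monoid_add)"
proof (induction p rule: update_induct)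
  case const then show ?case by fact
next
  case (update f a b)
  have "Poly_Mapping.update a b f = Poly_Mapping.single a b + f"
    using update by (intro poly_mapping_eqI) (auto simp: lookup_update lookup_add lookup_single when_def in_keys_iff)
  then show ?case using assms(2) update by metis
qed

lemma poly_diff_mult: "poly_diff j (p * q) = poly_diff j p * q + p * poly_diff j q"
proof (induction p rule: pm_induct)
  case zero then show ?case by simp
next
  case (add m c p)
  have "poly_diff j (Poly_Mapping.single m c * q) =
      poly_diff j (Poly_Mapping.single m c) * q + Poly_Mapping.single m c * poly_diff j q"
  proof (induction q rule: pm_induct)
    case zero then show ?case by simp
  next
    case (add l d q)
    let ?e = "Poly_Mapping.single j (1::nat)"
    have 1: "of_nat (Poly_Mapping.lookup m j) = (0::complex) \<or> m - ?e + l = m + l - ?e"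
      by (cases "Poly_Mapping.lookup m j = 0")
         (auto intro!: poly_mapping_eqI simp: lookup_add lookup_minus lookup_single when_def)
    have 2: "of_nat (Poly_Mapping.lookup l j) = (0::complex) \<or> m + (l - ?e) = m + l - ?e"
      by (cases "Poly_Mapping.lookup l j = 0")
         (auto intro!: poly_mapping_eqI simp: lookup_add lookup_minus lookup_single when_def)
    have "poly_diff j (Poly_Mapping.single m c * Poly_Mapping.single l d) =
      poly_diff j (Poly_Mapping.single m c) * Poly_Mapping.single l d +
      Poly_Mapping.single m c * poly_diff j (Poly_Mapping.single l d)"
      using 1 2 by (auto simp: poly_diff_single mult_single lookup_add algebra_simps simp flip: single_add)
    then show ?case using add by (simp add: distrib_left poly_diff_add)
  qed
  then show ?case using add by (simp add: distrib_right poly_diff_add)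
qed

lemma lookup_param_diff:
  "Poly_Mapping.lookup (param_diff j r) m = poly_diff j (Poly_Mapping.lookup r m)"
  by (simp add: param_diff_def map.rep_eq when_def)

lemma param_diff_mult: "param_diff j (r * s) = param_diff j r * s + r * param_diff j s"
proof -
  have add: "param_diff j (r + s) = param_diff j r + param_diff j s" for r s
    by (intro poly_mapping_eqI) (simp add: lookup_param_diff lookup_add poly_diff_add)
  have zero [simp]: "param_diff j 0 = 0"
    by (intro poly_mapping_eqI) (simp add: lookup_param_diff)
  have sgl: "param_diff j (Poly_Mapping.single m c) = Poly_Mapping.single m (poly_diff j c)" for m c
    by (intro poly_mapping_eqI) (simp add: lookup_param_diff lookup_single when_def)
  have 1: "param_diff j (Poly_Mapping.single m c * s) =
      param_diff j (Poly_Mapping.single m c) * s + Poly_Mapping.single m c * param_diff j s" for m c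
    by (induction s rule: pm_induct)
      (simp_all add: add distrib_left distrib_right mult_single sgl poly_diff_mult single_add algebra_simps)
  show ?thesis
    by (induction r rule: pm_induct) (simp_all add: add distrib_left distrib_right 1 add_ac)
qed

lemma lookup_euler:
  "Poly_Mapping.lookup (euler i r) m = of_int (Poly_Mapping.lookup m i) * Poly_Mapping.lookup r m"
  by (simp add: euler_def lookup_mapp when_def in_keys_iff)

lemma euler_mult: "euler i (r * s) = euler i r * s + r * euler i s"
proof -
  have add: "euler i (r + s) = euler i r + euler i s" for r s
    by (intro poly_mapping_eqI) (simp add: lookup_euler lookup_add distrib_left)
  have zero [simp]: "euler i 0 = 0"
    by (intro poly_mapping_eqI) (simp add: lookup_euler)
  have sgl: "euler i (Poly_Mapping.single m c) =
      Poly_Mapping.single m (of_int (Poly_Mapping.lookup m i) * c)" for m c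
    by (intro poly_mapping_eqI) (simp add: lookup_euler lookup_single when_def)
  have 1: "euler i (Poly_Mapping.single m c * s) =
      euler i (Poly_Mapping.single m c) * s + Poly_Mapping.single m c * euler i s" for m c
    by (induction s rule: pm_induct)
      (simp_all add: add distrib_left distrib_right mult_single sgl lookup_add single_add algebra_simps)
  show ?thesis
    by (induction r rule: pm_induct) (simp_all add: add distrib_left distrib_right 1 add_ac)
qed


section \<open>Regular functions on the complement of the zero locus\<close>

text \<open>The localization of \<open>subtorus_ring\<close> at the powers of \<open>g\<close>, inside the field of fractions.\<close>

definition regular_fun ::
  "('n::{finite,linorder}, 'j::linorder) laurent \<Rightarrow> ('n, 'j) laurent fract set" where
  "regular_fun g = {to_fract r / to_fract g ^ k | r k. r \<in> subtorus_ring}"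

text \<open>The extension of a derivation to the field of fractions by the quotient rule; it is
  well defined by \<open>fract_deriv_Fract\<close> below, with \<open>euler_mult\<close> and \<open>param_diff_mult\<close>.\<close>

definition fract_deriv :: "('a::idom \<Rightarrow> 'a) \<Rightarrow> 'a fract \<Rightarrow> 'a fract" where
  "fract_deriv \<delta> q =
     (THE q'. \<exists>a b. b \<noteq> 0 \<and> q = Fract a b \<and> q' = Fract (\<delta> a * b - a * \<delta> b) (b * b))"

lemma quotient_identity:
  fixes a b c d :: "'a::idom"
  assumes "a * d = c * b" "a' * d + a * d' = c' * b + c * b'"
  shows "(c' * d - c * d') * (b * b) = (a' * b - a * b') * (d * d)"
proof -
  have "c' * b = a' * d + a * d' - c * b'"
    using assms(2) by (simp add: algebra_simps)
  moreover have "(c' * d - c * d') * (b * b) = (c' * b) * (b * d) - (c * b) * (b * d')"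
    by (simp add: algebra_simps)
  ultimately have "(c' * d - c * d') * (b * b) =
      (a' * d + a * d' - c * b') * (b * d) - (c * b) * (b * d')"
    by simp
  also have "\<dots> = (a' * d + a * d') * (b * d) - (c * b) * (b' * d) - (c * b) * (b * d')"
    by (simp add: algebra_simps)
  also have "\<dots> = (a' * b - a * b') * (d * d)"
    unfolding assms(1) [symmetric] by (simp add: algebra_simps)
  finally show ?thesis .
qed

lemma fract_deriv_Fract:
  fixes \<delta> :: "'a::idom \<Rightarrow> 'a"
  assumes leibniz: "\<And>r s. \<delta> (r * s) = \<delta> r * s + r * \<delta> s" and "b \<noteq> 0"
  shows "fract_deriv \<delta> (Fract a b) = Fract (\<delta> a * b - a * \<delta> b) (b * b)"
  unfolding fract_deriv_def
proof (rule the_equality)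
  show "\<exists>a' b'. b' \<noteq> 0 \<and> Fract a b = Fract a' b' \<and>
      Fract (\<delta> a * b - a * \<delta> b) (b * b) = Fract (\<delta> a' * b' - a' * \<delta> b') (b' * b')"
    using \<open>b \<noteq> 0\<close> by blast
next
  fix q'
  assume "\<exists>a' b'. b' \<noteq> 0 \<and> Fract a b = Fract a' b' \<and>
      q' = Fract (\<delta> a' * b' - a' * \<delta> b') (b' * b')"
  then obtain c d where "d \<noteq> 0" and eq: "Fract a b = Fract c d"
    and q': "q' = Fract (\<delta> c * d - c * \<delta> d) (d * d)" by blast
  have e: "a * d = c * b"
    using eq \<open>b \<noteq> 0\<close> \<open>d \<noteq> 0\<close> by (simp add: eq_fract)
  have "\<delta> a * d + a * \<delta> d = \<delta> c * b + c * \<delta> b"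
    using arg_cong [OF e, of \<delta>] by (simp add: leibniz)
  then have "(\<delta> c * d - c * \<delta> d) * (b * b) = (\<delta> a * b - a * \<delta> b) * (d * d)"
    using quotient_identity [of a d c b] e by blast
  then show "q' = Fract (\<delta> a * b - a * \<delta> b) (b * b)"
    using \<open>b \<noteq> 0\<close> \<open>d \<noteq> 0\<close> by (simp add: q' eq_fract)
qed


section \<open>Differential forms\<close>

text \<open>\<open>\<omega> $ I\<close> is the coefficient of \<open>\<omega>\<close> at \<open>dx\<^sub>i\<^sub>1/x\<^sub>i\<^sub>1 \<and> \<dots> \<and> dx\<^sub>i\<^sub>k/x\<^sub>i\<^sub>k\<close>, where \<open>I = {i\<^sub>1 < \<dots> < i\<^sub>k}\<close>.
  In particular \<open>axis {} r\<close> is \<open>r\<close> as a form of degree 0 and \<open>axis {i} 1\<close> is \<open>dx\<^sub>i/x\<^sub>i\<close>.\<close>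

type_synonym ('r, 'n) form = "('r, 'n set) vec"

text \<open>The forms of degree \<open>k\<close> in the \<open>dx\<^sub>i/x\<^sub>i\<close>, \<open>i \<in> S\<close>, with coefficients in \<open>R\<close>.\<close>

definition forms :: "'n set \<Rightarrow> 'r set \<Rightarrow> int \<Rightarrow> ('r::zero, 'n::finite) form set" where
  "forms S R k =
     {\<omega>. \<forall>I. \<omega> $ I \<in> R \<and> (\<omega> $ I \<noteq> 0 \<longrightarrow> I \<subseteq> S \<and> int (card I) = k)}"

definition wedge ::
  "('r::comm_ring_1, 'n::{finite,linorder}) form \<Rightarrow> ('r, 'n) form \<Rightarrow> ('r, 'n) form"
  (infixr \<open>\<and>\<^sub>f\<close> 70) where
  "\<eta> \<and>\<^sub>f \<omega> = (\<chi> K. \<Sum>I\<in>Pow K.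
     (- 1) ^ card {(i, j). i \<in> I \<and> j \<in> K - I \<and> j < i} * \<eta> $ I * \<omega> $ (K - I))"

text \<open>Exterior derivative in the variables \<open>x\<^sub>i\<close>, \<open>i \<in> S\<close>; \<open>\<theta> i\<close> is the operator
  \<open>x\<^sub>i \<partial>/\<partial>x\<^sub>i\<close> on functions.\<close>

definition ext_deriv ::
  "'n set \<Rightarrow> ('n \<Rightarrow> 'r \<Rightarrow> 'r) \<Rightarrow> ('r::comm_ring_1, 'n::{finite,linorder}) form \<Rightarrow> ('r, 'n) form"
  where
  "ext_deriv S \<theta> \<omega> = (\<Sum>i\<in>S. axis {i} 1 \<and>\<^sub>f (\<chi> K. \<theta> i (\<omega> $ K)))"


section \<open>The Weyl algebra\<close>

text \<open>The exponents \<open>'a free_word\<close> form the free monoid on \<open>'a\<close>, so that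
  \<open>'a free_word \<Rightarrow>\<^sub>0 complex\<close> is the free associative \<open>\<complex>\<close>-algebra on \<open>'a\<close>.\<close>

datatype 'a free_word = Free_Word (letters: "'a list")

instantiation free_word :: (type) monoid_add
begin

definition zero_free_word :: "'a free_word" where
  "0 = Free_Word []"

definition plus_free_word :: "'a free_word \<Rightarrow> 'a free_word \<Rightarrow> 'a free_word" where
  "u + v = Free_Word (letters u @ letters v)"

instance
  by standard (simp_all add: zero_free_word_def plus_free_word_def)

end

type_synonym 'a free_alg = "'a free_word \<Rightarrow>\<^sub>0 complex"

definition free_ring :: "'a free_alg ring" where
  "free_ring = \<lparr>carrier = UNIV, monoid.mult = (*), one = 1, zero = 0, add = (+)\<rparr>"

lemma ring_free_ring: "ring free_ring"
proof (rule ringI)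
  show "abelian_group (free_ring :: 'a free_alg ring)"
  proof (rule abelian_groupI)
    fix x :: "'a free_alg"
    show "\<exists>y\<in>carrier free_ring. y \<oplus>\<^bsub>free_ring\<^esub> x = \<zero>\<^bsub>free_ring\<^esub>"
      by (rule bexI [of _ "- x"]) (simp_all add: free_ring_def)
  qed (simp_all add: free_ring_def add_ac)
  show "Group.monoid (free_ring :: 'a free_alg ring)"
    by (rule monoidI) (simp_all add: free_ring_def mult.assoc)
qed (simp_all add: free_ring_def distrib_left distrib_right)

datatype 'j weyl_gen = Lam 'j | Par 'j

definition gen :: "'a \<Rightarrow> 'a free_alg" where
  "gen x = Poly_Mapping.single (Free_Word [x]) 1"

definition weyl_relations :: "'j weyl_gen free_alg set" where
  "weyl_relations =
     (\<Union>i j. {gen (Lam i) * gen (Lam j) - gen (Lam j) * gen (Lam i),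
             gen (Par i) * gen (Par j) - gen (Par j) * gen (Par i),
             gen (Par i) * gen (Lam j) - gen (Lam j) * gen (Par i) - (if i = j then 1 else 0)})"

definition weyl_algebra :: "'j weyl_gen free_alg set ring" where
  "weyl_algebra = free_ring Quot (Idl\<^bsub>free_ring\<^esub> weyl_relations)"

text \<open>The library only has modules over commutative rings.\<close>

locale left_module = R?: ring R + M?: abelian_group M
  for R (structure) and M :: "('a, 'b, 'c) module_scheme" (structure) +
  assumes smult_closed: "\<lbrakk>a \<in> carrier R; x \<in> carrier M\<rbrakk> \<Longrightarrow> a \<odot>\<^bsub>M\<^esub> x \<in> carrier M"
    and smult_l_distr: "\<lbrakk>a \<in> carrier R; b \<in> carrier R; x \<in> carrier M\<rbrakk> \<Longrightarrow>
      (a \<oplus>\<^bsub>R\<^esub> b) \<odot>\<^bsub>M\<^esub> x = (a \<odot>\<^bsub>M\<^esub> x) \<oplus>\<^bsub>M\<^esub> (b \<odot>\<^bsub>M\<^esub> x)"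
    and smult_r_distr: "\<lbrakk>a \<in> carrier R; x \<in> carrier M; y \<in> carrier M\<rbrakk> \<Longrightarrow>
      a \<odot>\<^bsub>M\<^esub> (x \<oplus>\<^bsub>M\<^esub> y) = (a \<odot>\<^bsub>M\<^esub> x) \<oplus>\<^bsub>M\<^esub> (a \<odot>\<^bsub>M\<^esub> y)"
    and smult_assoc: "\<lbrakk>a \<in> carrier R; b \<in> carrier R; x \<in> carrier M\<rbrakk> \<Longrightarrow>
      (a \<otimes>\<^bsub>R\<^esub> b) \<odot>\<^bsub>M\<^esub> x = a \<odot>\<^bsub>M\<^esub> (b \<odot>\<^bsub>M\<^esub> x)"
    and smult_one: "x \<in> carrier M \<Longrightarrow> \<one>\<^bsub>R\<^esub> \<odot>\<^bsub>M\<^esub> x = x"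

text \<open>Isomorphic as left \<open>R\<close>-modules; that both arguments are left \<open>R\<close>-modules is part of the
  definition.\<close>

definition left_module_isomorphic ::
  "('a, 'm) ring_scheme \<Rightarrow> ('a, 'b, 'c) module_scheme \<Rightarrow> ('a, 'd, 'e) module_scheme \<Rightarrow> bool"
  where
  "left_module_isomorphic R M N \<longleftrightarrow> left_module R M \<and> left_module R N \<and>
     (\<exists>\<phi>. bij_betw \<phi> (carrier M) (carrier N) \<and>
          (\<forall>x\<in>carrier M. \<forall>y\<in>carrier M. \<phi> (x \<oplus>\<^bsub>M\<^esub> y) = \<phi> x \<oplus>\<^bsub>N\<^esub> \<phi> y) \<and>
          (\<forall>P\<in>carrier R. \<forall>x\<in>carrier M. \<phi> (P \<odot>\<^bsub>M\<^esub> x) = P \<odot>\<^bsub>N\<^esub> \<phi> x))"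


section \<open>Cohomology\<close>

text \<open>The action on forms of an element of the free algebra, given the action \<open>act\<close> of the
  generators and the embedding \<open>\<iota>\<close> of \<open>\<complex>\<close> into the coefficient ring.\<close>

definition free_act ::
  "(complex \<Rightarrow> 'r) \<Rightarrow> ('a \<Rightarrow> ('r, 'n) form \<Rightarrow> ('r, 'n) form) \<Rightarrow> 'a free_alg
     \<Rightarrow> ('r, 'n) form \<Rightarrow> ('r::comm_ring_1, 'n::finite) form" where
  "free_act \<iota> act p \<omega> =
     (\<Sum>w\<in>Poly_Mapping.keys p. \<iota> (Poly_Mapping.lookup p w) *s foldr act (letters w) \<omega>)"

text \<open>The \<open>k\<close>-th cohomology of the complex \<open>(C, d)\<close>: the elements are cosets \<open>\<omega> + im d\<close> with
  \<open>d \<omega> = 0\<close>. An element \<open>P\<close> of a quotient of the free algebra is itself a coset, and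
  \<open>P \<odot> (\<omega> + im d)\<close> collects the cosets of \<open>p \<eta>\<close> over all representatives \<open>p\<close> of \<open>P\<close>
  and \<open>\<eta>\<close> of \<open>\<omega> + im d\<close> (compare \<open>rcoset_mult\<close>). The fields \<open>mult\<close> and \<open>one\<close>
  of the record play no role for modules.\<close>

definition cohomology ::
  "(int \<Rightarrow> ('r, 'n) form set) \<Rightarrow> (('r, 'n) form \<Rightarrow> ('r, 'n) form)
     \<Rightarrow> ('a free_alg \<Rightarrow> ('r, 'n) form \<Rightarrow> ('r, 'n) form) \<Rightarrow> int
     \<Rightarrow> ('a free_alg set, ('r::comm_ring_1, 'n::finite) form set) module" where
  "cohomology C d act k =
     \<lparr>carrier = {{\<omega> + \<beta> | \<beta>. \<beta> \<in> d ` C (k - 1)} | \<omega>. \<omega> \<in> C k \<and> d \<omega> = 0},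
      monoid.mult = undefined, one = undefined,
      zero = d ` C (k - 1),
      add = (\<lambda>X Y. {\<omega> + \<eta> | \<omega> \<eta>. \<omega> \<in> X \<and> \<eta> \<in> Y}),
      smult = (\<lambda>P X. {act p \<omega> + \<beta> | p \<omega> \<beta>. p \<in> P \<and> \<omega> \<in> X \<and> \<beta> \<in> d ` C (k - 1)})\<rparr>"


section \<open>The complex on the \<open>n\<close>-torus\<close>

definition torus_forms :: "int \<Rightarrow> (('n::{finite,linorder}, 'j) laurent, 'n) form set" where
  "torus_forms = forms UNIV UNIV"

definition torus_nabla ::
  "('j::finite \<Rightarrow> int ^ 'n::{finite,linorder}) \<Rightarrow> complex ^ 'n::{finite,linorder}
     \<Rightarrow> (('n, 'j) laurent, 'n) form \<Rightarrow> (('n, 'j) laurent, 'n) form" where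
  "torus_nabla a \<alpha> \<omega> =
     ext_deriv UNIV euler \<omega>
     + (\<Sum>i\<in>UNIV. lconst (\<alpha> $ i) *s (axis {i} 1 \<and>\<^sub>f \<omega>))
     + ext_deriv UNIV euler (axis {} (generic_laurent a)) \<and>\<^sub>f \<omega>"

primrec torus_gen_act ::
  "('j \<Rightarrow> int ^ 'n::{finite,linorder}) \<Rightarrow> 'j weyl_gen
     \<Rightarrow> (('n, 'j) laurent, 'n) form \<Rightarrow> (('n, 'j) laurent, 'n) form" where
  "torus_gen_act a (Lam j) = (\<lambda>\<omega>. lparam j *s \<omega>)"
| "torus_gen_act a (Par j) = (\<lambda>\<omega>. \<chi> K. param_diff j (\<omega> $ K) + lmonom (a j) * \<omega> $ K)"

definition torus_cohomology ::
  "('j::finite \<Rightarrow> int ^ 'n::{finite,linorder}) \<Rightarrow> complex ^ 'n::{finite,linorder} \<Rightarrow> int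
     \<Rightarrow> ('j weyl_gen free_alg set,
         (('n, 'j) laurent, 'n) form set) module" where
  "torus_cohomology a \<alpha> =
     cohomology torus_forms (torus_nabla a \<alpha>) (free_act lconst (torus_gen_act a))"


section \<open>The complex on the complement of the zero locus in the \<open>(n-1)\<close>-torus\<close>

definition open_forms ::
  "('n, 'j) laurent \<Rightarrow> int
     \<Rightarrow> (('n::{finite,linorder}, 'j::linorder) laurent fract, 'n) form set" where
  "open_forms g = forms (- {top_idx}) (regular_fun g)"

definition open_nabla ::
  "('n, 'j) laurent \<Rightarrow> complex ^ 'n::{finite,linorder}
     \<Rightarrow> (('n, 'j::linorder) laurent fract, 'n) form
     \<Rightarrow> (('n, 'j) laurent fract, 'n) form" where
  "open_nabla g \<alpha> \<omega> =
     (let d = ext_deriv (- {top_idx}) (\<lambda>i. fract_deriv (euler i)) in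
       d \<omega>
       + (\<Sum>i\<in>- {top_idx}. to_fract (lconst (\<alpha> $ i)) *s (axis {i} 1 \<and>\<^sub>f \<omega>))
       - to_fract (lconst (\<alpha> $ top_idx)) *s
           ((inverse (to_fract g) *s d (axis {} (to_fract g))) \<and>\<^sub>f \<omega>))"

primrec open_gen_act ::
  "('n, 'j) laurent \<Rightarrow> complex ^ 'n::{finite,linorder} \<Rightarrow> 'j weyl_gen
     \<Rightarrow> (('n, 'j::linorder) laurent fract, 'n) form
     \<Rightarrow> (('n, 'j) laurent fract, 'n) form" where
  "open_gen_act g \<alpha> (Lam j) = (\<lambda>\<omega>. to_fract (lparam j) *s \<omega>)"
| "open_gen_act g \<alpha> (Par j) =
     (\<lambda>\<omega>. \<chi> K. fract_deriv (param_diff j) (\<omega> $ K)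
        - to_fract (lconst (\<alpha> $ top_idx)) * (to_fract (param_diff j g) / to_fract g) * \<omega> $ K)"

definition open_cohomology ::
  "('n, 'j) laurent \<Rightarrow> complex ^ 'n::{finite,linorder} \<Rightarrow> int
     \<Rightarrow> ('j weyl_gen free_alg set,
         (('n, 'j::linorder) laurent fract, 'n) form set) module" where
  "open_cohomology g \<alpha> =
     cohomology (open_forms g) (open_nabla g \<alpha>)
       (free_act (\<lambda>c. to_fract (lconst c)) (open_gen_act g \<alpha>))"

end

theory Submission
  imports Defs
begin

text \<open>
  Let \<open>t\<close> be the top index and \<open>D\<^sub>i = x\<^sub>i \<partial>/\<partial>x\<^sub>i + \<alpha>\<^sub>i + x\<^sub>i \<partial>f/\<partial>x\<^sub>i\<close>, so that the complex on the
  \<open>n\<close>-torus is the Koszul complex of the commuting operators \<open>D\<^sub>i\<close>.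

  Nonresonance is used only through the existence of some \<open>\<alpha>\<^sub>i \<notin> \<int>\<close>: the cone of \<open>A\<close> has at least
  one facet, and its integral linear form would take an integral value on an integral \<open>\<alpha>\<close>.
  For such an \<open>i\<close>, on the graded pieces of the filtration by degree in \<open>x\<^sub>t\<close> the operator \<open>D\<^sub>i\<close>
  multiplies \<open>x\<^sup>u\<close> by \<open>u\<^sub>i + \<alpha>\<^sub>i \<noteq> 0\<close>. Contraction with \<open>x\<^sub>i \<partial>/\<partial>x\<^sub>i\<close> therefore shows that
  the cohomology does not change when the coefficients are restricted to the span \<open>P\<close> of the
  monomials of degree \<open>\<ge> m\<close> in \<open>x\<^sub>t\<close>.

  For \<open>m\<close> so large that \<open>k + \<alpha>\<^sub>t \<noteq> 0\<close> for all \<open>k \<ge> m\<close>, the operator \<open>D\<^sub>t\<close> is injective on \<open>P\<close>, and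
  its cokernel is identified with the ring of regular functions on \<open>U\<close> by sending \<open>b x\<^sub>t\<^sup>k\<close> to
  \<open>\<gamma>\<^sub>k b / g\<^sup>k\<close>, where \<open>\<gamma>\<^sub>k\<^sub>+\<^sub>1 = - (k + \<alpha>\<^sub>t) \<gamma>\<^sub>k\<close>. This map carries the \<open>D\<^sub>i\<close> for \<open>i \<noteq> t\<close>, and the
  action of the Weyl algebra, to the ones defining the complex on \<open>U\<close>.
\<close>

section \<open>A facet of the cone\<close>

text \<open>The reals form a vector space over the rationals in which 1 is independent, so the
  assignment of 1 to 1 extends to a rational-linear map. It will turn a real form vanishing on
  integral vectors into a rational one.\<close>

lemma exists_rational_functional:
  "\<exists>\<phi> :: real \<Rightarrow> real. \<phi> 1 = 1 \<and> (\<forall>x y. \<phi> (x + y) = \<phi> x + \<phi> y) \<and> range \<phi> \<subseteq> \<rat>"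
proof -
  interpret V: vector_space_pair "\<lambda>(q::rat) (x::real). of_rat q * x" "\<lambda>(q::rat) (x::rat). q * x"
    by unfold_locales (simp_all add: algebra_simps of_rat_add of_rat_mult)
  have "V.vs1.independent {1::real}"
    by (simp add: V.vs1.dependent_def)
  then obtain \<psi> :: "real \<Rightarrow> rat"
    where lin: "Vector_Spaces.linear (\<lambda>q x. of_rat q * x) (\<lambda>q x. q * x) \<psi>" and "\<psi> 1 = 1"
    using V.linear_independent_extend [of "{1}" "\<lambda>_. 1"] by auto
  then have "\<psi> (x + y) = \<psi> x + \<psi> y" for x y
    using V.linear_add by blast
  with \<open>\<psi> 1 = 1\<close> show ?thesis
    by (intro exI [of _ "\<lambda>x. of_rat (\<psi> x)"]) (auto simp: of_rat_add Rats_def)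
qed

text \<open>Take a form that vanishes at as many elements of \<open>S\<close> as possible. If its zeros did not span a
  hyperplane, it could be tilted, keeping its zeros, until it vanishes at a further element.\<close>

lemma exists_supporting_hyperplane:
  fixes S :: "'a::euclidean_space set"
  assumes "finite S" "span S = UNIV" and pos: "\<And>v. v \<in> S \<Longrightarrow> e \<bullet> v > 0"
  obtains l where "l \<noteq> 0" "\<And>v. v \<in> S \<Longrightarrow> l \<bullet> v \<ge> 0" "dim {v \<in> S. l \<bullet> v = 0} = DIM('a) - 1"
proof -
  define Z where "Z l = {v \<in> S. l \<bullet> v = 0}" for l
  define Q where "Q l \<longleftrightarrow> l \<noteq> 0 \<and> (\<forall>v\<in>S. l \<bullet> v \<ge> 0)" for l
  have "S \<noteq> {}"
    using \<open>span S = UNIV\<close> by auto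
  then have "Q e"
    using pos unfolding Q_def by (metis all_not_in_conv inner_zero_left less_eq_real_def less_irrefl)
  have "card (Z l) \<le> card S" for l
    unfolding Z_def using \<open>finite S\<close> by (intro card_mono) auto
  then obtain l where "Q l" and max: "\<And>l'. Q l' \<Longrightarrow> card (Z l') \<le> card (Z l)"
    using ex_has_greatest_nat [of Q e "\<lambda>l. card (Z l)" "Suc (card S)"] \<open>Q e\<close>
    by (metis less_Suc_eq_le)
  have "dim (Z l) \<le> dim {x. l \<bullet> x = 0}"
    unfolding Z_def by (intro dim_subset) auto
  then have upper: "dim (Z l) \<le> DIM('a) - 1"
    using \<open>Q l\<close> by (simp add: Q_def dim_hyperplane)
  have "\<not> dim (Z l) < DIM('a) - 1"
  proof
    assume "dim (Z l) < DIM('a) - 1"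
    \<comment> \<open>Including \<open>l\<close> makes the direction \<open>h\<close> orthogonal to
      \<open>l\<close> as well; this keeps the tilted form \<open>l'\<close> nonzero, through
      \<open>l' \<bullet> l = l \<bullet> l\<close>.\<close>
    then have "dim (insert l (Z l)) < DIM('a)"
      by (simp add: dim_insert less_diff_conv)
    then obtain h where "h \<noteq> 0" and h: "span (insert l (Z l)) \<subseteq> {x. h \<bullet> x = 0}"
      using lowdim_subset_hyperplane by blast
    have hl: "h \<bullet> l = 0" and hZ: "\<And>v. v \<in> Z l \<Longrightarrow> h \<bullet> v = 0"
      using h by (auto simp: span_base subset_iff)
    have "\<exists>v\<in>S. h \<bullet> v \<noteq> 0"
    proof (rule ccontr)
      assume "\<not> ?thesis"
      then have "h \<bullet> h = 0"
        using orthogonal_to_span [of h S h] \<open>span S = UNIV\<close> by (simp add: orthogonal_def)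
      with \<open>h \<noteq> 0\<close> show False by simp
    qed
    \<comment> \<open>The factor \<open>s\<close> adjusts the sign of \<open>h\<close>, so that the
      tilt decreases some value on \<open>S\<close>.\<close>
    then obtain s :: real where "\<exists>v\<in>S. (s *\<^sub>R h) \<bullet> v < 0"
      by (metis inner_minus_left linorder_neqE_linordered_idom neg_less_0_iff_less scaleR_minus_left scaleR_one)
    define k where "k = s *\<^sub>R h"
    define N where "N = {v \<in> S. k \<bullet> v < 0}"
    \<comment> \<open>The value of \<open>l + x *\<^sub>R k\<close> at \<open>v\<close> in
      \<open>N\<close> reaches zero at \<open>x = q v\<close>. Stopping at the least of these
      parameters keeps all values on \<open>S\<close> nonnegative and gains a new zero.\<close>
    define q where "q v = (l \<bullet> v) / - (k \<bullet> v)" for v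
    have "finite N" "N \<noteq> {}"
      using \<open>finite S\<close> \<open>\<exists>v\<in>S. (s *\<^sub>R h) \<bullet> v < 0\<close> by (auto simp: N_def k_def)
    then obtain w where "w \<in> N" and min: "\<And>v. v \<in> N \<Longrightarrow> q w \<le> q v"
      using finite_has_minimal [of "q ` N"]
      by (metis (no_types, lifting) finite_imageI image_iff image_is_empty linorder_linear)
    define l' where "l' = l + q w *\<^sub>R k"
    have "q w \<ge> 0"
      using \<open>w \<in> N\<close> \<open>Q l\<close> by (auto simp: q_def N_def Q_def intro!: divide_nonneg_neg)
    have kl: "k \<bullet> l = 0" and kZ: "\<And>v. v \<in> Z l \<Longrightarrow> k \<bullet> v = 0"
      using hl hZ by (simp_all add: k_def)
    have "l' \<bullet> l = l \<bullet> l"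
      by (simp add: l'_def inner_add_left kl)
    then have "l' \<noteq> 0"
      using \<open>Q l\<close> by (auto simp: Q_def)
    moreover have "l' \<bullet> v \<ge> 0" if "v \<in> S" for v
    proof (cases "v \<in> N")
      case True
      have "q w * - (k \<bullet> v) \<le> q v * - (k \<bullet> v)"
        using min [OF True] True by (intro mult_right_mono) (simp_all add: N_def)
      also have "\<dots> = l \<bullet> v"
        using True by (simp add: q_def N_def)
      finally have "q w * - (k \<bullet> v) \<le> l \<bullet> v" .
      then show ?thesis by (simp add: l'_def inner_add_left)
    next
      case False
      then show ?thesis
        using that \<open>Q l\<close> \<open>q w \<ge> 0\<close> by (simp add: l'_def inner_add_left N_def Q_def)
    qed
    ultimately have "Q l'" by (simp add: Q_def)
    have "l' \<bullet> w = 0"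
      using \<open>w \<in> N\<close> by (simp add: l'_def inner_add_left inner_diff_left q_def N_def)
    then have "insert w (Z l) \<subseteq> Z l'"
      using kZ \<open>w \<in> N\<close> by (auto simp: Z_def l'_def inner_add_left N_def)
    moreover have "w \<notin> Z l"
      using kZ \<open>w \<in> N\<close> by (auto simp: N_def)
    moreover have "finite (Z x)" for x
      using \<open>finite S\<close> by (simp add: Z_def)
    ultimately have "card (Z l) < card (Z l')"
      by (metis card_mono card_insert_disjoint less_eq_Suc_le)
    with max [OF \<open>Q l'\<close>] show False by simp
  qed
  with upper have "dim (Z l) = DIM('a) - 1" by simp
  then show thesis
    using that \<open>Q l\<close> by (auto simp: Q_def Z_def)
qed

section \<open>Integral vectors and rational forms\<close>

definition rvec :: "int ^ 'n \<Rightarrow> real ^ 'n::finite" where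
  "rvec v = (\<chi> i. real_of_int (v $ i))"

lemma rvec_nth [simp]: "rvec v $ i = real_of_int (v $ i)"
  by (simp add: rvec_def)

text \<open>The span is closed under the differences that generate the group, so it contains all
  integral vectors, in particular the standard basis.\<close>

lemma span_rvec_eq_UNIV:
  fixes A :: "(int ^ 'n::finite) set"
  assumes "group_closure A = UNIV"
  shows "span (rvec ` A) = UNIV"
proof -
  have "rvec v \<in> span (rvec ` A)" for v
  proof -
    have "v \<in> group_closure A" using assms by simp
    then show ?thesis
    proof (induction v rule: group_closure.induct)
      case (base s)
      moreover have "rvec (0 :: int ^ 'n) = 0" by (simp add: vec_eq_iff)
      ultimately show ?case by (auto intro: span_base span_zero)
    next
      case (diff s t)
      moreover have "rvec (s - t) = rvec s - rvec t" by (simp add: vec_eq_iff)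
      ultimately show ?case by (simp add: span_diff)
    qed
  qed
  moreover have "rvec (axis i 1) = axis i 1" for i :: 'n
    by (simp add: vec_eq_iff axis_def)
  ultimately have "Basis \<subseteq> span (rvec ` A)"
    by (auto simp: Basis_vec_def) metis
  then show ?thesis
    by (metis span_Basis span_mono span_span top.extremum_uniqueI)
qed

text \<open>The orthogonal complement of a hyperplane is a line: after subtracting from
  \<open>w\<close> its projection on \<open>l\<close>, the remainder is orthogonal to
  \<open>l\<close> and to \<open>Z\<close>, which together span the space.\<close>

lemma orthogonal_multiple:
  fixes l w :: "'a::euclidean_space"
  assumes "l \<noteq> 0" "\<And>v. v \<in> Z \<Longrightarrow> l \<bullet> v = 0" "\<And>v. v \<in> Z \<Longrightarrow> w \<bullet> v = 0" "dim Z = DIM('a) - 1"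
  obtains c where "w = c *\<^sub>R l"
proof -
  define w' where "w' = w - ((w \<bullet> l) / (l \<bullet> l)) *\<^sub>R l"
  have "l \<notin> span Z"
    using orthogonal_to_span [of l Z l] assms(1,2) by (auto simp: orthogonal_def)
  then have "dim (insert l Z) = DIM('a)"
    using assms(4) by (simp add: dim_insert)
  then have "span (insert l Z) = UNIV"
    using dim_eq_full by blast
  moreover have "w' \<bullet> v = 0" if "v \<in> insert l Z" for v
    using that assms(1-3) by (auto simp: w'_def inner_diff_left)
  ultimately have "w' \<bullet> w' = 0"
    using orthogonal_to_span [of w' "insert l Z" w'] by (auto simp: orthogonal_def)
  then show thesis
    using that [of "(w \<bullet> l) / (l \<bullet> l)"] by (simp add: w'_def)
qed

text \<open>A supporting hyperplane spanned by elements of \<open>A\<close> is cut out by a form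
  proportional to a rational one; clearing denominators and dividing by the greatest common divisor
  normalizes it. The coordinate \<open>t\<close>, positive on \<open>A\<close>, is the form from
  which the search for the hyperplane starts.\<close>

lemma exists_facet_form:
  fixes A :: "(int ^ 'n::finite) set"
  assumes "finite A" and gen: "group_closure A = UNIV" and pos: "\<And>v. v \<in> A \<Longrightarrow> v $ t > 0"
  obtains l where "facet_form A l"
proof -
  define S where "S = rvec ` A"
  have "finite S" "span S = UNIV"
    using assms by (simp_all add: S_def span_rvec_eq_UNIV)
  have "axis t 1 \<bullet> v > 0" if "v \<in> S" for v
    using that pos by (auto simp: S_def inner_axis')
  from exists_supporting_hyperplane [OF \<open>finite S\<close> \<open>span S = UNIV\<close> this]
  obtain l where "l \<noteq> 0" and l: "\<And>v. v \<in> S \<Longrightarrow> l \<bullet> v \<ge> 0"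
    and dimZ: "dim {v \<in> S. l \<bullet> v = 0} = DIM(real ^ 'n) - 1"
    by blast
  define Z where "Z = {v \<in> S. l \<bullet> v = 0}"
  obtain i where i: "l $ i \<noteq> 0"
    using \<open>l \<noteq> 0\<close> by (auto simp: vec_eq_iff)
  obtain \<phi> :: "real \<Rightarrow> real" where "\<phi> 1 = 1" and add: "\<And>x y. \<phi> (x + y) = \<phi> x + \<phi> y"
    and "range \<phi> \<subseteq> \<rat>"
    using exists_rational_functional by blast
  interpret \<phi>: Modules.additive \<phi> by standard (fact add)
  have smult_nat: "\<phi> (of_nat m * x) = of_nat m * \<phi> x" for m x
    by (induction m) (simp_all add: distrib_right add \<phi>.zero)
  have smult: "\<phi> (of_int m * x) = of_int m * \<phi> x" for m x
    using smult_nat by (cases m) (simp_all add: \<phi>.minus del: of_nat_Suc)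
  \<comment> \<open>As \<open>Z\<close> consists of integral vectors, \<open>w\<close> is again orthogonal to \<open>Z\<close>, hence a multiple of
    \<open>l\<close>; this shows that \<open>l / l\<^sub>i\<close> is rational.\<close>
  define w :: "real ^ 'n" where "w = (\<chi> k. \<phi> (l $ k / l $ i))"
  have "w \<bullet> v = 0" if v: "v \<in> Z" for v
  proof -
    obtain u :: "int ^ 'n" where "v = rvec u" and "l \<bullet> v = 0"
      using v unfolding Z_def S_def by blast
    have "w \<bullet> v = (\<Sum>k\<in>UNIV. \<phi> (of_int (u $ k) * (l $ k / l $ i)))"
      by (simp only: smult) (simp add: inner_vec_def w_def \<open>v = rvec u\<close> mult.commute)
    also have "\<dots> = \<phi> (\<Sum>k\<in>UNIV. of_int (u $ k) * (l $ k / l $ i))"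
      by (simp add: \<phi>.sum)
    also have "(\<Sum>k\<in>UNIV. of_int (u $ k) * (l $ k / l $ i)) = (l \<bullet> v) / l $ i"
      by (simp add: inner_vec_def \<open>v = rvec u\<close> sum_divide_distrib mult.commute)
    finally show ?thesis using \<open>l \<bullet> v = 0\<close> \<phi>.zero by simp
  qed
  then obtain c where c: "w = c *\<^sub>R l"
    using orthogonal_multiple [of l Z w] \<open>l \<noteq> 0\<close> dimZ unfolding Z_def by blast
  have "w $ i = 1"
    by (simp add: w_def i \<open>\<phi> 1 = 1\<close>)
  then have "l $ i * c = 1"
    using c by (simp add: mult.commute)
  then have w: "l = (l $ i) *\<^sub>R w"
    by (metis c scaleR_one scaleR_scaleR)
  have "w $ k \<in> \<rat>" for k
    using \<open>range \<phi> \<subseteq> \<rat>\<close> by (auto simp: w_def)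
  then have "\<exists>q::rat. w $ k = of_rat q" for k
    by (auto elim: Rats_cases)
  then obtain q where q: "\<And>k. w $ k = of_rat (q k :: rat)"
    by metis
  define d where "d k = snd (quotient_of (q k))" for k
  define D where "D = (\<Prod>k\<in>UNIV. d k)"
  have d: "d k > 0" for k
    by (simp add: d_def quotient_of_denom_pos')
  then have "D > 0"
    by (simp add: D_def prod_pos)
  have "\<exists>m. real_of_int D * w $ k = of_int m" for k
  proof -
    have "D = d k * (\<Prod>k\<in>UNIV - {k}. d k)"
      by (simp add: D_def prod.remove)
    then have "real_of_int D * w $ k = (real_of_int (d k) * w $ k) * of_int (\<Prod>k\<in>UNIV - {k}. d k)"
      by (simp only: of_int_mult mult_ac)
    also have "real_of_int (d k) * w $ k = of_int (fst (quotient_of (q k)))"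
    proof -
      have "of_int (d k) * q k = of_int (fst (quotient_of (q k)))"
        using quotient_of_div [of "q k"] d [of k]
        by (metis d_def nonzero_mult_div_cancel_left of_int_0_eq_iff order_less_irrefl prod.collapse times_divide_eq_right)
      then have "of_rat (of_int (d k) * q k) = (of_rat (of_int (fst (quotient_of (q k)))) :: real)"
        by simp
      then show ?thesis by (simp add: of_rat_mult q)
    qed
    finally show ?thesis
      by (metis of_int_mult)
  qed
  then obtain m where m: "\<And>k. real_of_int D * w $ k = of_int (m k)"
    by metis
  \<comment> \<open>The sign compensates for that of \<open>l $ i\<close> in
    \<open>l = (l $ i) *\<^sub>R w\<close>, so that \<open>p\<close> is a positive multiple of
    \<open>l\<close> and stays nonnegative on the cone.\<close>
  define p :: "int ^ 'n" where "p = (\<chi> k. sgn (if l $ i > 0 then 1 else -1) * m k)"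
  have p: "rvec p = (D / \<bar>l $ i\<bar>) *\<^sub>R l"
    using i by (subst w) (auto simp: vec_eq_iff p_def m [symmetric] abs_if)
  have "p $ i \<noteq> 0"
    using arg_cong [OF p, of "\<lambda>v. v $ i"] i \<open>D > 0\<close> by auto
  define G where "G = (GCD k\<in>UNIV. p $ k)"
  have dvd: "G dvd p $ k" for k
    by (simp add: G_def)
  have "G > 0"
    using dvd [of i] \<open>p $ i \<noteq> 0\<close> by (metis G_def Gcd_int_greater_eq_0 dvd_0_left_iff order_le_less)
  define L :: "int ^ 'n" where "L = (\<chi> k. p $ k div G)"
  have pL: "p $ k = G * L $ k" for k
    using dvd by (simp add: L_def)
  have "G = Gcd (range (\<lambda>k. G * L $ k))"
    using pL by (metis (no_types, lifting) G_def image_cong)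
  also have "\<dots> = normalize (G * (GCD k\<in>UNIV. L $ k))"
    using Gcd_mult [of G "range (($) L)"] by (simp only: image_image)
  finally have "G = G * (GCD k\<in>UNIV. L $ k)"
    using \<open>G > 0\<close> by (simp add: abs_mult)
  then have gcd: "(GCD k\<in>UNIV. L $ k) = 1"
    using \<open>G > 0\<close> by simp
  define r where "r = D / \<bar>l $ i\<bar> / G"
  have "r > 0"
    using \<open>D > 0\<close> \<open>G > 0\<close> i by (simp add: r_def)
  have L: "rvec L = r *\<^sub>R l"
  proof -
    have "rvec L $ k = rvec p $ k / G" for k
      using \<open>G > 0\<close> by (simp add: pL)
    then show ?thesis
      unfolding p by (simp add: vec_eq_iff r_def)
  qed
  have eq: "(\<Sum>k\<in>UNIV. of_int (L $ k) * u $ k) = r * (l \<bullet> u)" for u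
  proof -
    have "(\<Sum>k\<in>UNIV. of_int (L $ k) * u $ k) = rvec L \<bullet> u"
      by (simp add: inner_vec_def)
    then show ?thesis by (simp add: L)
  qed
  define C where "C = real_cone A"
  have C: "C = convex_cone hull S"
    by (simp add: C_def real_cone_def S_def rvec_def)
  have "convex_cone hull S \<subseteq> {u. l \<bullet> u \<ge> 0}"
    by (rule hull_minimal)
      (auto simp: l convex_cone_def conic_def inner_add_right intro: convex_halfspace_ge exI [of _ 0])
  then have nonneg: "l \<bullet> u \<ge> 0" if "u \<in> C" for u
    using that C by blast
  have "S \<subseteq> C"
    by (simp add: C hull_subset)
  have "convex C" "0 \<in> C"
    by (simp_all add: C convex_convex_cone_hull convex_cone_hull_contains_0)
  define F where "F = C \<inter> {u. l \<bullet> u = 0}"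
  have "F face_of C"
    unfolding F_def using \<open>convex C\<close> nonneg by (rule face_of_Int_supporting_hyperplane_ge)
  have "0 \<in> F"
    using \<open>0 \<in> C\<close> by (simp add: F_def)
  \<comment> \<open>\<open>F\<close> lies between \<open>Z\<close> and the hyperplane, which have
    the same dimension. As \<open>F\<close> and \<open>C\<close> contain 0, their affine dimensions
    are their linear ones.\<close>
  have "dim F \<le> dim {u. l \<bullet> u = 0}" "dim Z \<le> dim F"
    using \<open>S \<subseteq> C\<close> by (auto simp: F_def Z_def intro!: dim_subset)
  then have "dim F = DIM(real ^ 'n) - 1"
    using dimZ \<open>l \<noteq> 0\<close> by (simp add: dim_hyperplane Z_def)
  moreover have "dim C = DIM(real ^ 'n)"
    using \<open>S \<subseteq> C\<close> \<open>span S = UNIV\<close> dim_eq_full [of C] span_mono by blast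
  ultimately have "F facet_of C"
    using \<open>F face_of C\<close> \<open>0 \<in> F\<close> \<open>0 \<in> C\<close> zero_less_card_finite [where ?'a = 'n]
    by (auto simp: facet_of_def aff_dim_zero hull_inc of_nat_diff)
  moreover have "{u \<in> C. (\<Sum>k\<in>UNIV. of_int (L $ k) * u $ k) = 0} = F"
    using \<open>r > 0\<close> by (auto simp: eq F_def)
  ultimately have "facet_form A L"
    using gcd nonneg \<open>r > 0\<close> by (simp add: facet_form_def eq flip: C_def)
  then show thesis by (rule that)
qed

lemma nonresonant_imp_not_Ints:
  assumes "finite A" "group_closure A = UNIV" "\<And>v. v \<in> A \<Longrightarrow> v $ t > 0" "nonresonant A \<alpha>"
  obtains i where "\<alpha> $ i \<notin> \<int>"
proof -
  obtain l where "facet_form A l"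
    using exists_facet_form assms(1-3) by blast
  then have "(\<Sum>i\<in>UNIV. of_int (l $ i) * \<alpha> $ i) \<notin> \<int>"
    using assms(4) by (simp add: nonresonant_def)
  then show thesis
    using that by (meson Ints_mult Ints_of_int Ints_sum)
qed

section \<open>Modules over the Weyl algebra from complexes\<close>

text \<open>The laws are required only on the forms of the complex, so that the same
  \<open>d\<close> and \<open>act\<close> can be used on subcomplexes with restricted coefficients.
  The free algebra acts and the relations act as zero, which is what makes the Weyl algebra act on
  cohomology.\<close>

locale weyl_complex =
  fixes C :: "int \<Rightarrow> ('r::comm_ring_1, 'n::finite) form set"
    and d :: "('r, 'n) form \<Rightarrow> ('r, 'n) form"
    and act :: "'j weyl_gen free_alg \<Rightarrow> ('r, 'n) form \<Rightarrow> ('r, 'n) form"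
  assumes zero_mem: "0 \<in> C k"
    and add_mem: "\<omega> \<in> C k \<Longrightarrow> \<eta> \<in> C k \<Longrightarrow> \<omega> + \<eta> \<in> C k"
    and uminus_mem: "\<omega> \<in> C k \<Longrightarrow> - \<omega> \<in> C k"
    and d_mem: "\<omega> \<in> C k \<Longrightarrow> d \<omega> \<in> C (k + 1)"
    and d_add: "\<omega> \<in> C k \<Longrightarrow> \<eta> \<in> C k \<Longrightarrow> d (\<omega> + \<eta>) = d \<omega> + d \<eta>"
    and act_mem: "\<omega> \<in> C k \<Longrightarrow> act p \<omega> \<in> C k"
    and act_add: "\<omega> \<in> C k \<Longrightarrow> \<eta> \<in> C k \<Longrightarrow> act p (\<omega> + \<eta>) = act p \<omega> + act p \<eta>"
    and d_act: "\<omega> \<in> C k \<Longrightarrow> d (act p \<omega>) = act p (d \<omega>)"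
    and act_plus: "\<omega> \<in> C k \<Longrightarrow> act (p + q) \<omega> = act p \<omega> + act q \<omega>"
    and act_times: "\<omega> \<in> C k \<Longrightarrow> act (p * q) \<omega> = act p (act q \<omega>)"
    and act_one: "\<omega> \<in> C k \<Longrightarrow> act 1 \<omega> = \<omega>"
    and act_relation: "\<omega> \<in> C k \<Longrightarrow> p \<in> weyl_relations \<Longrightarrow> act p \<omega> = 0"
begin

section \<open>Exact forms and cohomology classes\<close>

lemma d_zero [simp]: "d 0 = 0"
  using d_add [OF zero_mem zero_mem] by simp

lemma act_zero [simp]: "act p 0 = 0"
  using act_add [OF zero_mem zero_mem] by simp

lemma d_uminus: "\<omega> \<in> C k \<Longrightarrow> d (- \<omega>) = - d \<omega>"
  using d_add [OF _ uminus_mem] by (metis add.right_inverse d_zero minus_unique)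

lemma diff_mem: "\<omega> \<in> C k \<Longrightarrow> \<eta> \<in> C k \<Longrightarrow> \<omega> - \<eta> \<in> C k"
  using add_mem [OF _ uminus_mem] by (metis diff_conv_add_uminus)

lemma d_diff: "\<omega> \<in> C k \<Longrightarrow> \<eta> \<in> C k \<Longrightarrow> d (\<omega> - \<eta>) = d \<omega> - d \<eta>"
  using d_add [OF _ uminus_mem] d_uminus by (metis diff_conv_add_uminus)

definition coset :: "int \<Rightarrow> ('r, 'n) form \<Rightarrow> ('r, 'n) form set" where
  "coset k \<omega> = {\<omega> + \<beta> | \<beta>. \<beta> \<in> d ` C (k - 1)}"

lemma exact_mem: "\<beta> \<in> d ` C (k - 1) \<Longrightarrow> \<beta> \<in> C k"
  using d_mem [of _ "k - 1"] by auto

lemma exact_zero: "0 \<in> d ` C (k - 1)"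
  using zero_mem by (metis d_zero image_eqI)

lemma exact_add: "\<beta> \<in> d ` C k \<Longrightarrow> \<gamma> \<in> d ` C k \<Longrightarrow> \<beta> + \<gamma> \<in> d ` C k"
  by (auto simp: image_iff) (metis add_mem d_add)

lemma exact_uminus: "\<beta> \<in> d ` C k \<Longrightarrow> - \<beta> \<in> d ` C k"
  by (auto simp: image_iff) (metis uminus_mem d_uminus)

lemma exact_act: "\<beta> \<in> d ` C k \<Longrightarrow> act p \<beta> \<in> d ` C k"
  by (auto simp: image_iff) (metis act_mem d_act)

lemma coset_self: "\<omega> \<in> coset k \<omega>"
  using exact_zero by (auto simp: coset_def)

lemma coset_eq_iff: "coset k \<omega> = coset k \<eta> \<longleftrightarrow> \<omega> - \<eta> \<in> d ` C (k - 1)"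
proof
  assume "coset k \<omega> = coset k \<eta>"
  then have "\<omega> \<in> coset k \<eta>"
    using coset_self by blast
  then show "\<omega> - \<eta> \<in> d ` C (k - 1)"
    by (auto simp: coset_def)
next
  assume *: "\<omega> - \<eta> \<in> d ` C (k - 1)"
  have sub: "coset k x \<subseteq> coset k y" if "x - y \<in> d ` C (k - 1)" for x y
  proof
    fix z assume "z \<in> coset k x"
    then obtain \<beta> where "\<beta> \<in> d ` C (k - 1)" "z = x + \<beta>"
      by (auto simp: coset_def)
    then show "z \<in> coset k y"
      using exact_add [OF that, of \<beta>] unfolding coset_def
      by (intro CollectI exI [of _ "x - y + \<beta>"]) simp
  qed
  have "\<eta> - \<omega> \<in> d ` C (k - 1)"
    using exact_uminus [OF *] by simp
  with sub * show "coset k \<omega> = coset k \<eta>" by blast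
qed

lemma carrier_cohomology:
  "carrier (cohomology C d act k) = coset k ` {\<omega> \<in> C k. d \<omega> = 0}"
  by (auto simp: cohomology_def coset_def)

lemma zero_cohomology: "\<zero>\<^bsub>cohomology C d act k\<^esub> = coset k 0"
  by (simp add: cohomology_def coset_def)

lemma add_cohomology: "coset k \<omega> \<oplus>\<^bsub>cohomology C d act k\<^esub> coset k \<eta> = coset k (\<omega> + \<eta>)"
proof -
  have "\<exists>\<gamma>. \<omega> + \<beta> + (\<eta> + \<beta>') = \<omega> + \<eta> + \<gamma> \<and> \<gamma> \<in> d ` C (k - 1)"
    if "\<beta> \<in> d ` C (k - 1)" "\<beta>' \<in> d ` C (k - 1)" for \<beta> \<beta>'
    using exact_add [OF that] by (intro exI [of _ "\<beta> + \<beta>'"]) (simp add: algebra_simps)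
  moreover have "\<exists>x y. \<omega> + \<eta> + \<beta> = x + y \<and> x \<in> coset k \<omega> \<and> y \<in> coset k \<eta>"
    if "\<beta> \<in> d ` C (k - 1)" for \<beta>
    using that coset_self [of \<omega> k]
    by (intro exI [of _ \<omega>] exI [of _ "\<eta> + \<beta>"]) (auto simp: coset_def add.assoc)
  ultimately show ?thesis
    by (auto simp: cohomology_def coset_def)
qed

abbreviation relation_ideal :: "'j weyl_gen free_alg set" where
  "relation_ideal \<equiv> Idl\<^bsub>free_ring\<^esub> weyl_relations"

text \<open>The elements acting as zero on all forms of the complex constitute a two-sided ideal,
  and it contains the relations.\<close>

lemma act_relation_ideal:
  assumes "h \<in> relation_ideal" "\<omega> \<in> C k"
  shows "act h \<omega> = 0"
proof -
  interpret F: ring "free_ring :: 'j weyl_gen free_alg ring"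
    by (rule ring_free_ring)
  define K where "K = {p. \<forall>k. \<forall>\<omega>\<in>C k. act p \<omega> = 0}"
  have act_0: "act 0 \<eta> = 0" if "\<eta> \<in> C k" for \<eta> k
    using act_plus [OF that, of 0 0] by simp
  have act_uminus: "act (- p) \<eta> = - act p \<eta>" if "\<eta> \<in> C k" for p \<eta> k
    using act_plus [OF that, of "- p" p] act_0 [OF that] by (simp add: eq_neg_iff_add_eq_0)
  have "ideal K free_ring"
  proof (rule idealI [OF ring_free_ring])
    show "subgroup K (add_monoid free_ring)"
    proof (rule group.subgroupI)
      show "Group.group (add_monoid (free_ring :: 'j weyl_gen free_alg ring))"
        by (rule F.a_group)
      fix p assume "p \<in> K"
      have "inv\<^bsub>add_monoid free_ring\<^esub> p = - p"
        using F.minus_equality [of "- p" p] by (simp add: free_ring_def a_inv_def)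
      then show "inv\<^bsub>add_monoid free_ring\<^esub> p \<in> K"
        using \<open>p \<in> K\<close> act_uminus by (auto simp: K_def)
    qed (use act_0 act_plus in \<open>auto simp: K_def free_ring_def\<close>)
  next
    fix p q :: "'j weyl_gen free_alg"
    assume "p \<in> K"
    then have p: "act p \<eta> = 0" if "\<eta> \<in> C k" for \<eta> k
      using that by (auto simp: K_def)
    show "q \<otimes>\<^bsub>free_ring\<^esub> p \<in> K"
      by (simp add: K_def free_ring_def act_times p)
    show "p \<otimes>\<^bsub>free_ring\<^esub> q \<in> K"
      using p [OF act_mem] by (simp add: K_def free_ring_def act_times)
  qed
  then have "relation_ideal \<subseteq> K"
    by (rule F.genideal_minimal) (use act_relation in \<open>auto simp: K_def\<close>)
  with assms show ?thesis by (auto simp: K_def)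
qed

text \<open>Changing the representative \<open>p\<close> adds an element of the ideal, which acts as
  zero; changing \<open>\<omega>\<close> adds an exact form, which stays exact under the action. So
  the product collected over all representatives is a single coset.\<close>

lemma smult_cohomology:
  assumes "\<omega> \<in> C k"
  shows "(relation_ideal +>\<^bsub>free_ring\<^esub> p) \<odot>\<^bsub>cohomology C d act k\<^esub> coset k \<omega> = coset k (act p \<omega>)"
proof -
  interpret F: ring "free_ring :: 'j weyl_gen free_alg ring"
    by (rule ring_free_ring)
  interpret I: ideal relation_ideal free_ring
    by (rule F.genideal_ideal) (simp add: free_ring_def)
  have coset: "relation_ideal +>\<^bsub>free_ring\<^esub> p = {h + p | h. h \<in> relation_ideal}"
    by (auto simp: a_r_coset_def' free_ring_def)
  have act: "act (h + p) (\<omega> + \<beta>) = act p \<omega> + act p \<beta>"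
    if "h \<in> relation_ideal" "\<beta> \<in> C k" for h \<beta>
    using that assms act_relation_ideal by (simp add: act_plus add_mem act_add)
  have "act q \<omega>' + \<gamma> \<in> coset k (act p \<omega>)"
    if q: "q \<in> relation_ideal +>\<^bsub>free_ring\<^esub> p" and \<omega>': "\<omega>' \<in> coset k \<omega>" and "\<gamma> \<in> d ` C (k - 1)" for q \<omega>' \<gamma>
  proof -
    obtain h where "h \<in> relation_ideal" "q = h + p"
      using q coset by blast
    moreover obtain \<beta> where "\<beta> \<in> d ` C (k - 1)" "\<omega>' = \<omega> + \<beta>"
      using \<omega>' by (auto simp: coset_def)
    ultimately have "act q \<omega>' + \<gamma> = act p \<omega> + (act p \<beta> + \<gamma>)" "act p \<beta> + \<gamma> \<in> d ` C (k - 1)"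
      using act exact_mem exact_act exact_add that(3) by (auto simp: add.assoc)
    then show ?thesis by (auto simp: coset_def)
  qed
  moreover have "\<exists>q \<omega>' \<gamma>. act p \<omega> + \<beta> = act q \<omega>' + \<gamma> \<and> q \<in> relation_ideal +>\<^bsub>free_ring\<^esub> p \<and>
      \<omega>' \<in> coset k \<omega> \<and> \<gamma> \<in> d ` C (k - 1)" if "\<beta> \<in> d ` C (k - 1)" for \<beta>
  proof -
    have "p \<in> relation_ideal +>\<^bsub>free_ring\<^esub> p"
      using I.zero_closed by (simp only: coset mem_Collect_eq) (metis add_0 free_ring_def ring.select_convs(1))
    then show ?thesis using that coset_self by blast
  qed
  ultimately show ?thesis
    by (auto simp: cohomology_def coset_def [of _ "act p \<omega>"])
qed

lemma weyl_algebra_cases: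
  assumes "P \<in> carrier weyl_algebra"
  obtains p where "P = relation_ideal +>\<^bsub>free_ring\<^esub> p"
  using assms by (auto simp: weyl_algebra_def FactRing_def A_RCOSETS_def' free_ring_def)

lemma cohomology_cases:
  assumes "X \<in> carrier (cohomology C d act k)"
  obtains \<omega> where "\<omega> \<in> C k" "d \<omega> = 0" "X = coset k \<omega>"
  using assms by (auto simp: carrier_cohomology)

lemma coset_mem_carrier:
  "\<omega> \<in> C k \<Longrightarrow> d \<omega> = 0 \<Longrightarrow> coset k \<omega> \<in> carrier (cohomology C d act k)"
  by (simp add: carrier_cohomology)

lemma left_module_cohomology: "left_module weyl_algebra (cohomology C d act k)"
proof -
  let ?H = "cohomology C d act k"
  interpret F: ring "free_ring :: 'j weyl_gen free_alg ring"
    by (rule ring_free_ring)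
  interpret I: ideal relation_ideal free_ring
    by (rule F.genideal_ideal) (simp add: free_ring_def)
  interpret W: ring "weyl_algebra :: 'j weyl_gen free_alg set ring"
    unfolding weyl_algebra_def by (rule I.quotient_is_ring)
  have hom: "(+>\<^bsub>free_ring\<^esub>) relation_ideal \<in> ring_hom free_ring weyl_algebra"
    unfolding weyl_algebra_def by (rule I.rcos_ring_hom)
  \<comment> \<open>Read from right to left, these laws of the quotient map replace sums and
    products of cosets by cosets of sums and products, to which \<open>smult_cohomology\<close>
    applies.\<close>
  note quot_plus = ring_hom_add [OF hom, simplified free_ring_def, simplified, folded free_ring_def]
    and quot_times = ring_hom_mult [OF hom, simplified free_ring_def, simplified, folded free_ring_def]
    and quot_one = ring_hom_one [OF hom, simplified free_ring_def, simplified, folded free_ring_def]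
  interpret H: abelian_group ?H
  proof (rule abelian_groupI)
    fix X assume "X \<in> carrier ?H"
    then obtain \<omega> where "\<omega> \<in> C k" "d \<omega> = 0" "X = coset k \<omega>"
      by (rule cohomology_cases)
    then show "\<exists>Y\<in>carrier ?H. Y \<oplus>\<^bsub>?H\<^esub> X = \<zero>\<^bsub>?H\<^esub>"
      by (intro bexI [of _ "coset k (- \<omega>)"] coset_mem_carrier uminus_mem)
        (simp_all add: add_cohomology zero_cohomology d_uminus)
  qed (auto elim!: cohomology_cases intro!: coset_mem_carrier zero_mem add_mem
      simp: add_cohomology zero_cohomology d_add add_ac)
  show ?thesis
    by unfold_locales
      (auto elim!: cohomology_cases weyl_algebra_cases intro!: coset_mem_carrier add_mem act_mem
        simp: add_cohomology smult_cohomology d_add d_act act_add act_plus act_times act_one add_mem act_mem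
          simp flip: quot_plus quot_times quot_one)
qed

end

text \<open>The axioms concern single forms or pairs of forms of one degree and hence pass to the
  image. This gives the complex on the open set from one on the torus, without a separate
  verification for fractions.\<close>

lemma weyl_complex_image:
  assumes "weyl_complex C d act"
    and image: "\<And>k. C' k = \<Theta> ` C (k + s)"
    and add: "\<And>k \<omega> \<eta>. \<omega> \<in> C k \<Longrightarrow> \<eta> \<in> C k \<Longrightarrow> \<Theta> (\<omega> + \<eta>) = \<Theta> \<omega> + \<Theta> \<eta>"
    and d: "\<And>k \<omega>. \<omega> \<in> C k \<Longrightarrow> d' (\<Theta> \<omega>) = \<Theta> (d \<omega>)"
    and act: "\<And>k \<omega> p. \<omega> \<in> C k \<Longrightarrow> act' p (\<Theta> \<omega>) = \<Theta> (act p \<omega>)"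
  shows "weyl_complex C' d' act'"
proof -
  interpret weyl_complex C d act by fact
  have zero: "\<Theta> 0 = 0"
    using add [OF zero_mem zero_mem] by simp
  have uminus: "\<Theta> (- \<omega>) = - \<Theta> \<omega>" if "\<omega> \<in> C k" for \<omega> k
    using add [OF uminus_mem [OF that] that] zero by (simp add: eq_neg_iff_add_eq_0)
  show ?thesis
  proof
    show "0 \<in> C' k" for k
      unfolding image using zero zero_mem by (metis image_eqI)
    show "- \<omega> \<in> C' k" if "\<omega> \<in> C' k" for \<omega> k
      using that uminus uminus_mem by (auto simp: image image_iff) metis
    show "\<omega> + \<eta> \<in> C' k" if "\<omega> \<in> C' k" "\<eta> \<in> C' k" for \<omega> \<eta> k
      using that add add_mem by (auto simp: image image_iff) metis
    show "d' \<omega> \<in> C' (k + 1)" if "\<omega> \<in> C' k" for \<omega> k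
      using that d d_mem [of _ "k + s"] by (auto simp: image image_iff algebra_simps)
  next
    fix k \<eta> \<eta>' p q
    assume "\<eta> \<in> C' k"
    then obtain \<omega> where \<omega>: "\<omega> \<in> C (k + s)" "\<eta> = \<Theta> \<omega>"
      by (auto simp: image)
    note act' = act [OF act_mem [OF \<omega>(1)]] d [OF act_mem [OF \<omega>(1)]] act [OF d_mem [OF \<omega>(1)]]
      act [OF \<omega>(1)] d [OF \<omega>(1)]
    show "act' p \<eta> \<in> C' k"
      using \<omega> act' by (auto simp: image act_mem)
    show "d' (act' p \<eta>) = act' p (d' \<eta>)"
      using \<omega> by (simp add: act' d_act)
    show "act' (p + q) \<eta> = act' p \<eta> + act' q \<eta>"
      using \<omega> by (simp add: act' act_plus add [OF act_mem act_mem])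
    show "act' (p * q) \<eta> = act' p (act' q \<eta>)"
      using \<omega> by (simp add: act' act_times)
    show "act' 1 \<eta> = \<eta>"
      using \<omega> by (simp add: act' act_one)
    show "act' p \<eta> = 0" if "p \<in> weyl_relations"
      using \<omega> that by (simp add: act' act_relation zero)
    assume "\<eta>' \<in> C' k"
    then obtain \<omega>' where \<omega>': "\<omega>' \<in> C (k + s)" "\<eta>' = \<Theta> \<omega>'"
      by (auto simp: image)
    note sum = add [OF \<omega>(1) \<omega>'(1), symmetric] add_mem [OF \<omega>(1) \<omega>'(1)]
    show "d' (\<eta> + \<eta>') = d' \<eta> + d' \<eta>'"
      using \<omega> \<omega>' by (simp add: sum(1) d [OF sum(2)] d [OF \<omega>(1)] d [OF \<omega>'(1)] d_add add [OF d_mem d_mem])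
    show "act' p (\<eta> + \<eta>') = act' p \<eta> + act' p \<eta>'"
      using \<omega> \<omega>' by (simp add: sum(1) act [OF sum(2)] act [OF \<omega>(1)] act [OF \<omega>'(1)] act_add add [OF act_mem act_mem])
  qed
qed

text \<open>By \<open>retract\<close>, a class has a representative in the subcomplex
  \<open>D\<close>; it is sent to the class of the image of that representative under
  \<open>\<Theta>\<close>. The equivalence \<open>exact\<close> makes this both well defined and
  injective, and \<open>surj\<close> makes it onto.\<close>

lemma left_module_isomorphic_cohomology:
  assumes C: "weyl_complex C d act" and C': "weyl_complex C' d' act'" and D: "weyl_complex D d act"
    and sub: "D k \<subseteq> C k"
    and retract: "\<And>\<omega>. \<omega> \<in> C k \<Longrightarrow> d \<omega> = 0 \<Longrightarrow> \<exists>\<omega>'\<in>D k. d \<omega>' = 0 \<and> \<omega> - \<omega>' \<in> d ` C (k - 1)"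
    and closed: "\<And>\<omega>. \<omega> \<in> D k \<Longrightarrow> d \<omega> = 0 \<Longrightarrow> \<Theta> \<omega> \<in> C' k' \<and> d' (\<Theta> \<omega>) = 0"
    and add: "\<And>\<omega> \<eta>. \<omega> \<in> D k \<Longrightarrow> \<eta> \<in> D k \<Longrightarrow> \<Theta> (\<omega> + \<eta>) = \<Theta> \<omega> + \<Theta> \<eta>"
    and act: "\<And>\<omega> p. \<omega> \<in> D k \<Longrightarrow> \<Theta> (act p \<omega>) = act' p (\<Theta> \<omega>)"
    and exact: "\<And>\<omega>. \<omega> \<in> D k \<Longrightarrow> d \<omega> = 0 \<Longrightarrow> \<omega> \<in> d ` C (k - 1) \<longleftrightarrow> \<Theta> \<omega> \<in> d' ` C' (k' - 1)"
    and surj: "\<And>\<eta>. \<eta> \<in> C' k' \<Longrightarrow> d' \<eta> = 0 \<Longrightarrow> \<exists>\<omega>\<in>D k. d \<omega> = 0 \<and> \<Theta> \<omega> = \<eta>"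
  shows "left_module_isomorphic weyl_algebra (cohomology C d act k) (cohomology C' d' act' k')"
proof -
  interpret C: weyl_complex C d act by fact
  interpret C': weyl_complex C' d' act' by fact
  interpret D: weyl_complex D d act by fact
  let ?H = "cohomology C d act k" and ?H' = "cohomology C' d' act' k'"
  have cases: "\<exists>\<omega>. \<omega> \<in> D k \<and> d \<omega> = 0 \<and> X = C.coset k \<omega>" if X: "X \<in> carrier ?H" for X
  proof -
    obtain \<omega> where "\<omega> \<in> C k" "d \<omega> = 0" "X = C.coset k \<omega>"
      using X by (rule C.cohomology_cases)
    with retract show ?thesis by (metis C.coset_eq_iff)
  qed
  have diff: "\<Theta> (\<omega> - \<eta>) = \<Theta> \<omega> - \<Theta> \<eta>" if "\<omega> \<in> D k" "\<eta> \<in> D k" for \<omega> \<eta>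
    using add [OF D.diff_mem [OF that] that(2)] by (simp add: eq_diff_eq)
  have coset_iff: "C.coset k \<omega> = C.coset k \<eta> \<longleftrightarrow> C'.coset k' (\<Theta> \<omega>) = C'.coset k' (\<Theta> \<eta>)"
    if "\<omega> \<in> D k" "d \<omega> = 0" "\<eta> \<in> D k" "d \<eta> = 0" for \<omega> \<eta>
    using exact [of "\<omega> - \<eta>"] that
    by (simp add: C.coset_eq_iff C'.coset_eq_iff D.diff_mem D.d_diff diff)
  define \<phi> where "\<phi> X = C'.coset k' (\<Theta> (SOME \<omega>. \<omega> \<in> D k \<and> d \<omega> = 0 \<and> X = C.coset k \<omega>))" for X
  have \<phi>: "\<phi> (C.coset k \<omega>) = C'.coset k' (\<Theta> \<omega>)" if "\<omega> \<in> D k" "d \<omega> = 0" for \<omega>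
  proof -
    define \<eta> where "\<eta> = (SOME \<eta>. \<eta> \<in> D k \<and> d \<eta> = 0 \<and> C.coset k \<omega> = C.coset k \<eta>)"
    have "\<eta> \<in> D k \<and> d \<eta> = 0 \<and> C.coset k \<omega> = C.coset k \<eta>"
      unfolding \<eta>_def by (rule someI [of _ \<omega>]) (use that in simp)
    with that coset_iff [of \<omega> \<eta>] show ?thesis
      unfolding \<phi>_def \<eta>_def [symmetric] by simp
  qed
  have "inj_on \<phi> (carrier ?H)"
  proof (rule inj_onI)
    fix X Y assume XY: "X \<in> carrier ?H" "Y \<in> carrier ?H" "\<phi> X = \<phi> Y"
    obtain \<omega> \<eta> where "\<omega> \<in> D k" "d \<omega> = 0" "X = C.coset k \<omega>" "\<eta> \<in> D k" "d \<eta> = 0" "Y = C.coset k \<eta>"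
      using cases XY by blast
    then show "X = Y"
      using XY(3) coset_iff \<phi> by simp
  qed
  moreover have "\<phi> ` carrier ?H = carrier ?H'"
  proof (intro equalityI subsetI)
    fix Y assume "Y \<in> \<phi> ` carrier ?H"
    then obtain X where "X \<in> carrier ?H" "Y = \<phi> X" by blast
    then show "Y \<in> carrier ?H'"
      using cases [of X] \<phi> closed C'.coset_mem_carrier by auto
  next
    fix Y assume "Y \<in> carrier ?H'"
    then obtain \<eta> where "\<eta> \<in> C' k'" "d' \<eta> = 0" "Y = C'.coset k' \<eta>"
      by (rule C'.cohomology_cases)
    moreover then obtain \<omega> where "\<omega> \<in> D k" "d \<omega> = 0" "\<Theta> \<omega> = \<eta>"
      using surj by blast
    ultimately show "Y \<in> \<phi> ` carrier ?H"
      using \<phi> sub by (intro image_eqI [of _ _ "C.coset k \<omega>"] C.coset_mem_carrier) auto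
  qed
  moreover have "\<phi> (X \<oplus>\<^bsub>?H\<^esub> Y) = \<phi> X \<oplus>\<^bsub>?H'\<^esub> \<phi> Y" if XY: "X \<in> carrier ?H" "Y \<in> carrier ?H" for X Y
  proof -
    obtain \<omega> \<eta> where "\<omega> \<in> D k" "d \<omega> = 0" "X = C.coset k \<omega>" "\<eta> \<in> D k" "d \<eta> = 0" "Y = C.coset k \<eta>"
      using cases XY by blast
    then show ?thesis
      by (simp add: C.add_cohomology C'.add_cohomology \<phi> D.add_mem D.d_add add)
  qed
  moreover have "\<phi> (P \<odot>\<^bsub>?H\<^esub> X) = P \<odot>\<^bsub>?H'\<^esub> \<phi> X"
    if P: "P \<in> carrier weyl_algebra" and X: "X \<in> carrier ?H" for P X
  proof -
    obtain p where "P = C.relation_ideal +>\<^bsub>free_ring\<^esub> p"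
      using P by (rule C.weyl_algebra_cases)
    moreover obtain \<omega> where \<omega>: "\<omega> \<in> D k" "d \<omega> = 0" "X = C.coset k \<omega>"
      using cases X by blast
    moreover have "\<omega> \<in> C k" "\<Theta> \<omega> \<in> C' k'"
      using \<omega> sub closed by auto
    ultimately show ?thesis
      by (simp add: C.smult_cohomology C'.smult_cohomology \<phi> D.act_mem D.d_act act)
  qed
  ultimately show ?thesis
    unfolding left_module_isomorphic_def bij_betw_def
    by (intro conjI exI [of _ \<phi>] ballI C.left_module_cohomology C'.left_module_cohomology)
qed

section \<open>Actions of the free algebra on forms\<close>

lemma free_act_superset:
  assumes "finite X" "Poly_Mapping.keys p \<subseteq> X" "\<iota> 0 = 0"
  shows "free_act \<iota> act p \<omega> = (\<Sum>w\<in>X. \<iota> (Poly_Mapping.lookup p w) *s foldr act (letters w) \<omega>)"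
  unfolding free_act_def using assms
  by (intro sum.mono_neutral_left) (auto simp: in_keys_iff)

lemma foldr_mem:
  assumes "\<omega> \<in> C" "\<And>x \<omega>. \<omega> \<in> C \<Longrightarrow> act x \<omega> \<in> C"
  shows "foldr act xs \<omega> \<in> C"
  using assms by (induction xs) auto

lemma free_act_mem:
  assumes "\<omega> \<in> C" "\<And>x \<omega>. \<omega> \<in> C \<Longrightarrow> act x \<omega> \<in> C" "\<And>c \<omega>. \<omega> \<in> C \<Longrightarrow> \<iota> c *s \<omega> \<in> C"
    and "0 \<in> C" "\<And>\<omega> \<eta>. \<omega> \<in> C \<Longrightarrow> \<eta> \<in> C \<Longrightarrow> \<omega> + \<eta> \<in> C"
  shows "free_act \<iota> act p \<omega> \<in> C"
proof -
  have "(\<Sum>w\<in>X. \<iota> (Poly_Mapping.lookup p w) *s foldr act (letters w) \<omega>) \<in> C" for X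
    using assms by (induction X rule: infinite_finite_induct) (simp_all add: foldr_mem)
  then show ?thesis by (simp add: free_act_def)
qed

text \<open>The free algebra acts by sums of scalar multiples of words in the generators, so
  compatibility with sums, scalars and generators is enough. It is asked on \<open>C\<close> only,
  since a map such as the later \<open>\<Theta>\<close> respects the structure on suitable
  forms.\<close>

lemma free_act_intertwine:
  assumes "\<omega> \<in> C" and act: "\<And>x \<omega>. \<omega> \<in> C \<Longrightarrow> act x \<omega> \<in> C" and \<iota>: "\<And>c \<omega>. \<omega> \<in> C \<Longrightarrow> \<iota> c *s \<omega> \<in> C"
    and C: "0 \<in> C" "\<And>\<omega> \<eta>. \<omega> \<in> C \<Longrightarrow> \<eta> \<in> C \<Longrightarrow> \<omega> + \<eta> \<in> C"
    and "\<And>\<omega> \<eta>. \<omega> \<in> C \<Longrightarrow> \<eta> \<in> C \<Longrightarrow> \<Theta> (\<omega> + \<eta>) = \<Theta> \<omega> + \<Theta> \<eta>"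
    and "\<And>x \<omega>. \<omega> \<in> C \<Longrightarrow> \<Theta> (act x \<omega>) = act' x (\<Theta> \<omega>)"
    and "\<And>c \<omega>. \<omega> \<in> C \<Longrightarrow> \<Theta> (\<iota> c *s \<omega>) = \<iota>' c *s \<Theta> \<omega>"
  shows "\<Theta> (free_act \<iota> act p \<omega>) = free_act \<iota>' act' p (\<Theta> \<omega>)"
proof -
  define h where "h w = \<iota> (Poly_Mapping.lookup p w) *s foldr act (letters w) \<omega>" for w
  have h: "h w \<in> C" for w
    unfolding h_def using foldr_mem [of \<omega> C act] act \<iota> \<open>\<omega> \<in> C\<close> by blast
  have foldr: "\<Theta> (foldr act xs \<omega>) = foldr act' xs (\<Theta> \<omega>)" for xs
    using assms foldr_mem [of \<omega> C act] by (induction xs) simp_all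
  have "\<Theta> 0 = 0"
    using assms(6) [OF C(1) C(1)] by simp
  \<comment> \<open>Membership in \<open>C\<close> is carried along in the induction because
    additivity of \<open>\<Theta>\<close> is known on \<open>C\<close> only.\<close>
  have "(\<Sum>w\<in>X. h w) \<in> C \<and> \<Theta> (\<Sum>w\<in>X. h w) = (\<Sum>w\<in>X. \<Theta> (h w))" for X
    using C h \<open>\<Theta> 0 = 0\<close> assms(6) by (induction X rule: infinite_finite_induct) simp_all
  moreover have "\<Theta> (h w) = \<iota>' (Poly_Mapping.lookup p w) *s foldr act' (letters w) (\<Theta> \<omega>)" for w
    unfolding h_def using foldr assms foldr_mem [of \<omega> C act] by metis
  ultimately show ?thesis by (simp add: free_act_def flip: h_def)
qed

text \<open>Linearity is over the complex scalars, not over the coefficient ring: generators such as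
  \<open>Par j\<close> act as differential operators.\<close>

locale linear_action =
  fixes \<iota> :: "complex \<Rightarrow> 'r::comm_ring_1"
    and act :: "'a \<Rightarrow> ('r, 'n::finite) form \<Rightarrow> ('r, 'n) form"
  assumes \<iota>_add: "\<iota> (c + c') = \<iota> c + \<iota> c'"
    and \<iota>_mult: "\<iota> (c * c') = \<iota> c * \<iota> c'"
    and \<iota>_one: "\<iota> 1 = 1"
    and act_add: "act x (\<omega> + \<eta>) = act x \<omega> + act x \<eta>"
    and act_smult: "act x (\<iota> c *s \<omega>) = \<iota> c *s act x \<omega>"
begin

lemma \<iota>_zero [simp]: "\<iota> 0 = 0"
  using \<iota>_add [of 0 0] by simp

lemma foldr_act_add: "foldr act xs (\<omega> + \<eta>) = foldr act xs \<omega> + foldr act xs \<eta>"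
  by (induction xs) (simp_all add: act_add)

lemma foldr_act_smult: "foldr act xs (\<iota> c *s \<omega>) = \<iota> c *s foldr act xs \<omega>"
  by (induction xs) (simp_all add: act_smult)

lemma free_act_add: "free_act \<iota> act p (\<omega> + \<eta>) = free_act \<iota> act p \<omega> + free_act \<iota> act p \<eta>"
  by (simp add: free_act_def foldr_act_add vector_add_ldistrib sum.distrib)

lemma free_act_zero_left [simp]: "free_act \<iota> act 0 \<omega> = 0"
  by (simp add: free_act_def)

lemma free_act_zero_right [simp]: "free_act \<iota> act p 0 = 0"
  using free_act_add [of p 0 0] by simp

lemma free_act_plus: "free_act \<iota> act (p + q) \<omega> = free_act \<iota> act p \<omega> + free_act \<iota> act q \<omega>"
proof -
  let ?X = "Poly_Mapping.keys p \<union> Poly_Mapping.keys q"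
  have "Poly_Mapping.keys (p + q) \<subseteq> ?X"
    by (rule keys_add)
  then show ?thesis
    by (simp add: free_act_superset [of ?X] lookup_add \<iota>_add vector_sadd_rdistrib sum.distrib)
qed

lemma free_act_single:
  "free_act \<iota> act (Poly_Mapping.single w c) \<omega> = \<iota> c *s foldr act (letters w) \<omega>"
  by (subst free_act_superset [of "{w}"]) auto

text \<open>By bilinearity it suffices to treat words, where the product is concatenation and the
  action is composition.\<close>

lemma free_act_times: "free_act \<iota> act (p * q) \<omega> = free_act \<iota> act p (free_act \<iota> act q \<omega>)"
proof (induction p rule: pm_induct)
  case (add u c p)
  have "free_act \<iota> act (Poly_Mapping.single u c * q) \<omega>
      = free_act \<iota> act (Poly_Mapping.single u c) (free_act \<iota> act q \<omega>)"
    by (induction q rule: pm_induct)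
      (simp_all add: distrib_left free_act_plus free_act_add mult_single free_act_single plus_free_word_def
        \<iota>_mult foldr_act_smult vector_smult_assoc)
  with add show ?case by (simp add: distrib_right free_act_plus)
qed simp

lemma free_act_one: "free_act \<iota> act 1 \<omega> = \<omega>"
  using free_act_single [of 0 1 \<omega>] unfolding single_one by (simp add: \<iota>_one zero_free_word_def)

lemma free_act_gen: "free_act \<iota> act (gen x) \<omega> = act x \<omega>"
  by (simp add: gen_def free_act_single \<iota>_one)

lemma free_act_uminus: "free_act \<iota> act (- p) \<omega> = - free_act \<iota> act p \<omega>"
  using free_act_plus [of "- p" p] by (simp add: eq_neg_iff_add_eq_0)

lemma free_act_minus: "free_act \<iota> act (p - q) \<omega> = free_act \<iota> act p \<omega> - free_act \<iota> act q \<omega>"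
  using free_act_plus [of p "- q"] by (simp add: free_act_uminus)

end

lemma free_act_weyl_relations:
  assumes "linear_action \<iota> act" and p: "p \<in> weyl_relations"
    and LL: "\<And>i j \<omega>. act (Lam i) (act (Lam j) \<omega>) = act (Lam j) (act (Lam i) \<omega>)"
    and PP: "\<And>i j \<omega>. act (Par i) (act (Par j) \<omega>) = act (Par j) (act (Par i) \<omega>)"
    and PL: "\<And>i j \<omega>. act (Par i) (act (Lam j) \<omega>) = act (Lam j) (act (Par i) \<omega>) + (if i = j then \<omega> else 0)"
  shows "free_act \<iota> act p \<omega> = 0"
proof -
  interpret linear_action \<iota> act by fact
  show ?thesis
    using p by (auto simp: weyl_relations_def free_act_minus free_act_times free_act_gen free_act_one LL PL
        intro: PP split: if_splits)
qed

section \<open>Koszul complexes\<close>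

text \<open>The sign arising when the factor with index \<open>i\<close> is moved past those of
  smaller index in \<open>K\<close> to its place in the ordered basis form.\<close>

definition basis_sign :: "'n::linorder \<Rightarrow> 'n set \<Rightarrow> 'r::comm_ring_1" where
  "basis_sign i K = (- 1) ^ card {j \<in> K. j < i}"

lemma basis_sign_mult_self [simp]: "basis_sign i K * basis_sign i K = 1"
  by (simp add: basis_sign_def flip: power_add)

lemma basis_sign_mult_self_left [simp]: "basis_sign i K * (basis_sign i K * x) = x"
  by (simp flip: mult.assoc)

lemma basis_sign_empty [simp]: "basis_sign i {} = 1"
  by (simp add: basis_sign_def)

lemma basis_sign_insert_self [simp]: "basis_sign i (insert i K) = basis_sign i K"
  unfolding basis_sign_def by (rule arg_cong [where f = "\<lambda>S. (- 1) ^ card S"]) auto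

lemma basis_sign_remove_self [simp]: "basis_sign i (K - {i}) = basis_sign i K"
  unfolding basis_sign_def by (rule arg_cong [where f = "\<lambda>S. (- 1) ^ card S"]) auto

lemma basis_sign_insert:
  fixes i j :: "'n::{finite,linorder}"
  assumes "j \<notin> K"
  shows "basis_sign i (insert j K) = (if j < i then - basis_sign i K else basis_sign i K)"
proof (cases "j < i")
  case True
  then have "{k \<in> insert j K. k < i} = insert j {k \<in> K. k < i}" by auto
  then show ?thesis using assms True by (simp add: basis_sign_def)
next
  case False
  then have "{k \<in> insert j K. k < i} = {k \<in> K. k < i}" by auto
  then show ?thesis using False by (simp add: basis_sign_def)
qed

text \<open>Of two distinct indices exactly one is the smaller, so exactly one of the two insertions
  changes a sign.\<close>

lemma basis_sign_swap:
  fixes i j :: "'n::{finite,linorder}"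
  assumes "i \<noteq> j" "i \<notin> K" "j \<notin> K"
  shows "basis_sign i (insert j K) * basis_sign j K = - (basis_sign j (insert i K) * basis_sign i K)"
  using assms by (cases i j rule: linorder_cases) (simp_all add: basis_sign_insert mult.commute)

text \<open>The exterior product with \<open>dx\<^sub>i/x\<^sub>i\<close> and the contraction with \<open>x\<^sub>i \<partial>/\<partial>x\<^sub>i\<close>.\<close>

definition ext_mult :: "'n \<Rightarrow> ('r, 'n) form \<Rightarrow> ('r::comm_ring_1, 'n::{finite,linorder}) form" where
  "ext_mult i \<omega> = (\<chi> K. if i \<in> K then basis_sign i K * \<omega> $ (K - {i}) else 0)"

definition contract :: "'n \<Rightarrow> ('r, 'n) form \<Rightarrow> ('r::comm_ring_1, 'n::{finite,linorder}) form" where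
  "contract i \<omega> = (\<chi> K. if i \<in> K then 0 else basis_sign i K * \<omega> $ insert i K)"

lemma ext_mult_add: "ext_mult i (\<omega> + \<eta>) = ext_mult i \<omega> + ext_mult i \<eta>"
  by (simp add: ext_mult_def vec_eq_iff algebra_simps)

lemma ext_mult_zero [simp]: "ext_mult i 0 = 0"
  by (simp add: ext_mult_def vec_eq_iff)

lemma ext_mult_sum: "ext_mult i (\<Sum>x\<in>X. h x) = (\<Sum>x\<in>X. ext_mult i (h x))"
  by (induction X rule: infinite_finite_induct) (simp_all add: ext_mult_add)

lemma contract_add: "contract i (\<omega> + \<eta>) = contract i \<omega> + contract i \<eta>"
  by (simp add: contract_def vec_eq_iff algebra_simps)

lemma contract_zero [simp]: "contract i 0 = 0"
  by (simp add: contract_def vec_eq_iff)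

lemma contract_sum: "contract i (\<Sum>x\<in>X. h x) = (\<Sum>x\<in>X. contract i (h x))"
  by (induction X rule: infinite_finite_induct) (simp_all add: contract_add)

lemma ext_mult_swap: "ext_mult i (ext_mult j \<omega>) = - ext_mult j (ext_mult i \<omega>)"
proof -
  have "ext_mult i (ext_mult j \<omega>) $ K = - ext_mult j (ext_mult i \<omega>) $ K" for K
  \<comment> \<open>In all other components both sides vanish; for \<open>i = j\<close> the outer
    factor removes the index, which is then missing for the inner one.\<close>
  proof (cases "i \<in> K \<and> j \<in> K \<and> i \<noteq> j")
    case True
    define L where "L = K - {i} - {j}"
    have L: "K = insert i (insert j L)" "i \<notin> L" "j \<notin> L" "i \<noteq> j" "j \<noteq> i" "insert j L - {j} = L" "insert i L - {i} = L"
        "insert i (insert j L) - {i} = insert j L" "insert i (insert j L) - {j} = insert i L"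
      using True by (auto simp: L_def)
    have "basis_sign i (insert j L) * basis_sign j L = (- (basis_sign j (insert i L) * basis_sign i L) :: 'a)"
      using L by (intro basis_sign_swap)
    then show ?thesis
      using L(2-5)
      by (simp add: ext_mult_def L mult.assoc [symmetric] insert_commute [of i j L])
        (simp add: insert_commute [of j i L] L)
  qed (auto simp: ext_mult_def)
  then show ?thesis by (simp add: vec_eq_iff)
qed

text \<open>The anticommutation relation of the exterior algebra. For \<open>i = j\<close> exactly
  one summand contributes, depending on whether \<open>i \<in> K\<close>; for
  \<open>i \<noteq> j\<close> the two carry opposite signs.\<close>

lemma ext_mult_contract:
  "ext_mult i (contract j \<omega>) + contract j (ext_mult i \<omega>) = (if i = j then \<omega> else 0)"
proof -
  have "(ext_mult i (contract j \<omega>) + contract j (ext_mult i \<omega>)) $ K = (if i = j then \<omega> else 0) $ K" for K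
  proof (cases "i = j")
    case True
    then show ?thesis
      by (cases "i \<in> K") (simp_all add: ext_mult_def contract_def insert_absorb)
  next
    case False
    show ?thesis
    proof (cases "i \<in> K \<and> j \<notin> K")
      case True
      define L where "L = K - {i}"
      have L: "K = insert i L" "i \<notin> L" "j \<notin> L" "i \<noteq> j" "j \<noteq> i" "insert i L - {i} = L" "insert j (insert i L) - {i} = insert j L"
        using True by (auto simp: L_def)
      have "basis_sign i L * basis_sign j L + basis_sign j (insert i L) * basis_sign i (insert j L) = (0::'a)"
        using L(2-4) by (cases i j rule: linorder_cases) (simp_all add: basis_sign_insert mult.commute)
      then show ?thesis
        using L(2-5) by (simp add: ext_mult_def contract_def L mult.assoc [symmetric] insert_commute [of j i L] flip: distrib_right)
    qed (use False in \<open>auto simp: ext_mult_def contract_def\<close>)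
  qed
  then show ?thesis by (simp add: vec_eq_iff)
qed

definition map_form :: "('r \<Rightarrow> 's) \<Rightarrow> ('r, 'n) form \<Rightarrow> ('s, 'n::finite) form" where
  "map_form h \<omega> = (\<chi> K. h (\<omega> $ K))"

lemma map_form_nth [simp]: "map_form h \<omega> $ K = h (\<omega> $ K)"
  by (simp add: map_form_def)

definition koszul ::
  "'n set \<Rightarrow> ('n \<Rightarrow> 'r \<Rightarrow> 'r) \<Rightarrow> ('r::comm_ring_1, 'n::{finite,linorder}) form \<Rightarrow> ('r, 'n) form"
  where
  "koszul S D \<omega> = (\<Sum>i\<in>S. ext_mult i (map_form (D i) \<omega>))"

lemma koszul_nth:
  "koszul S D \<omega> $ K = (\<Sum>i\<in>S \<inter> K. basis_sign i K * D i (\<omega> $ (K - {i})))"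
  by (simp add: koszul_def ext_mult_def sum.If_cases Int_def)

locale commuting_operators =
  fixes D :: "'n::{finite,linorder} \<Rightarrow> 'r::{idom,ring_char_0} \<Rightarrow> 'r"
  assumes D_add: "D i (r + s) = D i r + D i s"
    and D_swap: "D i (D j r) = D j (D i r)"
begin

lemma D_zero [simp]: "D i 0 = 0"
  using D_add [of i 0 0] by simp

lemma D_uminus: "D i (- r) = - D i r"
  using D_add [of i "- r" r] by (simp add: eq_neg_iff_add_eq_0)

lemma D_diff: "D i (r - s) = D i r - D i s"
  using D_add [of i r "- s"] D_uminus by simp

lemma D_sign: "D i (basis_sign j K * r) = basis_sign j K * D i r"
  by (cases "even (card {k \<in> K. k < j})") (simp_all add: basis_sign_def D_uminus)

lemma map_D_add: "map_form (D i) (\<omega> + \<eta>) = map_form (D i) \<omega> + map_form (D i) \<eta>"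
  by (simp add: vec_eq_iff D_add)

lemma map_D_zero [simp]: "map_form (D i) 0 = 0"
  by (simp add: vec_eq_iff)

lemma map_D_sum: "map_form (D i) (\<Sum>x\<in>X. h x) = (\<Sum>x\<in>X. map_form (D i) (h x))"
  by (induction X rule: infinite_finite_induct) (simp_all add: map_D_add)

lemma map_D_ext_mult: "map_form (D i) (ext_mult j \<omega>) = ext_mult j (map_form (D i) \<omega>)"
  by (simp add: vec_eq_iff ext_mult_def D_sign)

lemma map_D_contract: "map_form (D i) (contract j \<omega>) = contract j (map_form (D i) \<omega>)"
  by (simp add: vec_eq_iff contract_def D_sign)

lemma koszul_add: "koszul S D (\<omega> + \<eta>) = koszul S D \<omega> + koszul S D \<eta>"
  by (simp add: koszul_def map_D_add ext_mult_add sum.distrib)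

lemma koszul_uminus: "koszul S D (- \<omega>) = - koszul S D \<omega>"
  using koszul_add [of S "- \<omega>" \<omega>] by (simp add: eq_neg_iff_add_eq_0 koszul_def)

lemma koszul_diff: "koszul S D (\<omega> - \<eta>) = koszul S D \<omega> - koszul S D \<eta>"
  using koszul_add [of S \<omega> "- \<eta>"] koszul_uminus by simp

text \<open>The operators are symmetric and the exterior products antisymmetric in the two indices,
  so the double sum equals its own negative; characteristic zero removes the factor 2.\<close>

lemma koszul_koszul: "koszul S D (koszul S D \<omega>) = 0"
proof -
  define X where "X i j = ext_mult i (ext_mult j (map_form (D i) (map_form (D j) \<omega>)))" for i j
  have X: "koszul S D (koszul S D \<omega>) = (\<Sum>i\<in>S. \<Sum>j\<in>S. X i j)"
    by (simp add: koszul_def map_D_sum map_D_ext_mult ext_mult_sum X_def)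
  have X_swap: "X i j = - X j i" for i j
  proof -
    have "map_form (D i) (map_form (D j) \<omega>) = map_form (D j) (map_form (D i) \<omega>)"
      by (simp add: vec_eq_iff D_swap [of i j])
    then show ?thesis using ext_mult_swap [of i j] by (simp add: X_def)
  qed
  have "(\<Sum>i\<in>S. \<Sum>j\<in>S. X i j) = - (\<Sum>i\<in>S. \<Sum>j\<in>S. X j i)"
    unfolding sum_negf [symmetric] by (intro sum.cong refl X_swap)
  also have "(\<Sum>i\<in>S. \<Sum>j\<in>S. X j i) = (\<Sum>i\<in>S. \<Sum>j\<in>S. X i j)"
    by (rule sum.swap)
  finally have "2 * koszul S D (koszul S D \<omega>) $ K = 0" for K
    unfolding X by (metis add.right_inverse mult_2 vector_add_component zero_index)
  then show ?thesis by (simp add: vec_eq_iff)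
qed

text \<open>Cartan's formula: contraction is a homotopy between zero and the operator
  \<open>D i\<close> on coefficients. Inverting \<open>D i\<close> up to an error thus gives
  exactness up to that error.\<close>

lemma koszul_contract:
  assumes "i \<in> S"
  shows "koszul S D (contract i \<omega>) + contract i (koszul S D \<omega>) = map_form (D i) \<omega>"
proof -
  have "koszul S D (contract i \<omega>) + contract i (koszul S D \<omega>)
      = (\<Sum>j\<in>S. ext_mult j (contract i (map_form (D j) \<omega>)) + contract i (ext_mult j (map_form (D j) \<omega>)))"
    by (simp add: koszul_def map_D_contract contract_sum sum.distrib)
  also have "\<dots> = map_form (D i) \<omega>"
    using assms by (simp add: ext_mult_contract if_distrib sum.delta)
  finally show ?thesis .
qed

end

section \<open>Wedge products as exterior multiplication\<close>

lemma wedge_axis: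
  "(axis {i} r \<and>\<^sub>f \<omega>) = r *s ext_mult i \<omega>" for r :: "'r::comm_ring_1"
proof -
  have "(axis {i} r \<and>\<^sub>f \<omega>) $ K = r * ext_mult i \<omega> $ K" for K
  proof (cases "i \<in> K")
    case True
    have "{(i', j). i' \<in> {i} \<and> j \<in> K - {i} \<and> j < i'} = Pair i ` {j \<in> K. j < i}"
      by auto
    then have inv: "card {(i', j). i' \<in> {i} \<and> j \<in> K - {i} \<and> j < i'} = card {j \<in> K. j < i}"
      by (simp add: card_image inj_on_def)
    \<comment> \<open>Only the index set \<open>{i}\<close> contributes to the wedge product, and
      its sign counts the smaller elements of \<open>K\<close>.\<close>
    have "(- 1) ^ card {(i', j). i' \<in> I \<and> j \<in> K - I \<and> j < i'} * axis {i} r $ I * \<omega> $ (K - I)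
        = (if I = {i} then basis_sign i K * r * \<omega> $ (K - {i}) else 0)" for I
    proof (cases "I = {i}")
      case True
      show ?thesis unfolding True inv by (simp add: axis_def basis_sign_def)
    qed (simp add: axis_def)
    then have "(axis {i} r \<and>\<^sub>f \<omega>) $ K
        = (\<Sum>I\<in>Pow K. if I = {i} then basis_sign i K * r * \<omega> $ (K - {i}) else 0)"
      unfolding wedge_def by simp
    also have "\<dots> = r * ext_mult i \<omega> $ K"
      using True by (simp add: sum.delta ext_mult_def mult_ac)
    finally show ?thesis .
  next
    case False
    then have "(axis {i} r \<and>\<^sub>f \<omega>) $ K = 0"
      by (auto simp: wedge_def axis_def intro!: sum.neutral)
    then show ?thesis using False by (simp add: ext_mult_def)
  qed
  then show ?thesis by (simp add: vec_eq_iff)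
qed

lemma wedge_sum_left: "(\<Sum>i\<in>S. h i) \<and>\<^sub>f \<omega> = (\<Sum>i\<in>S. h i \<and>\<^sub>f \<omega>)"
proof (induction S rule: infinite_finite_induct)
  case (insert i S)
  then show ?case
    by (simp add: vec_eq_iff wedge_def distrib_left distrib_right sum.distrib)
qed (simp_all add: vec_eq_iff wedge_def)

lemma smult_wedge_left: "(r *s \<eta>) \<and>\<^sub>f \<omega> = r *s (\<eta> \<and>\<^sub>f \<omega>)"
  by (simp add: vec_eq_iff wedge_def sum_distrib_left mult_ac)

lemma ext_mult_axis: "ext_mult i (axis {} r) = axis {i} r"
proof -
  have "ext_mult i (axis {} r) $ K = axis {i} r $ K" for K
  proof (cases "K = {i}")
    case True
    then show ?thesis by (simp add: ext_mult_def axis_def)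
  next
    case False
    then have "i \<in> K \<Longrightarrow> K - {i} \<noteq> {}" by blast
    with False show ?thesis by (simp add: ext_mult_def axis_def)
  qed
  then show ?thesis by (simp add: vec_eq_iff)
qed

lemma ext_deriv_eq_koszul: "ext_deriv S \<theta> \<omega> = koszul S \<theta> \<omega>"
  by (simp add: ext_deriv_def koszul_def wedge_axis map_form_def)

lemma ext_deriv_axis:
  fixes \<theta> :: "'n::{finite,linorder} \<Rightarrow> 'r::comm_ring_1 \<Rightarrow> 'r"
  assumes "\<And>i. i \<in> S \<Longrightarrow> \<theta> i 0 = 0"
  shows "ext_deriv S \<theta> (axis {} r) = (\<Sum>i\<in>S. axis {i} (\<theta> i r))"
proof -
  have "map_form (\<theta> i) (axis {} r :: ('r, 'n) form) = axis {} (\<theta> i r)" if "i \<in> S" for i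
    using assms that by (simp add: vec_eq_iff axis_def)
  then show ?thesis
    unfolding ext_deriv_eq_koszul koszul_def by (intro sum.cong refl) (simp add: ext_mult_axis)
qed

lemma contract_forms:
  assumes "\<omega> \<in> forms UNIV R k" "0 \<in> R" "\<And>r. r \<in> R \<Longrightarrow> - r \<in> R"
  shows "contract i \<omega> \<in> forms UNIV R (k - 1)"
proof -
  have "basis_sign i K * r \<in> R" if "r \<in> R" for K r
    using assms that by (cases "even (card {j \<in> K. j < i})") (simp_all add: basis_sign_def)
  moreover have "int (card K) = k - 1" if "i \<notin> K" "\<omega> $ insert i K \<noteq> 0" for K
  proof -
    have "int (card (insert i K)) = k"
      using assms that by (auto simp: forms_def)
    then show ?thesis using that by simp
  qed
  ultimately show ?thesis
    using assms by (auto simp: forms_def contract_def dest!: mult_not_zero)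
qed

lemma koszul_forms:
  fixes \<omega> :: "('r::comm_ring_1, 'n::{finite,linorder}) form"
  assumes "\<omega> \<in> forms S R k" and "\<And>i r. i \<in> S \<Longrightarrow> r \<in> R \<Longrightarrow> D i r \<in> R" "0 \<in> R"
    and "\<And>i. i \<in> S \<Longrightarrow> D i 0 = 0"
    and "\<And>r s. r \<in> R \<Longrightarrow> s \<in> R \<Longrightarrow> r + s \<in> R" "\<And>r. r \<in> R \<Longrightarrow> - r \<in> R"
  shows "koszul S D \<omega> \<in> forms S R (k + 1)"
proof -
  have sum: "(\<Sum>x\<in>X. h x) \<in> R" if "\<And>x. x \<in> X \<Longrightarrow> h x \<in> R" for X and h :: "'n \<Rightarrow> 'r"
    using that assms(3,5) by (induction X rule: infinite_finite_induct) auto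
  have sign: "basis_sign i K * r \<in> R" if "r \<in> R" for i :: 'n and K r
    using assms(6) that by (cases "even (card {j \<in> K. j < i})") (simp_all add: basis_sign_def)
  have "koszul S D \<omega> $ K \<in> R" for K
    unfolding koszul_nth using assms(1,2) by (intro sum sign) (auto simp: forms_def)
  moreover have "K \<subseteq> S \<and> int (card K) = k + 1" if nz: "koszul S D \<omega> $ K \<noteq> 0" for K
  proof -
    obtain i where i: "i \<in> S \<inter> K" "basis_sign i K * D i (\<omega> $ (K - {i})) \<noteq> 0"
      using nz unfolding koszul_nth by (meson sum.not_neutral_contains_not_neutral)
    then have "\<omega> $ (K - {i}) \<noteq> 0"
      using assms(4) by auto
    then have "K - {i} \<subseteq> S" "int (card (K - {i})) = k"
      using assms(1) by (auto simp: forms_def)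
    moreover have "Suc (card (K - {i})) = card K"
      using i by (intro card_Suc_Diff1) auto
    ultimately have "K \<subseteq> S" "int (card K) = k + 1"
      using i by (blast, linarith)
    then show ?thesis ..
  qed
  ultimately show ?thesis by (simp add: forms_def)
qed


lemma forms_UNIV_iff: "\<omega> \<in> forms S R k \<longleftrightarrow> (\<forall>K. \<omega> $ K \<in> R) \<and> \<omega> \<in> forms S UNIV k"
  by (auto simp: forms_def)

lemma forms_mono: "R \<subseteq> R' \<Longrightarrow> forms S R k \<subseteq> forms S R' k"
  by (auto simp: forms_def)

text \<open>Dividing the components of \<open>\<omega>\<close> that contain \<open>t\<close> by
  \<open>D t\<close> gives a form \<open>\<zeta>\<close> without such components whose differential
  agrees with \<open>\<omega>\<close> there. The difference is closed and has no component
  containing \<open>t\<close>, so \<open>D t\<close> annihilates its coefficients and injectivity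
  makes it vanish.\<close>

lemma (in commuting_operators) koszul_primitive:
  assumes R: "0 \<in> R" "\<And>r. r \<in> R \<Longrightarrow> - r \<in> R" and inj: "\<And>r. r \<in> R \<Longrightarrow> D t r = 0 \<Longrightarrow> r = 0"
    and \<omega>: "\<omega> \<in> forms UNIV R k" "koszul UNIV D \<omega> = 0"
    and image: "\<And>K. t \<in> K \<Longrightarrow> \<omega> $ K \<in> D t ` R"
    and R_closed: "\<And>r s. r \<in> R \<Longrightarrow> s \<in> R \<Longrightarrow> r + s \<in> R" "\<And>i r. r \<in> R \<Longrightarrow> D i r \<in> R"
  obtains \<zeta> where "\<zeta> \<in> forms UNIV R (k - 1)" "\<And>K. t \<in> K \<Longrightarrow> \<zeta> $ K = 0" "\<omega> = koszul UNIV D \<zeta>"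
proof -
  have "\<exists>c. c \<in> R \<and> \<omega> $ insert t K = D t c" for K
    using image [of "insert t K"] by auto
  then obtain c where c: "\<And>K. c K \<in> R" "\<And>K. \<omega> $ insert t K = D t (c K)"
    by metis
  define \<zeta> where "\<zeta> = (\<chi> K. if t \<in> K then 0 else basis_sign t K * c K)"
  have sign: "basis_sign i K * r \<in> R" if "r \<in> R" for i :: 'n and K r
    using R that by (cases "even (card {j \<in> K. j < i})") (simp_all add: basis_sign_def)
  \<comment> \<open>Injectivity of \<open>D t\<close> also places \<open>\<zeta>\<close> in a single
    degree: a nonzero \<open>c K\<close> forces a nonzero component of \<open>\<omega>\<close> at
    \<open>insert t K\<close>.\<close>
  have "int (card K) = k - 1" if "t \<notin> K" "c K \<noteq> 0" for K
  proof -
    have "\<omega> $ insert t K \<noteq> 0"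
      using inj c that by metis
    then have "int (card (insert t K)) = k"
      using \<omega>(1) by (auto simp: forms_def)
    then show ?thesis using that by simp
  qed
  then have \<zeta>: "\<zeta> \<in> forms UNIV R (k - 1)"
    using c R by (auto simp: forms_def \<zeta>_def sign)
  \<comment> \<open>For a form without \<open>t\<close>, removing another index from
    \<open>insert t K\<close> leaves \<open>t\<close> behind, so the summand for \<open>t\<close>
    alone survives.\<close>
  have top: "koszul UNIV D \<xi> $ insert t K = basis_sign t K * D t (\<xi> $ K)"
    if "t \<notin> K" and \<xi>: "\<And>K. t \<in> K \<Longrightarrow> \<xi> $ K = 0" for \<xi> K
  proof -
    have "koszul UNIV D \<xi> $ insert t K
        = (\<Sum>i\<in>insert t K. basis_sign i (insert t K) * D i (\<xi> $ (insert t K - {i})))"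
      by (simp add: koszul_nth)
    also have "\<dots> = (\<Sum>i\<in>insert t K. if i = t then basis_sign t K * D t (\<xi> $ K) else 0)"
      using that by (intro sum.cong) auto
    finally show ?thesis by simp
  qed
  define \<omega>' where "\<omega>' = \<omega> - koszul UNIV D \<zeta>"
  have closed: "koszul UNIV D \<omega>' = 0"
    by (simp add: \<omega>'_def koszul_diff \<omega> koszul_koszul)
  have "koszul UNIV D \<zeta> \<in> forms UNIV R (k - 1 + 1)"
    using \<zeta> R R_closed by (intro koszul_forms) auto
  then have mem: "\<omega>' $ K \<in> R" for K
    using \<omega> R R_closed unfolding \<omega>'_def by (auto simp: forms_def) (metis diff_conv_add_uminus)
  have zero: "\<omega>' $ K = 0" if "t \<in> K" for K
  proof -
    have "K = insert t (K - {t})" using that by auto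
    moreover have "koszul UNIV D \<zeta> $ insert t (K - {t}) = \<omega> $ insert t (K - {t})"
      using top [of "K - {t}" \<zeta>] c(2) [of "K - {t}"] by (simp add: \<zeta>_def D_sign)
    ultimately show ?thesis by (simp add: \<omega>'_def)
  qed
  have "\<omega>' $ K = 0" for K
  proof (cases "t \<in> K")
    case False
    then have "basis_sign t K * D t (\<omega>' $ K) = 0"
      using top [OF False, of \<omega>'] zero closed by simp
    then have "basis_sign t K * (basis_sign t K * D t (\<omega>' $ K)) = 0"
      by (simp only: mult_zero_right)
    then show ?thesis using inj mem by simp
  qed (rule zero)
  then have "\<omega> = koszul UNIV D \<zeta>"
    by (simp add: \<omega>'_def vec_eq_iff)
  moreover have "\<zeta> $ K = 0" if "t \<in> K" for K
    using that by (simp add: \<zeta>_def)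
  ultimately show thesis
    by (intro that [OF \<zeta>])
qed

section \<open>Laurent polynomials\<close>

lemma lookup_single_zero_mult:
  "Poly_Mapping.lookup (Poly_Mapping.single 0 s * r) m = s * Poly_Mapping.lookup r m"
  for r :: "'a::monoid_add \<Rightarrow>\<^sub>0 'b::semiring_0"
  by (simp add: map.rep_eq when_def flip: mult_map_scale_conv_mult)

lemma lookup_lconst_mult:
  "Poly_Mapping.lookup (lconst c * r) m = Poly_Mapping.single 0 c * Poly_Mapping.lookup r m"
  by (simp add: lconst_def lookup_single_zero_mult)

lemma lconst_add: "lconst (c + c') = lconst c + lconst c'"
  by (simp add: lconst_def single_add)

lemma lconst_mult: "lconst (c * c') = lconst c * lconst c'"
  by (simp add: lconst_def mult_single)

lemma lconst_one [simp]: "lconst 1 = 1"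
  by (simp add: lconst_def)

lemma lconst_zero [simp]: "lconst 0 = 0"
  by (simp add: lconst_def)

lemma lconst_uminus: "lconst (- c) = - lconst c"
  using lconst_add [of "- c" c] by (simp add: eq_neg_iff_add_eq_0)

lemma lconst_eq_0_iff [simp]: "lconst c = 0 \<longleftrightarrow> c = 0"
  by (metis lconst_def lookup_single_eq lookup_zero single_zero)

lemma lconst_of_int: "lconst (of_int k) = of_int k"
  by (simp add: lconst_def)

lemma lconst_of_nat: "lconst (of_nat k) = of_nat k"
  using lconst_of_int [of "int k"] by simp

lemma euler_add: "euler i (r + s) = euler i r + euler i s"
  by (intro poly_mapping_eqI) (simp add: lookup_euler lookup_add distrib_left)

lemma euler_zero [simp]: "euler i 0 = 0"
  using euler_add [of i 0 0] by simp

lemma euler_euler: "euler i (euler j r) = euler j (euler i r)"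
  by (rule poly_mapping_eqI) (simp add: lookup_euler mult.left_commute)

lemma euler_single:
  "euler i (Poly_Mapping.single m c) = Poly_Mapping.single m (of_int (Poly_Mapping.lookup m i) * c)"
  by (intro poly_mapping_eqI) (simp add: lookup_euler lookup_single when_def)

lemma euler_lconst [simp]: "euler i (lconst c) = 0"
  by (simp add: lconst_def euler_single)

lemma param_diff_add: "param_diff j (r + s) = param_diff j r + param_diff j s"
  by (intro poly_mapping_eqI) (simp add: lookup_param_diff lookup_add poly_diff_add)

lemma param_diff_zero [simp]: "param_diff j 0 = 0"
  using param_diff_add [of j 0 0] by simp

lemma param_diff_single: "param_diff j (Poly_Mapping.single m c) = Poly_Mapping.single m (poly_diff j c)"
  by (intro poly_mapping_eqI) (simp add: lookup_param_diff lookup_single when_def)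

lemma param_diff_lconst [simp]: "param_diff j (lconst c) = 0"
  by (simp add: lconst_def param_diff_single poly_diff_single)

lemma param_diff_lmonom [simp]: "param_diff j (lmonom v) = 0"
  unfolding lmonom_def param_diff_single single_one [symmetric] poly_diff_single by simp

lemma param_diff_lparam: "param_diff i (lparam j) = (if i = j then 1 else 0)"
  by (simp add: lparam_def param_diff_single poly_diff_single lookup_single when_def)

lemma poly_diff_poly_diff: "poly_diff i (poly_diff j p) = poly_diff j (poly_diff i p)"
  by (intro poly_mapping_eqI) (auto simp: lookup_poly_diff lookup_add lookup_single when_def add.commute add.left_commute)

lemma param_diff_param_diff: "param_diff i (param_diff j r) = param_diff j (param_diff i r)"
  by (intro poly_mapping_eqI) (simp add: lookup_param_diff poly_diff_poly_diff)

lemma poly_diff_of_int [simp]: "poly_diff j (of_int k * p) = of_int k * poly_diff j p"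
proof -
  have "poly_diff j (of_int k) = 0"
    by (metis (no_types, lifting) lookup_zero mult_zero_left of_nat_0 poly_diff_single single_of_int single_zero)
  then show ?thesis by (simp add: poly_diff_mult)
qed

lemma param_diff_euler: "param_diff j (euler i r) = euler i (param_diff j r)"
  by (intro poly_mapping_eqI) (simp add: lookup_param_diff lookup_euler)

lemma lookup_exponent: "Poly_Mapping.lookup (Abs_poly_mapping (($) v)) i = v $ i"
  for v :: "int ^ 'n::finite"
  by simp

lemma euler_lmonom: "euler i (lmonom v) = of_int (v $ i) * lmonom v"
proof -
  have "euler i (lmonom v) = Poly_Mapping.single 0 (of_int (v $ i)) * lmonom v"
    by (simp only: lmonom_def euler_single mult_single lookup_exponent add_0)
  then show ?thesis by simp
qed

lemma euler_lparam [simp]: "euler i (lparam j) = 0"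
  by (simp add: lparam_def euler_single)

lemma param_diff_generic: "param_diff j (generic_laurent a) = lmonom (a j)"
proof -
  have "param_diff j (sum h X) = (\<Sum>x\<in>X. param_diff j (h x))" for X and h :: "'b \<Rightarrow> ('a, 'b) laurent"
    by (induction X rule: infinite_finite_induct) (simp_all add: param_diff_add)
  then show ?thesis
    by (simp add: generic_laurent_def param_diff_mult param_diff_lparam if_distrib [of "\<lambda>x. x * _"] sum.delta cong: if_cong)
qed

section \<open>The grading\<close>

definition deg_ge :: "'n \<Rightarrow> int \<Rightarrow> ('n, 'j) laurent set" where
  "deg_ge t k = {r. \<forall>m\<in>Poly_Mapping.keys r. k \<le> Poly_Mapping.lookup m t}"

definition homogeneous :: "'n \<Rightarrow> int \<Rightarrow> ('n, 'j) laurent set" where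
  "homogeneous t k = {r. \<forall>m\<in>Poly_Mapping.keys r. Poly_Mapping.lookup m t = k}"

lemma subtorus_ring_eq: "subtorus_ring = homogeneous top_idx 0"
  by (simp add: subtorus_ring_def homogeneous_def)

lemma deg_ge_zero [simp]: "0 \<in> deg_ge t k"
  by (simp add: deg_ge_def)

lemma deg_ge_add: "r \<in> deg_ge t k \<Longrightarrow> s \<in> deg_ge t k \<Longrightarrow> r + s \<in> deg_ge t k"
  using keys_add [of r s] by (auto simp: deg_ge_def)

lemma deg_ge_uminus: "r \<in> deg_ge t k \<Longrightarrow> - r \<in> deg_ge t k"
  by (simp add: deg_ge_def in_keys_iff)

lemma deg_ge_diff: "r \<in> deg_ge t k \<Longrightarrow> s \<in> deg_ge t k \<Longrightarrow> r - s \<in> deg_ge t k"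
  using deg_ge_add [OF _ deg_ge_uminus] by fastforce

lemma deg_ge_mult:
  assumes "r \<in> deg_ge t k" "s \<in> deg_ge t l"
  shows "r * s \<in> deg_ge t (k + l)"
  using assms keys_mult [of r s] by (fastforce simp: deg_ge_def lookup_add)

lemma deg_ge_mono: "l \<le> k \<Longrightarrow> deg_ge t k \<subseteq> deg_ge t l"
  by (auto simp: deg_ge_def)

lemma homogeneous_zero [simp]: "0 \<in> homogeneous t k"
  by (simp add: homogeneous_def)

lemma homogeneous_add: "r \<in> homogeneous t k \<Longrightarrow> s \<in> homogeneous t k \<Longrightarrow> r + s \<in> homogeneous t k"
  using keys_add [of r s] by (auto simp: homogeneous_def)

lemma homogeneous_mult:
  assumes "r \<in> homogeneous t k" "s \<in> homogeneous t l"
  shows "r * s \<in> homogeneous t (k + l)"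
  using assms keys_mult [of r s] by (fastforce simp: homogeneous_def lookup_add)

lemma homogeneous_single [simp]:
  "Poly_Mapping.lookup m t = k \<Longrightarrow> Poly_Mapping.single m c \<in> homogeneous t k"
  by (simp add: homogeneous_def)

lemma homogeneous_lconst [simp]: "lconst c \<in> homogeneous t 0"
  by (simp add: lconst_def)

lemma homogeneous_one [simp]: "1 \<in> homogeneous t 0"
  using homogeneous_lconst [of 1] by simp

lemma homogeneous_lparam [simp]: "lparam j \<in> homogeneous t 0"
  by (simp add: lparam_def)

lemma homogeneous_lmonom [simp]: "lmonom v \<in> homogeneous t (v $ t)"
  by (simp add: lmonom_def)

lemma homogeneous_power: "r \<in> homogeneous t k \<Longrightarrow> r ^ n \<in> homogeneous t (int n * k)"
proof (induction n)
  case (Suc n)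
  then show ?case using homogeneous_mult [of r t k "r ^ n" "int n * k"] by (simp add: distrib_right)
qed simp

lemma homogeneous_subset_deg_ge: "homogeneous t k \<subseteq> deg_ge t k"
  by (auto simp: homogeneous_def deg_ge_def)

lemma homogeneous_euler: "r \<in> homogeneous t k \<Longrightarrow> euler i r \<in> homogeneous t k"
  by (auto simp: homogeneous_def in_keys_iff lookup_euler)

lemma homogeneous_param_diff: "r \<in> homogeneous t k \<Longrightarrow> param_diff j r \<in> homogeneous t k"
  by (auto simp: homogeneous_def in_keys_iff lookup_param_diff)

lemma deg_ge_euler: "r \<in> deg_ge t k \<Longrightarrow> euler i r \<in> deg_ge t k"
  by (auto simp: deg_ge_def in_keys_iff lookup_euler)

lemma deg_ge_param_diff: "r \<in> deg_ge t k \<Longrightarrow> param_diff j r \<in> deg_ge t k"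
  by (auto simp: deg_ge_def in_keys_iff lookup_param_diff)

lemma deg_ge_homogeneous_mult: "s \<in> homogeneous t l \<Longrightarrow> r \<in> deg_ge t k \<Longrightarrow> s * r \<in> deg_ge t (k + l)"
  using deg_ge_mult [of s t l r k] homogeneous_subset_deg_ge by (metis add.commute subsetD)

text \<open>Euler's identity for the degree in \<open>x\<^sub>t\<close>.\<close>

lemma euler_homogeneous:
  assumes "r \<in> homogeneous t k"
  shows "euler t r = lconst (of_int k) * r"
proof (rule poly_mapping_eqI)
  fix m
  show "Poly_Mapping.lookup (euler t r) m = Poly_Mapping.lookup (lconst (of_int k) * r) m"
    using assms by (cases "m \<in> Poly_Mapping.keys r") (auto simp: homogeneous_def lookup_euler lookup_lconst_mult in_keys_iff)
qed

section \<open>Finiteness properties of the filtration by degree\<close>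

lemma sum_singles: "(\<Sum>m\<in>Poly_Mapping.keys r. Poly_Mapping.single m (Poly_Mapping.lookup r m)) = r"
  by (intro poly_mapping_eqI) (simp add: lookup_sum lookup_single when_def in_keys_iff)

text \<open>The filtration is exhaustive, since a Laurent polynomial has finitely many
  exponents.\<close>

lemma deg_ge_bounded: "\<exists>k. r \<in> deg_ge t k"
proof (cases "r = 0")
  case False
  then have "\<forall>m\<in>Poly_Mapping.keys r. Min ((\<lambda>m. Poly_Mapping.lookup m t) ` Poly_Mapping.keys r) \<le> Poly_Mapping.lookup m t"
    by simp
  then show ?thesis unfolding deg_ge_def by blast
qed simp

text \<open>The filtration is separated: any exponent of \<open>r\<close> would violate the bound
  one above its own degree.\<close>

lemma deg_ge_separated:
  assumes "\<And>n. r \<in> deg_ge t (k + int n)"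
  shows "r = 0"
proof (rule ccontr)
  assume "r \<noteq> 0"
  then obtain m where "m \<in> Poly_Mapping.keys r"
    by (metis all_not_in_conv keys_eq_empty)
  moreover have "r \<in> deg_ge t (k + int (nat (Poly_Mapping.lookup m t - k + 1)))"
    by (rule assms)
  ultimately have "k + int (nat (Poly_Mapping.lookup m t - k + 1)) \<le> Poly_Mapping.lookup m t"
    unfolding deg_ge_def by blast
  then show False by linarith
qed

text \<open>\<open>s\<close> is the component of degree \<open>k\<close>. That splitting it off
  creates no new exponents preserves upper bounds on the degree, which makes the elimination in
  \<open>D_top_eliminate\<close> end.\<close>

lemma deg_ge_split:
  assumes "r \<in> deg_ge t k"
  obtains s where "s \<in> homogeneous t k" "r - s \<in> deg_ge t (k + 1)"
    "\<And>m. m \<in> Poly_Mapping.keys (r - s) \<Longrightarrow> m \<in> Poly_Mapping.keys r"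
proof -
  define s where "s = Poly_Mapping.mapp (\<lambda>m c. c when Poly_Mapping.lookup m t = k) r"
  have s: "Poly_Mapping.lookup s m = (Poly_Mapping.lookup r m when Poly_Mapping.lookup m t = k)" for m
    by (auto simp: s_def lookup_mapp when_def in_keys_iff)
  show thesis
  proof
    show "s \<in> homogeneous t k"
      by (auto simp: homogeneous_def in_keys_iff s when_def split: if_splits)
    have "k + 1 \<le> Poly_Mapping.lookup m t" if "m \<in> Poly_Mapping.keys (r - s)" for m
    proof -
      have "m \<in> Poly_Mapping.keys r" "Poly_Mapping.lookup m t \<noteq> k"
        using that by (auto simp: in_keys_iff lookup_minus s when_def split: if_splits)
      with assms have "k \<le> Poly_Mapping.lookup m t" by (simp add: deg_ge_def)
      with \<open>Poly_Mapping.lookup m t \<noteq> k\<close> show ?thesis by simp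
    qed
    then show "r - s \<in> deg_ge t (k + 1)" by (simp add: deg_ge_def)
    show "m \<in> Poly_Mapping.keys r" if "m \<in> Poly_Mapping.keys (r - s)" for m
      using that by (auto simp: in_keys_iff lookup_minus s when_def split: if_splits)
  qed
qed

text \<open>Exponents \<open>a k\<close> may coincide, but nothing cancels: the parameter with index
  \<open>j\<close> has coefficient 1 in the coefficient of this monomial.\<close>

lemma keys_generic_laurent: "Abs_poly_mapping (($) (a j)) \<in> Poly_Mapping.keys (generic_laurent a)"
proof -
  let ?m = "\<lambda>j. Abs_poly_mapping (($) (a j))"
  have inj: "Poly_Mapping.single k (1::nat) = Poly_Mapping.single j 1 \<longleftrightarrow> k = j" for k
    by (metis lookup_single_eq lookup_single_not_eq zero_neq_one)
  have "Poly_Mapping.lookup (generic_laurent a) (?m j)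
      = (\<Sum>k\<in>UNIV. Poly_Mapping.single (Poly_Mapping.single k 1) 1 when ?m k = ?m j)"
    by (simp add: generic_laurent_def lookup_sum lparam_def lmonom_def mult_single lookup_single)
  then have "Poly_Mapping.lookup (Poly_Mapping.lookup (generic_laurent a) (?m j)) (Poly_Mapping.single j 1)
      = (\<Sum>k\<in>UNIV. if k = j then 1 else 0)"
    by (simp only: lookup_sum, intro sum.cong refl) (auto simp: when_def lookup_single inj [unfolded One_nat_def])
  then show ?thesis by (auto simp: in_keys_iff)
qed

section \<open>The operators on the torus\<close>

definition torus_op ::
  "('j::finite \<Rightarrow> int ^ 'n::{finite,linorder}) \<Rightarrow> complex ^ 'n::{finite,linorder} \<Rightarrow> 'n \<Rightarrow> ('n, 'j) laurent \<Rightarrow> ('n, 'j) laurent"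
  where
  "torus_op a \<alpha> i r = euler i r + lconst (\<alpha> $ i) * r + euler i (generic_laurent a) * r"

lemma torus_nabla_eq_koszul:
  fixes a :: "'j::finite \<Rightarrow> int ^ 'n::{finite,linorder}"
  shows "torus_nabla a \<alpha> \<omega> = koszul UNIV (torus_op a \<alpha>) \<omega>"
proof -
  let ?f = "generic_laurent a"
  have "ext_deriv UNIV euler (axis {} ?f) \<and>\<^sub>f \<omega> = (\<Sum>i\<in>UNIV. euler i ?f *s ext_mult i \<omega>)"
    by (simp add: ext_deriv_axis wedge_sum_left wedge_axis)
  then have "torus_nabla a \<alpha> \<omega> = (\<Sum>i\<in>UNIV. ext_mult i (map_form (euler i) \<omega>)
      + lconst (\<alpha> $ i) *s ext_mult i \<omega> + euler i ?f *s ext_mult i \<omega>)"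
    by (simp add: torus_nabla_def wedge_axis ext_deriv_eq_koszul koszul_def sum.distrib)
  also have "\<dots> = koszul UNIV (torus_op a \<alpha>) \<omega>"
    unfolding koszul_def
    by (intro sum.cong refl) (simp add: vec_eq_iff ext_mult_def torus_op_def algebra_simps)
  finally show ?thesis .
qed

lemma commuting_torus_op:
  "commuting_operators (torus_op (a :: 'j::{finite,linorder} \<Rightarrow> int ^ 'n::{finite,linorder}) \<alpha>)"
proof
  fix i j and r s :: "('n, 'j) laurent"
  show "torus_op a \<alpha> i (r + s) = torus_op a \<alpha> i r + torus_op a \<alpha> i s"
    by (simp add: torus_op_def euler_add algebra_simps)
  show "torus_op a \<alpha> i (torus_op a \<alpha> j r) = torus_op a \<alpha> j (torus_op a \<alpha> i r)"
    by (simp add: torus_op_def euler_add euler_mult euler_euler [of j i] algebra_simps)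
qed

text \<open>Formally, both operators arise from commuting derivations by conjugation with the
  product of the exponential of \<open>generic_laurent a\<close> and \<open>x\<close> to the power
  \<open>\<alpha>\<close>. Concretely, the cross terms agree because \<open>lmonom (a j)\<close> is
  the derivative of \<open>generic_laurent a\<close> with respect to
  \<open>\<lambda>\<^sub>j\<close>.\<close>

lemma torus_op_param_diff:
  "torus_op a \<alpha> i (param_diff j r + lmonom (a j) * r)
    = param_diff j (torus_op a \<alpha> i r) + lmonom (a j) * torus_op a \<alpha> i r"
proof -
  have "param_diff j (euler i (generic_laurent a)) = euler i (lmonom (a j))"
    by (simp add: param_diff_euler param_diff_generic)
  then show ?thesis
    by (simp add: torus_op_def euler_add euler_mult param_diff_add param_diff_mult param_diff_euler algebra_simps)
qed

lemma torus_op_lparam: "torus_op a \<alpha> i (lparam j * r) = lparam j * torus_op a \<alpha> i r"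
  by (simp add: torus_op_def euler_mult algebra_simps)

lemma torus_op_lconst: "torus_op a \<alpha> i (lconst c * r) = lconst c * torus_op a \<alpha> i r"
  by (simp add: torus_op_def euler_mult algebra_simps)

lemma koszul_map_commute:
  assumes "\<And>i r. i \<in> S \<Longrightarrow> D i (h r) = h (D i r)"
    and add: "\<And>r s. h (r + s) = h r + h s"
  shows "koszul S D (map_form h \<omega>) = map_form h (koszul S D \<omega>)"
proof -
  have zero: "h 0 = 0" using add [of 0 0] by simp
  have "h (- r) = - h r" for r
    using add [of "- r" r] zero by (simp add: eq_neg_iff_add_eq_0)
  then have sign: "h (basis_sign i K * r) = basis_sign i K * h r" for i :: 'a and K r
    by (cases "even (card {j \<in> K. j < i})") (simp_all add: basis_sign_def)
  have sum: "h (\<Sum>i\<in>X. v i) = (\<Sum>i\<in>X. h (v i))" for v :: "'a \<Rightarrow> 'b" and X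
    by (induction X rule: infinite_finite_induct) (simp_all add: zero add)
  show ?thesis
    using assms(1) by (simp add: vec_eq_iff koszul_nth sum sign)
qed

lemma torus_gen_act_eq_map_form:
  "torus_gen_act a (Lam j) = map_form (\<lambda>r. lparam j * r)"
  "torus_gen_act a (Par j) = map_form (\<lambda>r. param_diff j r + lmonom (a j) * r)"
  by (auto simp: fun_eq_iff vec_eq_iff)

lemma torus_nabla_gen_act: "torus_nabla a \<alpha> (torus_gen_act a x \<omega>) = torus_gen_act a x (torus_nabla a \<alpha> \<omega>)"
proof (cases x)
  case (Lam j)
  then show ?thesis
    unfolding torus_nabla_eq_koszul Lam torus_gen_act_eq_map_form
    by (intro koszul_map_commute) (simp_all add: torus_op_lparam distrib_left)
next
  case (Par j)
  then show ?thesis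
    unfolding torus_nabla_eq_koszul Par torus_gen_act_eq_map_form
    by (intro koszul_map_commute) (simp_all add: torus_op_param_diff param_diff_add distrib_left add_ac)
qed

section \<open>Torus complexes with restricted coefficients\<close>

lemma forms_zero: "0 \<in> R \<Longrightarrow> 0 \<in> forms S R k"
  by (simp add: forms_def)

lemma forms_uminus:
  "\<omega> \<in> forms S R k \<Longrightarrow> (\<And>r. r \<in> R \<Longrightarrow> - r \<in> R) \<Longrightarrow> - \<omega> \<in> forms S R k"
  for R :: "'r::ab_group_add set"
  by (simp add: forms_def)

lemma forms_add:
  fixes R :: "'r::monoid_add set"
  assumes "\<omega> \<in> forms S R k" "\<eta> \<in> forms S R k" "\<And>r s. r \<in> R \<Longrightarrow> s \<in> R \<Longrightarrow> r + s \<in> R"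
  shows "\<omega> + \<eta> \<in> forms S R k"
proof -
  have "I \<subseteq> S \<and> int (card I) = k" if "(\<omega> + \<eta>) $ I \<noteq> 0" for I
  proof -
    have "\<omega> $ I \<noteq> 0 \<or> \<eta> $ I \<noteq> 0" using that by auto
    then show ?thesis using assms(1,2) unfolding forms_def by blast
  qed
  then show ?thesis using assms by (simp add: forms_def)
qed

lemma map_form_forms:
  assumes "\<omega> \<in> forms S R k" "h 0 = 0" "\<And>r. r \<in> R \<Longrightarrow> h r \<in> R'"
  shows "map_form h \<omega> \<in> forms S R' k"
proof -
  have "\<omega> $ I \<noteq> 0" if "h (\<omega> $ I) \<noteq> 0" for I
    using assms(2) that by auto
  then show ?thesis using assms by (simp add: forms_def)
qed

lemma smult_eq_map_form: "c *s \<omega> = map_form (\<lambda>r. c * r) \<omega>"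
  by (simp add: vec_eq_iff)

lemma linear_action_torus: "linear_action lconst (torus_gen_act a)"
proof
  fix x \<omega> \<eta> c
  show "torus_gen_act a x (\<omega> + \<eta>) = torus_gen_act a x \<omega> + torus_gen_act a x \<eta>"
    by (cases x) (simp_all add: vec_eq_iff param_diff_add algebra_simps)
  show "torus_gen_act a x (lconst c *s \<omega>) = lconst c *s torus_gen_act a x \<omega>"
    by (cases x) (simp_all add: vec_eq_iff param_diff_mult algebra_simps)
qed (simp_all add: lconst_add lconst_mult)

text \<open>The set \<open>R\<close> of coefficients is kept general so that one argument covers the
  full Laurent polynomial ring and its truncations \<open>deg_ge t k\<close>.\<close>

lemma weyl_complex_torus:
  fixes a :: "'j::{finite,linorder} \<Rightarrow> int ^ 'n::{finite,linorder}"
  assumes R: "0 \<in> R" "\<And>r s. r \<in> R \<Longrightarrow> s \<in> R \<Longrightarrow> r + s \<in> R" "\<And>r. r \<in> R \<Longrightarrow> - r \<in> R"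
    and euler: "\<And>i r. r \<in> R \<Longrightarrow> euler i r \<in> R" and param_diff: "\<And>j r. r \<in> R \<Longrightarrow> param_diff j r \<in> R"
    and scalar: "\<And>c r. r \<in> R \<Longrightarrow> lconst c * r \<in> R" "\<And>j r. r \<in> R \<Longrightarrow> lparam j * r \<in> R"
    and monom: "\<And>j r. r \<in> R \<Longrightarrow> lmonom (a j) * r \<in> R"
    and euler_generic: "\<And>i r. r \<in> R \<Longrightarrow> euler i (generic_laurent a) * r \<in> R"
  shows "weyl_complex (forms UNIV R) (torus_nabla a \<alpha>) (free_act lconst (torus_gen_act a))"
proof -
  interpret commuting_operators "torus_op a \<alpha>"
    by (rule commuting_torus_op)
  interpret linear_action lconst "torus_gen_act a"
    by (rule linear_action_torus)
  note add = forms_add [where R = R, OF _ _ R(2)] and zero = forms_zero [OF R(1)]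
    and uminus = forms_uminus [where R = R, OF _ R(3)]
  have gen: "torus_gen_act a x \<omega> \<in> forms UNIV R k" if "\<omega> \<in> forms UNIV R k" for x \<omega> k
    using R param_diff scalar monom
    by (cases x) (simp_all only: torus_gen_act_eq_map_form, (intro map_form_forms [OF that]; simp)+)
  have act_mem: "free_act lconst (torus_gen_act a) p \<omega> \<in> forms UNIV R k" if "\<omega> \<in> forms UNIV R k" for p \<omega> k
  proof (rule free_act_mem [OF that])
    show "lconst c *s \<eta> \<in> forms UNIV R k" if "\<eta> \<in> forms UNIV R k" for c \<eta>
      unfolding smult_eq_map_form by (rule map_form_forms [OF that]) (simp_all add: scalar)
  qed (simp_all add: gen zero add)
  show ?thesis
  proof
    show "free_act lconst (torus_gen_act a) p \<omega> = 0" if "p \<in> weyl_relations" for p \<omega>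
    proof (rule free_act_weyl_relations [OF linear_action_torus that])
      fix i j and \<omega> :: "(('n, 'j) laurent, 'n) form"
      show "torus_gen_act a (Par i) (torus_gen_act a (Par j) \<omega>)
          = torus_gen_act a (Par j) (torus_gen_act a (Par i) \<omega>)"
        by (simp add: vec_eq_iff param_diff_add param_diff_mult param_diff_param_diff [of i j] algebra_simps)
      show "torus_gen_act a (Par i) (torus_gen_act a (Lam j) \<omega>)
          = torus_gen_act a (Lam j) (torus_gen_act a (Par i) \<omega>) + (if i = j then \<omega> else 0)"
        by (simp add: vec_eq_iff param_diff_mult param_diff_lparam algebra_simps)
    qed (simp add: vec_eq_iff algebra_simps)
    show "torus_nabla a \<alpha> \<omega> \<in> forms UNIV R (k + 1)" if "\<omega> \<in> forms UNIV R k" for \<omega> k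
      unfolding torus_nabla_eq_koszul using that R euler scalar euler_generic
      by (intro koszul_forms) (auto simp: torus_op_def)
    show "torus_nabla a \<alpha> (free_act lconst (torus_gen_act a) p \<omega>)
        = free_act lconst (torus_gen_act a) p (torus_nabla a \<alpha> \<omega>)" for p \<omega>
    proof (rule free_act_intertwine [of _ UNIV])
      show "torus_nabla a \<alpha> (lconst c *s \<omega>) = lconst c *s torus_nabla a \<alpha> \<omega>" for c \<omega>
        unfolding torus_nabla_eq_koszul smult_eq_map_form
        by (intro koszul_map_commute) (simp_all add: torus_op_lconst distrib_left)
    qed (simp_all add: torus_nabla_gen_act, simp add: torus_nabla_eq_koszul koszul_add)
  qed (simp_all add: zero add uminus act_mem free_act_add free_act_plus free_act_times free_act_one
      torus_nabla_eq_koszul koszul_add)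
qed

section \<open>Truncation in the degree\<close>

locale torus_family =
  fixes a :: "'j::{finite,linorder} \<Rightarrow> int ^ 'n::{finite,linorder}"
    and \<alpha> :: "complex ^ 'n::{finite,linorder}"
    and g :: "('n, 'j) laurent"
  assumes factor: "generic_laurent a = lmonom (axis top_idx 1) * g"
    and g_subtorus: "g \<in> subtorus_ring"
begin

abbreviation t :: 'n where "t \<equiv> top_idx"

abbreviation f :: "('n, 'j) laurent" where "f \<equiv> generic_laurent a"

abbreviation D :: "'n \<Rightarrow> ('n, 'j) laurent \<Rightarrow> ('n, 'j) laurent" where "D \<equiv> torus_op a \<alpha>"

sublocale commuting_operators D
  by (rule commuting_torus_op)

lemma homogeneous_f: "f \<in> homogeneous t 1"
  using homogeneous_mult [of "lmonom (axis t 1)" t 1 g 0] homogeneous_lmonom [of "axis t 1" t] g_subtorus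
  by (simp add: factor subtorus_ring_eq)

lemma f_nonzero: "f \<noteq> 0"
  using keys_generic_laurent [of a] by auto

lemma g_nonzero: "g \<noteq> 0"
  using f_nonzero factor by auto

text \<open>The normalization of the last coordinate follows from the factorization: each exponent
  \<open>a j\<close> occurs in \<open>f\<close>, which is homogeneous of degree 1.\<close>

lemma a_top: "a j $ t = 1"
  using keys_generic_laurent [of a j] homogeneous_f by (auto simp: homogeneous_def)

lemma euler_top_f: "euler t f = f"
  using euler_homogeneous [OF homogeneous_f] by simp

lemma euler_f_mult: "r \<in> deg_ge t k \<Longrightarrow> euler i f * r \<in> deg_ge t (k + 1)"
  by (rule deg_ge_homogeneous_mult [OF homogeneous_euler [OF homogeneous_f]])

lemma deg_ge_lconst_mult: "r \<in> deg_ge t k \<Longrightarrow> lconst c * r \<in> deg_ge t k"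
  using deg_ge_homogeneous_mult [OF homogeneous_lconst, of r t k c] by simp

lemma deg_ge_D: "r \<in> deg_ge t k \<Longrightarrow> D i r \<in> deg_ge t k"
  using euler_f_mult [of r k i] deg_ge_mono [of k "k + 1" t]
  by (auto simp: torus_op_def intro!: deg_ge_add deg_ge_euler deg_ge_lconst_mult)

lemma weyl_complex_deg_ge:
  "weyl_complex (forms UNIV (deg_ge t k)) (torus_nabla a \<alpha>) (free_act lconst (torus_gen_act a))"
proof (rule weyl_complex_torus)
  fix r :: "('n, 'j) laurent" and i j
  assume r: "r \<in> deg_ge t k"
  have mono: "deg_ge t (k + 1) \<subseteq> deg_ge t k"
    by (rule deg_ge_mono) simp
  show "euler i f * r \<in> deg_ge t k"
    using euler_f_mult [OF r] mono by blast
  show "lmonom (a j) * r \<in> deg_ge t k"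
    using deg_ge_homogeneous_mult [OF homogeneous_lmonom r, of "a j"] mono by (auto simp: a_top)
  show "lparam j * r \<in> deg_ge t k"
    using deg_ge_homogeneous_mult [OF homogeneous_lparam r, of j] by simp
qed (auto intro: deg_ge_add deg_ge_uminus deg_ge_euler deg_ge_param_diff deg_ge_lconst_mult)

end

lemma deg_ge_basis_sign: "r \<in> deg_ge t k \<Longrightarrow> basis_sign i K * r \<in> deg_ge t k"
  by (cases "even (card {j \<in> K. j < i})") (simp_all add: basis_sign_def deg_ge_uminus)

lemma deg_ge_sum: "(\<And>x. x \<in> X \<Longrightarrow> h x \<in> deg_ge t k) \<Longrightarrow> (\<Sum>x\<in>X. h x) \<in> deg_ge t k"
  by (induction X rule: infinite_finite_induct) (auto intro: deg_ge_add)

text \<open>Up to terms of higher degree, \<open>D i\<close> multiplies \<open>x\<^sup>u\<close> by \<open>u\<^sub>i + \<alpha>\<^sub>i\<close>. Composing the contraction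
  with the inverse of this diagonal operator gives a null homotopy of the complex modulo forms of
  high degree.\<close>

context torus_family
begin

text \<open>A quotient with zero denominator is 0, so the map is defined for every \<open>i\<close>;
  it inverts the diagonal operator for non-integral \<open>\<alpha> $ i\<close>, where no
  denominator vanishes.\<close>

definition diag_inverse :: "'n \<Rightarrow> ('n, 'j) laurent \<Rightarrow> ('n, 'j) laurent" where
  "diag_inverse i r =
     Poly_Mapping.mapp (\<lambda>m c. Poly_Mapping.single 0 (1 / (of_int (Poly_Mapping.lookup m i) + \<alpha> $ i)) * c) r"

lemma lookup_diag_inverse:
  "Poly_Mapping.lookup (diag_inverse i r) m =
     Poly_Mapping.single 0 (1 / (of_int (Poly_Mapping.lookup m i) + \<alpha> $ i)) * Poly_Mapping.lookup r m"
  by (simp add: diag_inverse_def lookup_mapp when_def in_keys_iff)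

lemma diag_inverse_add: "diag_inverse i (r + s) = diag_inverse i r + diag_inverse i s"
  by (rule poly_mapping_eqI) (simp add: lookup_diag_inverse lookup_add distrib_left)

lemma diag_inverse_deg_ge: "r \<in> deg_ge t k \<Longrightarrow> diag_inverse i r \<in> deg_ge t k"
  by (auto simp: deg_ge_def in_keys_iff lookup_diag_inverse)

lemma diag_inverse_commute:
  "euler j (diag_inverse i r) = diag_inverse i (euler j r)"
  "lconst c * diag_inverse i r = diag_inverse i (lconst c * r)"
  by (rule poly_mapping_eqI, simp add: lookup_diag_inverse lookup_euler lookup_lconst_mult mult.left_commute)+

lemma diag_inverse_inverse:
  assumes "\<alpha> $ i \<notin> \<int>"
  shows "euler i (diag_inverse i r) + lconst (\<alpha> $ i) * diag_inverse i r = r"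
proof (rule poly_mapping_eqI)
  fix m
  let ?q = "of_int (Poly_Mapping.lookup m i) + \<alpha> $ i"
  have "?q \<noteq> 0"
  proof
    assume "?q = 0"
    then have "\<alpha> $ i = of_int (- Poly_Mapping.lookup m i)"
      by (simp add: eq_neg_iff_add_eq_0 add.commute)
    with assms show False by (metis Ints_of_int)
  qed
  have "Poly_Mapping.lookup (euler i (diag_inverse i r) + lconst (\<alpha> $ i) * diag_inverse i r) m
      = Poly_Mapping.single 0 ?q * (Poly_Mapping.single 0 (1 / ?q) * Poly_Mapping.lookup r m)"
    by (simp add: lookup_add lookup_euler lookup_lconst_mult lookup_diag_inverse single_add distrib_right)
  also have "\<dots> = Poly_Mapping.lookup r m"
    using \<open>?q \<noteq> 0\<close> by (simp add: mult_single flip: mult.assoc)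
  finally show "Poly_Mapping.lookup (euler i (diag_inverse i r) + lconst (\<alpha> $ i) * diag_inverse i r) m
      = Poly_Mapping.lookup r m" .
qed

text \<open>Let \<open>\<theta>\<close> be \<open>diag_inverse i\<close> applied to
  \<open>\<eta>\<close>, and \<open>\<xi>\<close> its contraction. By
  \<open>koszul_contract\<close>, the differential of \<open>\<xi>\<close> is \<open>D i\<close> of
  \<open>\<theta>\<close>, which is \<open>\<eta>\<close> up to higher degree, minus the contraction
  of the differential of \<open>\<theta>\<close>. The latter has higher degree because that of
  \<open>\<eta>\<close> does and \<open>diag_inverse i\<close> commutes with the differential up to
  higher degree.\<close>

lemma koszul_raise_degree:
  assumes nonint: "\<alpha> $ i \<notin> \<int>" and \<eta>: "\<eta> \<in> forms UNIV (deg_ge t l) k"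
    and d\<eta>: "\<And>K. koszul UNIV D \<eta> $ K \<in> deg_ge t (l + 1)"
  obtains \<xi> where "\<xi> \<in> forms UNIV UNIV (k - 1)" "\<eta> - koszul UNIV D \<xi> \<in> forms UNIV (deg_ge t (l + 1)) k"
proof -
  let ?E = "diag_inverse i"
  have E0: "?E 0 = 0"
    using diag_inverse_add [of i 0 0] by simp
  have "?E (- r) = - ?E r" for r
    using diag_inverse_add [of i "- r" r] E0 by (simp add: eq_neg_iff_add_eq_0)
  then have E_sign: "?E (basis_sign j K * r) = basis_sign j K * ?E r" for j K r
    by (cases "even (card {k \<in> K. k < j})") (simp_all add: basis_sign_def)
  have E_sum: "?E (\<Sum>x\<in>X. h x) = (\<Sum>x\<in>X. ?E (h x))" for X :: "'n set" and h
    by (induction X rule: infinite_finite_induct) (simp_all add: E0 diag_inverse_add)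
  define \<theta> where "\<theta> = map_form ?E \<eta>"
  define \<xi> where "\<xi> = contract i \<theta>"
  have \<theta>: "\<theta> \<in> forms UNIV UNIV k"
    unfolding \<theta>_def using \<eta> E0 by (rule map_form_forms) simp
  have \<xi>: "\<xi> \<in> forms UNIV UNIV (k - 1)"
    unfolding \<xi>_def by (rule contract_forms [OF \<theta>]) simp_all
  have \<eta>K: "\<eta> $ K \<in> deg_ge t l" for K
    using \<eta> by (simp add: forms_def)
  \<comment> \<open>The diagonal parts commute, and the remaining multiplication by
    \<open>euler j f\<close> raises the degree by one.\<close>
  have commutator: "D j (?E r) - ?E (D j r) \<in> deg_ge t (l + 1)" if "r \<in> deg_ge t l" for j r
  proof -
    have "D j (?E r) - ?E (D j r) = euler j f * ?E r - ?E (euler j f * r)"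
      by (simp add: torus_op_def diag_inverse_add diag_inverse_commute)
    then show ?thesis
      using that by (simp add: deg_ge_diff diag_inverse_deg_ge euler_f_mult)
  qed
  have "koszul UNIV D \<theta> $ K \<in> deg_ge t (l + 1)" for K
  proof -
    have "koszul UNIV D \<theta> $ K - ?E (koszul UNIV D \<eta> $ K)
        = (\<Sum>j\<in>K. basis_sign j K * (D j (?E (\<eta> $ (K - {j}))) - ?E (D j (\<eta> $ (K - {j})))))"
      by (simp add: koszul_nth \<theta>_def E_sum E_sign right_diff_distrib sum_subtractf)
    also have "\<dots> \<in> deg_ge t (l + 1)"
      by (intro deg_ge_sum deg_ge_basis_sign commutator \<eta>K)
    finally show ?thesis
      using deg_ge_add [OF _ diag_inverse_deg_ge [OF d\<eta>]] by (metis diff_add_cancel)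
  qed
  then have contract: "contract i (koszul UNIV D \<theta>) $ K \<in> deg_ge t (l + 1)" for K
    by (simp add: contract_def deg_ge_basis_sign)
  have DE: "D i (?E r) = r + euler i f * ?E r" for r
    by (simp add: torus_op_def diag_inverse_inverse [OF nonint])
  have "koszul UNIV D \<xi> = map_form (D i) \<theta> - contract i (koszul UNIV D \<theta>)"
    using koszul_contract [of i UNIV \<theta>] by (simp add: \<xi>_def eq_diff_eq)
  then have "(\<eta> - koszul UNIV D \<xi>) $ K = contract i (koszul UNIV D \<theta>) $ K - euler i f * ?E (\<eta> $ K)" for K
    by (simp add: \<theta>_def DE)
  then have "(\<eta> - koszul UNIV D \<xi>) $ K \<in> deg_ge t (l + 1)" for K
    using contract \<eta>K by (simp add: deg_ge_diff euler_f_mult diag_inverse_deg_ge)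
  moreover have "\<eta> - koszul UNIV D \<xi> \<in> forms UNIV UNIV k"
  proof -
    have "koszul UNIV D \<xi> \<in> forms UNIV UNIV k"
      using koszul_forms [OF \<xi>, of D] by simp
    moreover have "\<eta> \<in> forms UNIV UNIV k"
      using \<eta> forms_UNIV_iff by blast
    ultimately show ?thesis
      unfolding diff_conv_add_uminus by (intro forms_add forms_uminus) simp_all
  qed
  ultimately show thesis
    using that \<xi> forms_UNIV_iff by blast
qed

text \<open>Each step raises the lower bound by one, \<open>n\<close> being the distance to
  \<open>m\<close>. Subtracting an exact form leaves the differential unchanged, so the second
  premise persists.\<close>

lemma koszul_truncate_aux:
  assumes nonint: "\<alpha> $ i \<notin> \<int>"
  shows "\<eta> \<in> forms UNIV (deg_ge t (m - int n)) k \<Longrightarrow> (\<And>K. koszul UNIV D \<eta> $ K \<in> deg_ge t m) \<Longrightarrow>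
    \<exists>\<xi>\<in>forms UNIV UNIV (k - 1). \<eta> - koszul UNIV D \<xi> \<in> forms UNIV (deg_ge t m) k"
proof (induction n arbitrary: \<eta>)
  case 0
  then show ?case
    by (intro bexI [of _ 0]) (simp_all add: forms_zero koszul_def)
next
  case (Suc n)
  have "koszul UNIV D \<eta> $ K \<in> deg_ge t (m - int (Suc n) + 1)" for K
    using Suc.prems(2) deg_ge_mono [of "m - int (Suc n) + 1" m t] by auto
  from koszul_raise_degree [OF nonint Suc.prems(1) this]
  obtain \<xi> where \<xi>: "\<xi> \<in> forms UNIV UNIV (k - 1)"
      "\<eta> - koszul UNIV D \<xi> \<in> forms UNIV (deg_ge t (m - int (Suc n) + 1)) k"
    by blast
  have "\<eta> - koszul UNIV D \<xi> \<in> forms UNIV (deg_ge t (m - int n)) k"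
    using \<xi>(2) by simp
  moreover have "koszul UNIV D (\<eta> - koszul UNIV D \<xi>) $ K \<in> deg_ge t m" for K
    using Suc.prems(2) by (simp add: koszul_diff koszul_koszul)
  ultimately obtain \<xi>' where \<xi>': "\<xi>' \<in> forms UNIV UNIV (k - 1)"
      "\<eta> - koszul UNIV D \<xi> - koszul UNIV D \<xi>' \<in> forms UNIV (deg_ge t m) k"
    using Suc.IH by blast
  have "\<xi> + \<xi>' \<in> forms UNIV UNIV (k - 1)"
    using \<xi>(1) \<xi>'(1) by (rule forms_add) simp
  then show ?case
    using \<xi>'(2) by (intro bexI [of _ "\<xi> + \<xi>'"]) (simp_all add: koszul_add diff_diff_eq)
qed

text \<open>A form has finitely many components, hence a common lower bound for its degrees. Asking
  only the differential to lie in \<open>deg_ge t m\<close> covers cocycles as well as primitives of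
  forms with truncated coefficients.\<close>

lemma koszul_truncate:
  assumes nonint: "\<alpha> $ i \<notin> \<int>" and "\<eta> \<in> forms UNIV UNIV k"
    and "\<And>K. koszul UNIV D \<eta> $ K \<in> deg_ge t m"
  obtains \<xi> where "\<xi> \<in> forms UNIV UNIV (k - 1)" "\<eta> - koszul UNIV D \<xi> \<in> forms UNIV (deg_ge t m) k"
proof -
  have "\<forall>K. \<exists>l. \<eta> $ K \<in> deg_ge t l"
    by (intro allI deg_ge_bounded)
  then obtain h where h: "\<And>K. \<eta> $ K \<in> deg_ge t (h K)"
    by metis
  define n where "n = nat (m - Min (range h))"
  have le: "m - int n \<le> h K" for K
  proof -
    have "Min (range h) \<le> h K" by simp
    then show ?thesis unfolding n_def by linarith
  qed
  have "\<eta> $ K \<in> deg_ge t (m - int n)" for K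
    by (rule subsetD [OF deg_ge_mono [OF le] h])
  then have "\<eta> \<in> forms UNIV (deg_ge t (m - int n)) k"
    using assms(2) forms_UNIV_iff by blast
  from koszul_truncate_aux [OF nonint this assms(3)] that show thesis by blast
qed

end

section \<open>Derivations of the field of fractions\<close>

locale derivation =
  fixes \<delta> :: "'a::idom \<Rightarrow> 'a"
  assumes add: "\<delta> (x + y) = \<delta> x + \<delta> y"
    and mult: "\<delta> (x * y) = \<delta> x * y + x * \<delta> y"
begin

lemma \<delta>_one [simp]: "\<delta> 1 = 0"
  using mult [of 1 1] by (simp only: mult_1_left mult_1_right add_cancel_right_right)

abbreviation \<Delta> :: "'a fract \<Rightarrow> 'a fract" where "\<Delta> \<equiv> fract_deriv \<delta>"

lemma \<Delta>_Fract: "b \<noteq> 0 \<Longrightarrow> \<Delta> (Fract a b) = Fract (\<delta> a * b - a * \<delta> b) (b * b)"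
  using mult by (rule fract_deriv_Fract)

lemma \<Delta>_to_fract [simp]: "\<Delta> (to_fract x) = to_fract (\<delta> x)"
  by (simp add: to_fract_def \<Delta>_Fract)

lemma \<Delta>_add: "\<Delta> (p + q) = \<Delta> p + \<Delta> q"
proof -
  obtain a b c d where "p = Fract a b" "b \<noteq> 0" "q = Fract c d" "d \<noteq> 0"
    by (metis Fract_cases)
  then show ?thesis
    by (simp add: \<Delta>_Fract eq_fract add mult algebra_simps)
qed

lemma \<Delta>_mult: "\<Delta> (p * q) = \<Delta> p * q + p * \<Delta> q"
proof -
  obtain a b c d where "p = Fract a b" "b \<noteq> 0" "q = Fract c d" "d \<noteq> 0"
    by (metis Fract_cases)
  then show ?thesis
    by (simp add: \<Delta>_Fract eq_fract mult algebra_simps)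
qed

lemma \<Delta>_power: "q \<noteq> 0 \<Longrightarrow> \<Delta> (q ^ n) = of_nat n * q ^ n / q * \<Delta> q"
proof (induction n)
  case 0
  then show ?case using \<Delta>_to_fract [of 1] by simp
next
  case (Suc n)
  then show ?case by (simp add: \<Delta>_mult field_simps)
qed

lemma \<Delta>_divide_power:
  assumes "q \<noteq> 0"
  shows "\<Delta> (p / q ^ n) = \<Delta> p / q ^ n - of_nat n * (\<Delta> q / q) * (p / q ^ n)"
proof -
  have "\<Delta> p = \<Delta> (p / q ^ n * q ^ n)"
    using assms by simp
  also have "\<dots> = \<Delta> (p / q ^ n) * q ^ n + p / q ^ n * (of_nat n * q ^ n / q * \<Delta> q)"
    by (simp only: \<Delta>_mult \<Delta>_power [OF assms])
  finally show ?thesis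
    using assms by (simp add: field_simps)
qed

end

lemma derivation_euler: "derivation (euler i :: ('n::linorder, 'j::linorder) laurent \<Rightarrow> _)"
  by standard (simp_all add: euler_add euler_mult)

lemma derivation_param_diff: "derivation (param_diff j :: ('n::linorder, 'j::linorder) laurent \<Rightarrow> _)"
  by standard (simp_all add: param_diff_add param_diff_mult)

section \<open>The cokernel of the top operator\<close>

text \<open>Only terms of \<open>r\<close> itself are added up, so the partial sums remain in the
  same step of the filtration.\<close>

lemma deg_ge_induct [consumes 1, case_names zero add]:
  assumes "r \<in> deg_ge t k" "Q 0"
    and "\<And>m c s. k \<le> Poly_Mapping.lookup m t \<Longrightarrow> s \<in> deg_ge t k \<Longrightarrow> Q s \<Longrightarrow> Q (Poly_Mapping.single m c + s)"
  shows "Q r"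
proof -
  let ?v = "\<lambda>X. \<Sum>m\<in>X. Poly_Mapping.single m (Poly_Mapping.lookup r m)"
  have *: "?v X \<in> deg_ge t k \<and> Q (?v X)" if "finite X" "X \<subseteq> Poly_Mapping.keys r" for X
    using that
  proof (induction X)
    case empty
    then show ?case by (simp add: assms(2))
  next
    case (insert m X)
    have m: "k \<le> Poly_Mapping.lookup m t"
      using assms(1) insert.prems by (simp add: deg_ge_def)
    have X: "?v X \<in> deg_ge t k" "Q (?v X)"
      using insert by simp_all
    have "Poly_Mapping.single m (Poly_Mapping.lookup r m) \<in> deg_ge t k"
      using m by (simp add: deg_ge_def)
    from deg_ge_add [OF this X(1)] assms(3) [OF m X] show ?case
      unfolding sum.insert [OF insert(1,2)] by (rule conjI)
  qed
  from * [OF finite_keys order_refl] show ?thesis by (simp add: sum_singles)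
qed

lemma sum_keys_add:
  fixes h :: "'a \<Rightarrow> 'b::comm_monoid_add \<Rightarrow> 'c::comm_monoid_add"
  assumes "\<And>m. h m 0 = 0" and "\<And>m x y. h m (x + y) = h m x + h m y"
  shows "(\<Sum>m\<in>Poly_Mapping.keys (r + s). h m (Poly_Mapping.lookup (r + s) m)) =
    (\<Sum>m\<in>Poly_Mapping.keys r. h m (Poly_Mapping.lookup r m)) +
    (\<Sum>m\<in>Poly_Mapping.keys s. h m (Poly_Mapping.lookup s m))"
proof -
  let ?X = "Poly_Mapping.keys r \<union> Poly_Mapping.keys s"
  have *: "(\<Sum>m\<in>Poly_Mapping.keys q. h m (Poly_Mapping.lookup q m)) = (\<Sum>m\<in>?X. h m (Poly_Mapping.lookup q m))"
    if "Poly_Mapping.keys q \<subseteq> ?X" for q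
    using that assms(1) by (intro sum.mono_neutral_left) (auto simp: in_keys_iff)
  show ?thesis
    unfolding * [OF keys_add] * [OF Un_upper1] * [OF Un_upper2] by (simp add: lookup_add assms(2) sum.distrib)
qed

context torus_family
begin

text \<open>Larger than the absolute value of \<open>\<alpha> $ t\<close>, which excludes zeros of
  \<open>k + \<alpha> $ t\<close> from \<open>cutoff\<close> on. Being a natural number, it also
  makes the degrees in \<open>P\<close> nonnegative, so that converting them by \<open>nat\<close>
  loses nothing.\<close>

definition cutoff :: nat where
  "cutoff = nat \<lfloor>norm (\<alpha> $ t)\<rfloor> + 1"

abbreviation P :: "('n, 'j) laurent set" where "P \<equiv> deg_ge t (int cutoff)"

lemma cutoff_nonzero:
  assumes "cutoff \<le> k"
  shows "of_nat k + \<alpha> $ t \<noteq> 0"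
proof
  assume "of_nat k + \<alpha> $ t = 0"
  then have "norm (\<alpha> $ t) = of_nat k"
    by (metis add_eq_0_iff norm_minus_cancel norm_of_nat)
  then have "cutoff = k + 1"
    by (simp add: cutoff_def)
  with assms show False by simp
qed

lemma D_top_homogeneous:
  assumes "cutoff \<le> k" "r \<in> homogeneous t (int k)"
  shows "D t r = lconst (of_nat k + \<alpha> $ t) * r + f * r"
  using euler_homogeneous [OF assms(2)]
  by (simp add: torus_op_def euler_top_f lconst_add distrib_right)

text \<open>Modulo the image of \<open>D t\<close>, the lowest component can be traded for one of
  the next degree, without exceeding the upper bound. After \<open>n\<close> steps everything sits
  in a single degree.\<close>

lemma D_top_eliminate:
  assumes "r \<in> deg_ge t (int k)" "cutoff \<le> k" "\<And>m. m \<in> Poly_Mapping.keys r \<Longrightarrow> Poly_Mapping.lookup m t \<le> int k + int n"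
  shows "\<exists>c\<in>P. r - D t c \<in> homogeneous t (int k + int n)"
  using assms
proof (induction n arbitrary: k r)
  case 0
  then have "r \<in> homogeneous t (int k)"
    by (force simp: homogeneous_def deg_ge_def)
  then show ?case by (intro bexI [of _ 0]) simp_all
next
  case (Suc n)
  obtain s where s: "s \<in> homogeneous t (int k)" "r - s \<in> deg_ge t (int k + 1)"
    "\<And>m. m \<in> Poly_Mapping.keys (r - s) \<Longrightarrow> m \<in> Poly_Mapping.keys r"
    using deg_ge_split [OF Suc.prems(1)] by blast
  \<comment> \<open>The factor is chosen so that \<open>D t c = s + f * c\<close>: the component
    \<open>s\<close> is cancelled, and \<open>f * c\<close> has the next degree.\<close>
  define c where "c = lconst (1 / (of_nat k + \<alpha> $ t)) * s"
  have c: "c \<in> homogeneous t (int k)"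
    using homogeneous_mult [OF homogeneous_lconst s(1)] by (simp add: c_def)
  have fc: "f * c \<in> homogeneous t (int k + 1)"
    using homogeneous_mult [OF homogeneous_f c] by (simp add: add.commute)
  have "lconst (of_nat k + \<alpha> $ t) * c = s"
    using cutoff_nonzero [OF Suc.prems(2)] by (simp add: c_def mult.assoc [symmetric] flip: lconst_mult)
  then have Dc: "r - D t c = (r - s) - f * c"
    using D_top_homogeneous [OF Suc.prems(2) c] by simp
  have "r - D t c \<in> deg_ge t (int (Suc k))"
    using s(2) fc homogeneous_subset_deg_ge [of t "int k + 1"] unfolding Dc
    by (auto intro: deg_ge_diff simp: add.commute)
  moreover have "Poly_Mapping.lookup m t \<le> int (Suc k) + int n" if "m \<in> Poly_Mapping.keys (r - D t c)" for m
  proof -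
    have "m \<in> Poly_Mapping.keys (r - s) \<or> m \<in> Poly_Mapping.keys (f * c)"
      using that unfolding Dc by (auto simp: in_keys_iff lookup_minus)
    then show ?thesis
    proof
      assume "m \<in> Poly_Mapping.keys (r - s)"
      then show ?thesis using s(3) Suc.prems(3) by fastforce
    next
      assume "m \<in> Poly_Mapping.keys (f * c)"
      then show ?thesis using fc by (simp add: homogeneous_def)
    qed
  qed
  ultimately obtain c' where c': "c' \<in> P" "r - D t c - D t c' \<in> homogeneous t (int (Suc k) + int n)"
    using Suc.IH [of "r - D t c" "Suc k"] Suc.prems(2) by auto
  have "c \<in> P"
    using c homogeneous_subset_deg_ge [of t "int k"] deg_ge_mono [of "int cutoff" "int k" t] Suc.prems(2) by auto
  then have "c + c' \<in> P"
    using c'(1) by (rule deg_ge_add)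
  moreover have "r - D t (c + c') = r - D t c - D t c'" "int k + int (Suc n) = int (Suc k) + int n"
    by (simp_all add: D_add)
  ultimately show ?case
    using c'(2) by metis
qed

text \<open>Comparing terms of lowest degree shows that the lowest component is zero, since its
  factor \<open>k + \<alpha> $ t\<close> is not. Hence \<open>r\<close> lies in every step of the
  filtration.\<close>

lemma D_top_inj:
  assumes "r \<in> P" "D t r = 0"
  shows "r = 0"
proof -
  have "r \<in> deg_ge t (int cutoff + int n)" for n
  proof (induction n)
    case 0
    then show ?case using assms by simp
  next
    case (Suc n)
    let ?k = "cutoff + n"
    obtain s where s: "s \<in> homogeneous t (int ?k)" "r - s \<in> deg_ge t (int ?k + 1)"
      using deg_ge_split [of r t "int ?k"] Suc by auto
    have "D t s = - D t (r - s)"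
      using assms(2) by (simp add: D_diff)
    then have "lconst (of_nat ?k + \<alpha> $ t) * s = - D t (r - s) - f * s"
      using D_top_homogeneous [OF _ s(1)] by (simp add: eq_diff_eq)
    also have "\<dots> \<in> deg_ge t (int ?k + 1)"
      using deg_ge_D [OF s(2)] deg_ge_homogeneous_mult [OF homogeneous_f, of s "int ?k"]
        s(1) homogeneous_subset_deg_ge [of t "int ?k"]
      by (auto intro!: deg_ge_diff deg_ge_uminus)
    finally have "lconst (1 / (of_nat ?k + \<alpha> $ t)) * (lconst (of_nat ?k + \<alpha> $ t) * s) \<in> deg_ge t (int ?k + 1)"
      by (rule deg_ge_lconst_mult)
    then have "s \<in> deg_ge t (int ?k + 1)"
      using cutoff_nonzero [of ?k] by (simp add: mult.assoc [symmetric] flip: lconst_mult)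
    from deg_ge_add [OF s(2) this] have "r \<in> deg_ge t (int ?k + 1)"
      by (simp only: diff_add_cancel)
    then show ?case by (simp add: add_ac)
  qed
  then show ?thesis by (rule deg_ge_separated)
qed

definition \<gamma> :: "nat \<Rightarrow> complex" where
  "\<gamma> k = (\<Prod>l\<in>{cutoff..<k}. - (of_nat l + \<alpha> $ t))"

lemma \<gamma>_Suc: "cutoff \<le> k \<Longrightarrow> \<gamma> (Suc k) = - (of_nat k + \<alpha> $ t) * \<gamma> k"
  by (simp add: \<gamma>_def atLeastLessThanSuc)

lemma lconst_\<gamma>_Suc: "cutoff \<le> k \<Longrightarrow> lconst (\<gamma> (Suc k)) = - lconst (of_nat k + \<alpha> $ t) * lconst (\<gamma> k)"
  by (simp only: \<gamma>_Suc lconst_mult lconst_uminus)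

lemma \<gamma>_nonzero: "\<gamma> k \<noteq> 0"
proof -
  have "- (of_nat l + \<alpha> $ t) \<noteq> 0" if "l \<in> {cutoff..<k}" for l
    using cutoff_nonzero that by (metis atLeastLessThan_iff neg_equal_0_iff_equal)
  then show ?thesis unfolding \<gamma>_def by (simp only: prod_zero_iff finite_atLeastLessThan) blast
qed

abbreviation F :: "('n, 'j) laurent fract" where "F \<equiv> to_fract f"

text \<open>The projection onto the cokernel of \<open>D t\<close>: the relation
  \<open>D t r = (k + \<alpha>\<^sub>t) r + f r\<close> for \<open>r\<close> of degree \<open>k\<close> dictates the recurrence satisfied by \<open>\<gamma>\<close>.\<close>

definition \<Phi> :: "('n, 'j) laurent \<Rightarrow> ('n, 'j) laurent fract" where
  "\<Phi> r = (\<Sum>m\<in>Poly_Mapping.keys r.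
     to_fract (lconst (\<gamma> (nat (Poly_Mapping.lookup m t))) * Poly_Mapping.single m (Poly_Mapping.lookup r m))
       / F ^ nat (Poly_Mapping.lookup m t))"

section \<open>Compatibility of the projection with the operators\<close>

lemma \<Phi>_add: "\<Phi> (r + s) = \<Phi> r + \<Phi> s"
  unfolding \<Phi>_def
  by (rule sum_keys_add) (simp_all add: single_add distrib_left add_divide_distrib)

lemma \<Phi>_zero [simp]: "\<Phi> 0 = 0"
  by (simp add: \<Phi>_def)

lemma \<Phi>_uminus: "\<Phi> (- r) = - \<Phi> r"
  using \<Phi>_add [of "- r" r] by (simp add: eq_neg_iff_add_eq_0)

lemma \<Phi>_diff: "\<Phi> (r - s) = \<Phi> r - \<Phi> s"
  using \<Phi>_add [of r "- s"] by (simp add: \<Phi>_uminus)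

lemma \<Phi>_homogeneous:
  assumes "r \<in> homogeneous t (int k)"
  shows "\<Phi> r = to_fract (lconst (\<gamma> k) * r) / F ^ k"
proof -
  have "\<Phi> r = (\<Sum>m\<in>Poly_Mapping.keys r.
      to_fract (lconst (\<gamma> k) * Poly_Mapping.single m (Poly_Mapping.lookup r m)) / F ^ k)"
    unfolding \<Phi>_def using assms by (intro sum.cong) (simp_all add: homogeneous_def)
  also have "\<dots> = to_fract (lconst (\<gamma> k) * (\<Sum>m\<in>Poly_Mapping.keys r. Poly_Mapping.single m (Poly_Mapping.lookup r m))) / F ^ k"
    by (simp add: sum_divide_distrib sum_distrib_left del: to_fract_mult)
  finally show ?thesis by (simp only: sum_singles)
qed


text \<open>Elements of \<open>P\<close> are sums of monomials of degree at least
  \<open>cutoff\<close>. This reduces additive identities to homogeneous elements, on which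
  \<open>\<Phi>\<close> is a single fraction.\<close>

lemma P_additive_eq:
  assumes "r \<in> P" and "\<And>r s. A (r + s) = A r + (A s :: 'b::ab_group_add)" "\<And>r s. B (r + s) = B r + B s"
    and "\<And>k r. cutoff \<le> k \<Longrightarrow> r \<in> homogeneous t (int k) \<Longrightarrow> A r = B r"
  shows "A r = B r"
  using assms(1)
proof (induction rule: deg_ge_induct)
  case zero
  show ?case using assms(2) [of 0 0] assms(3) [of 0 0] by simp
next
  case (add m c s)
  then have "cutoff \<le> nat (Poly_Mapping.lookup m t)"
      "Poly_Mapping.single m c \<in> homogeneous t (int (nat (Poly_Mapping.lookup m t)))"
    by (simp_all add: le_nat_iff)
  then show ?case using add assms(2-4) by simp
qed

lemma \<Phi>_degree_zero_mult:
  assumes "r \<in> P" "s \<in> homogeneous t 0"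
  shows "\<Phi> (s * r) = to_fract s * \<Phi> r"
  using assms(1)
proof (rule P_additive_eq)
  fix k and r :: "('n, 'j) laurent"
  assume r: "r \<in> homogeneous t (int k)"
  have "s * r \<in> homogeneous t (int k)"
    using homogeneous_mult [OF assms(2) r] by simp
  with r show "\<Phi> (s * r) = to_fract s * \<Phi> r"
    by (simp add: \<Phi>_homogeneous mult_ac)
qed (simp_all add: \<Phi>_add distrib_left)

text \<open>One computation serves \<open>euler i\<close> and \<open>param_diff j\<close>. In degree
  \<open>k\<close>, differentiating \<open>1 / F ^ k\<close> produces the factor \<open>- k\<close>,
  and passing from \<open>\<gamma> k\<close> to \<open>\<gamma> (Suc k)\<close> produces
  \<open>- (k + \<alpha> $ t)\<close>; their difference is the twist by
  \<open>- \<alpha> $ t\<close>.\<close>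

lemma \<Phi>_derivation:
  assumes "derivation \<delta>" "r \<in> P" and lconst: "\<And>c. \<delta> (lconst c) = 0"
    and homogeneous: "\<And>k r. r \<in> homogeneous t k \<Longrightarrow> \<delta> r \<in> homogeneous t k"
  shows "\<Phi> (\<delta> r + \<delta> f * r) = fract_deriv \<delta> (\<Phi> r) - to_fract (lconst (\<alpha> $ t)) * (to_fract (\<delta> f) / F) * \<Phi> r"
  using assms(2)
proof (rule P_additive_eq)
  interpret derivation \<delta> by fact
  fix k and r :: "('n, 'j) laurent"
  assume k: "cutoff \<le> k" and r: "r \<in> homogeneous t (int k)"
  have F: "F \<noteq> 0" using f_nonzero by simp
  define q where "q = \<Phi> r"
  have q: "q = to_fract (lconst (\<gamma> k) * r) / F ^ k"
    unfolding q_def by (rule \<Phi>_homogeneous [OF r])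
  have "\<delta> f * r \<in> homogeneous t (int (Suc k))"
    using homogeneous_mult [OF homogeneous [OF homogeneous_f] r] by simp
  then have "\<Phi> (\<delta> f * r) = to_fract (lconst (\<gamma> (Suc k)) * (\<delta> f * r)) / F ^ Suc k"
    by (rule \<Phi>_homogeneous)
  also have "\<dots> = - to_fract (lconst (of_nat k + \<alpha> $ t)) * (to_fract (\<delta> f) / F) * q"
    by (simp add: lconst_\<gamma>_Suc [OF k] q)
  finally have 1: "\<Phi> (\<delta> f * r) = - to_fract (lconst (of_nat k + \<alpha> $ t)) * (to_fract (\<delta> f) / F) * q" .
  have "\<delta> (lconst (\<gamma> k) * r) = lconst (\<gamma> k) * \<delta> r"
    by (simp add: mult lconst)
  then have "fract_deriv \<delta> q = to_fract (lconst (\<gamma> k) * \<delta> r) / F ^ k - of_nat k * (to_fract (\<delta> f) / F) * q"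
    unfolding q \<Delta>_divide_power [OF F] by (simp only: \<Delta>_to_fract)
  also have "to_fract (lconst (\<gamma> k) * \<delta> r) / F ^ k = \<Phi> (\<delta> r)"
    by (rule \<Phi>_homogeneous [symmetric]) (rule homogeneous [OF r])
  finally have 2: "\<Phi> (\<delta> r) = fract_deriv \<delta> q + of_nat k * (to_fract (\<delta> f) / F) * q"
    by simp
  have "to_fract (of_nat k) = (of_nat k :: ('n, 'j) laurent fract)"
    by (induction k) simp_all
  then show "\<Phi> (\<delta> r + \<delta> f * r) = fract_deriv \<delta> (\<Phi> r) - to_fract (lconst (\<alpha> $ t)) * (to_fract (\<delta> f) / F) * \<Phi> r"
    unfolding \<Phi>_add 1 2 q_def [symmetric] by (simp add: lconst_add lconst_of_nat algebra_simps)
next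
  interpret derivation \<delta> by fact
  fix r s
  show "\<Phi> (\<delta> (r + s) + \<delta> f * (r + s)) = \<Phi> (\<delta> r + \<delta> f * r) + \<Phi> (\<delta> s + \<delta> f * s)"
    by (simp add: add \<Phi>_add distrib_left)
  show "fract_deriv \<delta> (\<Phi> (r + s)) - to_fract (lconst (\<alpha> $ t)) * (to_fract (\<delta> f) / F) * \<Phi> (r + s)
      = fract_deriv \<delta> (\<Phi> r) - to_fract (lconst (\<alpha> $ t)) * (to_fract (\<delta> f) / F) * \<Phi> r
        + (fract_deriv \<delta> (\<Phi> s) - to_fract (lconst (\<alpha> $ t)) * (to_fract (\<delta> f) / F) * \<Phi> s)"
    by (simp add: \<Phi>_add \<Delta>_add algebra_simps add_divide_distrib)
qed

text \<open>In degree \<open>k\<close> the images of \<open>(k + \<alpha> $ t) r\<close> and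
  \<open>f * r\<close> cancel by the recurrence for \<open>\<gamma>\<close>.\<close>

lemma \<Phi>_D_top: 
  assumes "r \<in> P"
  shows "\<Phi> (D t r) = 0"
  using assms
proof (rule P_additive_eq)
  fix k and r :: "('n, 'j) laurent"
  assume k: "cutoff \<le> k" and r: "r \<in> homogeneous t (int k)"
  have "lconst (of_nat k + \<alpha> $ t) * r \<in> homogeneous t (int k)"
    using homogeneous_mult [OF homogeneous_lconst r] by simp
  moreover have "f * r \<in> homogeneous t (int (Suc k))"
    using homogeneous_mult [OF homogeneous_f r] by simp
  ultimately show "\<Phi> (D t r) = 0"
    using f_nonzero by (simp only: D_top_homogeneous [OF k r] \<Phi>_add \<Phi>_homogeneous lconst_\<gamma>_Suc [OF k]) simp
qed (simp_all add: D_add \<Phi>_add)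

text \<open>By \<open>D_top_eliminate\<close>, \<open>r\<close> can be made homogeneous modulo the
  image of \<open>D t\<close>; in a single degree \<open>\<Phi>\<close> is multiplication by a
  nonzero fraction, hence injective.\<close>

lemma \<Phi>_eq_0_imp:
  assumes "r \<in> P" "\<Phi> r = 0"
  shows "r \<in> D t ` P"
proof -
  \<comment> \<open>For \<open>r = 0\<close> this maximum is unspecified, which is harmless: there
    are no exponents to bound.\<close>
  define b where "b = Max ((\<lambda>m. Poly_Mapping.lookup m t) ` Poly_Mapping.keys r)"
  define n where "n = nat (b - int cutoff)"
  obtain c where c: "c \<in> P" "r - D t c \<in> homogeneous t (int cutoff + int n)"
  proof -
    have "Poly_Mapping.lookup m t \<le> int cutoff + int n" if "m \<in> Poly_Mapping.keys r" for m
    proof -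
      have "Poly_Mapping.lookup m t \<le> b" using that by (simp add: b_def)
      then show ?thesis unfolding n_def by linarith
    qed
    then show thesis using D_top_eliminate [OF assms(1) order_refl, of n] that by blast
  qed
  have "\<Phi> (r - D t c) = 0"
    using assms \<Phi>_D_top [OF c(1)] by (simp add: \<Phi>_diff)
  then have "r - D t c = 0"
    using \<Phi>_homogeneous [of "r - D t c" "cutoff + n"] c(2) f_nonzero \<gamma>_nonzero by simp
  then show ?thesis using c(1) by auto
qed

end

section \<open>The complex on the open set\<close>

lemma lmonom_mult: "lmonom v * lmonom w = lmonom (v + w)"
proof -
  have "Abs_poly_mapping (($) v) + Abs_poly_mapping (($) w) = Abs_poly_mapping (($) (v + w))"
    by (rule poly_mapping_eqI) (simp add: lookup_add)
  then show ?thesis by (simp add: lmonom_def mult_single)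
qed

lemma lmonom_zero: "lmonom 0 = 1"
proof -
  have "Abs_poly_mapping (($) (0 :: int ^ 'a)) = 0"
    by (rule poly_mapping_eqI) simp
  then show ?thesis by (simp add: lmonom_def)
qed

context torus_family
begin

section \<open>Regular functions as values of the projection\<close>

abbreviation X :: "('n, 'j) laurent" where "X \<equiv> lmonom (axis t 1)"

abbreviation G :: "('n, 'j) laurent fract" where "G \<equiv> to_fract g"

lemma X_inverse: "X * lmonom (axis t (- 1)) = 1"
proof -
  have "axis t 1 + axis t (- 1 :: int) = 0"
    by (simp add: vec_eq_iff axis_def)
  then show ?thesis by (simp add: lmonom_mult lmonom_zero)
qed

lemma X_nonzero: "X \<noteq> 0"
  using X_inverse by auto

lemma F_eq: "F = to_fract X * G"
  by (simp add: factor)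

lemma to_fract_power: "to_fract (r ^ k) = to_fract r ^ k"
  by (induction k) simp_all

lemma homogeneous_mult_zero: "r \<in> homogeneous t 0 \<Longrightarrow> s \<in> homogeneous t 0 \<Longrightarrow> r * s \<in> homogeneous t 0"
  for r s :: "('n, 'j) laurent"
  using homogeneous_mult [of r t 0 s 0] by simp

lemma regular_fun_zero: "0 \<in> regular_fun g"
  unfolding regular_fun_def subtorus_ring_eq by (intro CollectI exI [of _ 0] exI [of _ 0]) simp

lemma regular_fun_add:
  assumes "p \<in> regular_fun g" "q \<in> regular_fun g"
  shows "p + q \<in> regular_fun g"
proof -
  obtain r k s l where *: "p = to_fract r / G ^ k" "r \<in> homogeneous t 0" "q = to_fract s / G ^ l" "s \<in> homogeneous t 0"
    using assms by (auto simp: regular_fun_def subtorus_ring_eq)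
  have "g ^ m \<in> homogeneous t 0" for m
    using homogeneous_power [of g t 0 m] g_subtorus by (simp add: subtorus_ring_eq)
  then have "r * g ^ l + s * g ^ k \<in> homogeneous t 0"
    using * by (intro homogeneous_add homogeneous_mult_zero)
  moreover have "p + q = to_fract (r * g ^ l + s * g ^ k) / G ^ (k + l)"
    unfolding *(1,3) using g_nonzero by (simp add: to_fract_power field_simps power_add)
  ultimately show ?thesis unfolding regular_fun_def subtorus_ring_eq by blast
qed

text \<open>A term of degree \<open>k\<close> contains the factor \<open>X ^ k\<close>, which
  cancels against the one in \<open>F ^ k\<close> and leaves a power of \<open>g\<close> as
  denominator.\<close>

lemma \<Phi>_mem:
  assumes "r \<in> P"
  shows "\<Phi> r \<in> regular_fun g"
  using assms
proof (induction rule: deg_ge_induct)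
  case zero
  show ?case by (simp add: regular_fun_zero)
next
  case (add m c s)
  define k where "k = nat (Poly_Mapping.lookup m t)"
  define q :: "('n, 'j) laurent" where "q = Poly_Mapping.single m c"
  \<comment> \<open>\<open>Y\<close> is the inverse of \<open>X ^ k\<close>.\<close>
  define Y :: "('n, 'j) laurent" where "Y = lmonom (axis t (- 1)) ^ k"
  have q: "q \<in> homogeneous t (int k)"
    using add by (simp add: q_def k_def)
  have Y: "Y \<in> homogeneous t (- int k)"
    using homogeneous_power [OF homogeneous_lmonom [of "axis t (- 1)" t], of k] by (simp add: Y_def)
  have XY: "X ^ k * Y = 1"
    by (simp add: Y_def X_inverse flip: power_mult_distrib)
  have "\<Phi> q = to_fract (X ^ k * Y * (lconst (\<gamma> k) * q)) / (to_fract X * G) ^ k"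
    by (simp add: \<Phi>_homogeneous [OF q] XY F_eq)
  also have "\<dots> = to_fract (Y * (lconst (\<gamma> k) * q)) / G ^ k"
    using X_nonzero by (simp add: to_fract_power power_mult_distrib)
  finally have "\<Phi> q = to_fract (Y * (lconst (\<gamma> k) * q)) / G ^ k" .
  moreover have "Y * (lconst (\<gamma> k) * q) \<in> homogeneous t 0"
    using homogeneous_mult [OF Y homogeneous_mult [OF homogeneous_lconst q]] by simp
  ultimately have "\<Phi> q \<in> regular_fun g"
    unfolding regular_fun_def subtorus_ring_eq by blast
  then show ?case
    using add unfolding \<Phi>_add q_def by (intro regular_fun_add)
qed

text \<open>A fraction with denominator \<open>g ^ k\<close> is expanded by
  \<open>g ^ cutoff\<close>, and then by the power of \<open>X\<close> that turns the denominator
  into a power of \<open>f\<close>; this brings the numerator into \<open>P\<close>.\<close>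

lemma \<Phi>_surj:
  assumes "q \<in> regular_fun g"
  obtains r where "r \<in> P" "\<Phi> r = q"
proof -
  obtain s k where s: "s \<in> homogeneous t 0" "q = to_fract s / G ^ k"
    using assms by (auto simp: regular_fun_def subtorus_ring_eq)
  define K where "K = cutoff + k"
  define v where "v = X ^ K * (g ^ cutoff * s)"
  have "X ^ K \<in> homogeneous t (int K)"
    using homogeneous_power [OF homogeneous_lmonom [of "axis t 1" t], of K] by simp
  moreover have "g ^ cutoff \<in> homogeneous t 0"
    using homogeneous_power [of g t 0 cutoff] g_subtorus by (simp add: subtorus_ring_eq)
  ultimately have "v \<in> homogeneous t (int K)"
    using homogeneous_mult [of "X ^ K" t "int K" "g ^ cutoff * s" 0] homogeneous_mult_zero [of "g ^ cutoff" s] s(1)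
    by (simp add: v_def)
  then have r: "lconst (1 / \<gamma> K) * v \<in> homogeneous t (int K)"
    using homogeneous_mult [OF homogeneous_lconst, of v t "int K"] by simp
  have "lconst (\<gamma> K) * (lconst (1 / \<gamma> K) * v) = v"
    using \<gamma>_nonzero [of K] by (simp add: mult.assoc [symmetric] flip: lconst_mult)
  then have "\<Phi> (lconst (1 / \<gamma> K) * v) = to_fract v / F ^ K"
    using \<Phi>_homogeneous [OF r] by (simp only:)
  also have "\<dots> = q"
    using X_nonzero g_nonzero
    by (simp add: v_def s(2) F_eq to_fract_power power_mult_distrib K_def power_add)
  finally show thesis
    using that r homogeneous_subset_deg_ge [of t "int K"] deg_ge_mono [of "int cutoff" "int K" t]
    by (auto simp: K_def)
qed

text \<open>Written with \<open>f\<close> instead of \<open>g\<close>, so that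
  \<open>\<Phi>_D\<close> holds for all \<open>i\<close> uniformly; for \<open>i \<noteq> t\<close>,
  \<open>log_derivative_euler\<close> replaces \<open>f\<close> by \<open>g\<close>.\<close>

definition open_op :: "'n \<Rightarrow> ('n, 'j) laurent fract \<Rightarrow> ('n, 'j) laurent fract" where
  "open_op i q = fract_deriv (euler i) q + to_fract (lconst (\<alpha> $ i)) * q
     - to_fract (lconst (\<alpha> $ t)) * (to_fract (euler i f) / F) * q"

lemma \<Phi>_D:
  assumes "r \<in> P"
  shows "\<Phi> (D i r) = open_op i (\<Phi> r)"
proof -
  have "\<Phi> (D i r) = \<Phi> (euler i r + euler i f * r) + \<Phi> (lconst (\<alpha> $ i) * r)"
    by (simp add: torus_op_def \<Phi>_add)
  also have "\<dots> = open_op i (\<Phi> r)"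
    using \<Phi>_derivation [OF derivation_euler assms, of i] \<Phi>_degree_zero_mult [OF assms homogeneous_lconst]
    by (simp add: homogeneous_euler open_op_def)
  finally show ?thesis .
qed

text \<open>\<open>f\<close> and \<open>g\<close> differ by the factor \<open>X\<close>, a constant
  for \<open>\<delta>\<close>.\<close>

lemma log_derivative:
  assumes "derivation \<delta>" "\<delta> X = 0"
  shows "to_fract (\<delta> f) / F = to_fract (\<delta> g) / G"
proof -
  interpret derivation \<delta> by fact
  have "\<delta> f = X * \<delta> g"
    by (simp add: factor mult assms(2))
  then show ?thesis using X_nonzero by (simp add: F_eq)
qed

lemma log_derivative_euler: "i \<noteq> t \<Longrightarrow> to_fract (euler i f) / F = to_fract (euler i g) / G"
  by (rule log_derivative [OF derivation_euler]) (simp add: euler_lmonom axis_def)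

lemma log_derivative_param_diff: "to_fract (param_diff j f) / F = to_fract (param_diff j g) / G"
  by (rule log_derivative [OF derivation_param_diff]) simp

lemma open_nabla_eq_koszul: "open_nabla g \<alpha> \<omega> = koszul (- {t}) open_op \<omega>"
proof -
  let ?\<theta> = "\<lambda>i. fract_deriv (euler i :: ('n, 'j) laurent \<Rightarrow> _)"
  define c where "c i = to_fract (euler i f) / F" for i
  have to_fract: "?\<theta> i (to_fract r) = to_fract (euler i r)" for i r
    by (rule derivation.\<Delta>_to_fract [OF derivation_euler])
  have zero: "?\<theta> i 0 = 0" for i
    using to_fract [of i 0] by simp
  have "(inverse G *s ext_deriv (- {t}) ?\<theta> (axis {} G)) \<and>\<^sub>f \<omega>
      = (\<Sum>i\<in>- {t}. (inverse G * to_fract (euler i g)) *s ext_mult i \<omega>)"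
    by (simp add: ext_deriv_axis [of _ ?\<theta>, OF zero] to_fract smult_wedge_left wedge_sum_left wedge_axis
        vec_eq_iff sum_distrib_left mult.assoc)
  also have "\<dots> = (\<Sum>i\<in>- {t}. c i *s ext_mult i \<omega>)"
    by (intro sum.cong refl) (simp add: c_def log_derivative_euler field_simps)
  finally have "open_nabla g \<alpha> \<omega> = (\<Sum>i\<in>- {t}. ext_mult i (map_form (?\<theta> i) \<omega>)
      + to_fract (lconst (\<alpha> $ i)) *s ext_mult i \<omega>
      - to_fract (lconst (\<alpha> $ t)) *s (c i *s ext_mult i \<omega>))"
    by (simp add: open_nabla_def wedge_axis ext_deriv_eq_koszul koszul_def sum.distrib sum_subtractf
        vec_eq_iff sum_distrib_left mult.assoc)
  also have "\<dots> = koszul (- {t}) open_op \<omega>"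
    unfolding koszul_def
    by (intro sum.cong refl) (simp add: vec_eq_iff ext_mult_def open_op_def algebra_simps flip: c_def)
  finally show ?thesis .
qed

text \<open>On a form written as \<open>\<eta>\<close> wedge \<open>dx\<^sub>t/x\<^sub>t\<close>
  plus terms without \<open>dx\<^sub>t/x\<^sub>t\<close>, this extracts \<open>\<eta>\<close> and
  applies \<open>\<Phi>\<close> to its coefficients. No sign appears, because \<open>t\<close> is
  the largest index and \<open>dx\<^sub>t/x\<^sub>t\<close> comes last. The lost factor accounts for
  the shift of degree.\<close>

definition \<Theta> :: "(('n, 'j) laurent, 'n) form \<Rightarrow> (('n, 'j) laurent fract, 'n) form" where
  "\<Theta> \<omega> = (\<chi> K. if t \<in> K then 0 else \<Phi> (\<omega> $ insert t K))"

lemma \<Theta>_add: "\<Theta> (\<omega> + \<eta>) = \<Theta> \<omega> + \<Theta> \<eta>"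
  by (simp add: \<Theta>_def vec_eq_iff \<Phi>_add)

lemma \<Theta>_zero [simp]: "\<Theta> 0 = 0"
  by (simp add: \<Theta>_def vec_eq_iff)

lemma \<Theta>_diff: "\<Theta> (\<omega> - \<eta>) = \<Theta> \<omega> - \<Theta> \<eta>"
  by (simp add: \<Theta>_def vec_eq_iff \<Phi>_diff)

lemma \<Theta>_mem:
  assumes "\<omega> \<in> forms UNIV P k"
  shows "\<Theta> \<omega> \<in> open_forms g (k - 1)"
proof -
  have \<omega>: "\<omega> $ K \<in> P" "\<omega> $ K \<noteq> 0 \<Longrightarrow> int (card K) = k" for K
    using assms by (auto simp: forms_def)
  have "K \<subseteq> - {t} \<and> int (card K) = k - 1" if nz: "\<Theta> \<omega> $ K \<noteq> 0" for K
  proof -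
    have "t \<notin> K" "\<omega> $ insert t K \<noteq> 0"
      using nz by (auto simp: \<Theta>_def split: if_splits)
    then show ?thesis using \<omega>(2) [of "insert t K"] by auto
  qed
  moreover have "\<Theta> \<omega> $ K \<in> regular_fun g" for K
    by (simp add: \<Theta>_def \<omega> \<Phi>_mem regular_fun_zero)
  ultimately show ?thesis by (simp add: open_forms_def forms_def)
qed

lemma \<Theta>_surj:
  assumes "\<eta> \<in> open_forms g (k - 1)"
  obtains \<omega> where "\<omega> \<in> forms UNIV P k" "\<Theta> \<omega> = \<eta>"
proof -
  have \<eta>: "\<eta> $ K \<in> regular_fun g" "\<eta> $ K \<noteq> 0 \<Longrightarrow> K \<subseteq> - {t} \<and> int (card K) = k - 1" for K
    using assms by (auto simp: open_forms_def forms_def)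
  \<comment> \<open>Zero coefficients are lifted to zero, so that the lift is a form of pure
    degree.\<close>
  have "\<exists>r\<in>P. \<Phi> r = \<eta> $ K \<and> (\<eta> $ K = 0 \<longrightarrow> r = 0)" for K
  proof (cases "\<eta> $ K = 0")
    case False
    then show ?thesis using \<Phi>_surj [OF \<eta>(1) [of K]] by metis
  qed (auto intro!: bexI [of _ 0])
  then obtain r where r: "\<And>K. r K \<in> P" "\<And>K. \<Phi> (r K) = \<eta> $ K" "\<And>K. \<eta> $ K = 0 \<Longrightarrow> r K = 0"
    by metis
  define \<omega> where "\<omega> = (\<chi> K. if t \<in> K then r (K - {t}) else 0)"
  have "int (card K) = k" if "t \<in> K" "r (K - {t}) \<noteq> 0" for K
  proof -
    have "int (card (K - {t})) = k - 1"
      using \<eta>(2) r(3) that by metis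
    moreover have "Suc (card (K - {t})) = card K"
      using that by (intro card_Suc_Diff1) auto
    ultimately show ?thesis by linarith
  qed
  then have "\<omega> \<in> forms UNIV P k"
    by (auto simp: forms_def \<omega>_def r)
  moreover have "\<Theta> \<omega> $ K = \<eta> $ K" for K
    using \<eta>(2) [of K] by (auto simp: \<Theta>_def \<omega>_def r insert_Diff_if)
  then have "\<Theta> \<omega> = \<eta>" by (simp add: vec_eq_iff)
  ultimately show thesis by (rule that)
qed

lemma \<Phi>_sign: "\<Phi> (basis_sign i K * r) = basis_sign i K * \<Phi> r"
  by (cases "even (card {j \<in> K. j < i})") (simp_all add: basis_sign_def \<Phi>_uminus)

lemma \<Phi>_sum: "\<Phi> (\<Sum>x\<in>S. h x) = (\<Sum>x\<in>S. \<Phi> (h x))"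
  by (induction S rule: infinite_finite_induct) (simp_all add: \<Phi>_add)

lemma le_top: "i \<le> t"
  by (simp add: top_idx_def)

text \<open>The summand for \<open>t\<close> is annihilated by \<open>\<Phi>_D_top\<close>, and the
  others are carried over by \<open>\<Phi>_D\<close>. Inserting the largest index \<open>t\<close>
  into \<open>K\<close> does not affect their signs.\<close>

lemma \<Theta>_koszul:
  assumes "\<omega> \<in> forms UNIV P k"
  shows "\<Theta> (koszul UNIV D \<omega>) = koszul (- {t}) open_op (\<Theta> \<omega>)"
proof -
  have \<omega>: "\<omega> $ K \<in> P" for K
    using assms by (simp add: forms_def)
  have open_op_zero: "open_op i 0 = 0" for i
    using \<Phi>_D [of 0 i] by simp
  have "\<Theta> (koszul UNIV D \<omega>) $ K = koszul (- {t}) open_op (\<Theta> \<omega>) $ K" for K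
  proof (cases "t \<in> K")
    case True
    then show ?thesis by (auto simp: \<Theta>_def koszul_nth open_op_zero intro!: sum.neutral split: if_split_asm)
  next
    case False
    have sign: "basis_sign i (insert t K) = basis_sign i K" for i
      using False le_top [of i] by (simp add: basis_sign_insert not_less)
    have "\<Theta> (koszul UNIV D \<omega>) $ K
        = (\<Sum>i\<in>insert t K. basis_sign i (insert t K) * \<Phi> (D i (\<omega> $ (insert t K - {i}))))"
      using False by (simp add: \<Theta>_def koszul_nth \<Phi>_add \<Phi>_sum \<Phi>_sign)
    also have "\<dots> = (\<Sum>i\<in>K. basis_sign i K * \<Phi> (D i (\<omega> $ (insert t K - {i}))))"
      using False by (simp add: \<Phi>_D_top \<omega> sign)
    also have "\<dots> = (\<Sum>i\<in>K. basis_sign i K * open_op i (\<Theta> \<omega> $ (K - {i})))"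
    proof (rule sum.cong [OF refl])
      fix i assume "i \<in> K"
      then have "insert t K - {i} = insert t (K - {i})" using False by auto
      then show "basis_sign i K * \<Phi> (D i (\<omega> $ (insert t K - {i}))) = basis_sign i K * open_op i (\<Theta> \<omega> $ (K - {i}))"
        using False by (simp add: \<Phi>_D \<omega> \<Theta>_def)
    qed
    also have "\<dots> = koszul (- {t}) open_op (\<Theta> \<omega>) $ K"
      unfolding koszul_nth using False by (intro sum.cong) auto
    finally show ?thesis .
  qed
  then show ?thesis by (simp add: vec_eq_iff)
qed

lemma \<Theta>_act:
  assumes "\<omega> \<in> forms UNIV P k"
  shows "\<Theta> (free_act lconst (torus_gen_act a) p \<omega>)
    = free_act (\<lambda>c. to_fract (lconst c)) (open_gen_act g \<alpha>) p (\<Theta> \<omega>)"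
proof (rule free_act_intertwine [of \<omega> "forms UNIV P k"])
  interpret W: weyl_complex "forms UNIV P" "torus_nabla a \<alpha>" "free_act lconst (torus_gen_act a)"
    by (rule weyl_complex_deg_ge)
  interpret linear_action lconst "torus_gen_act a"
    by (rule linear_action_torus)
  fix \<omega> \<eta> :: "(('n, 'j) laurent, 'n) form" and x c
  assume \<omega>: "\<omega> \<in> forms UNIV P k"
  show "torus_gen_act a x \<omega> \<in> forms UNIV P k"
    using W.act_mem [OF \<omega>, of "gen x"] by (simp add: free_act_gen)
  show "lconst c *s \<omega> \<in> forms UNIV P k"
    unfolding smult_eq_map_form by (rule map_form_forms [OF \<omega>]) (simp_all add: deg_ge_lconst_mult)
  have \<omega>K: "\<omega> $ K \<in> P" for K
    using \<omega> by (simp add: forms_def)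
  show "\<Theta> (lconst c *s \<omega>) = to_fract (lconst c) *s \<Theta> \<omega>"
    by (simp add: vec_eq_iff \<Theta>_def \<Phi>_degree_zero_mult \<omega>K)
  show "\<Theta> (torus_gen_act a x \<omega>) = open_gen_act g \<alpha> x (\<Theta> \<omega>)"
  proof (cases x)
    case (Lam j)
    then show ?thesis by (simp add: vec_eq_iff \<Theta>_def \<Phi>_degree_zero_mult \<omega>K)
  next
    case (Par j)
    have "fract_deriv (param_diff j) 0 = (0 :: ('n, 'j) laurent fract)"
      using derivation.\<Delta>_to_fract [OF derivation_param_diff, of j 0] by simp
    \<comment> \<open>As \<open>param_diff j f\<close> is \<open>lmonom (a j)\<close>, the action of
      \<open>Par j\<close> has the shape treated in \<open>\<Phi>_derivation\<close>.\<close>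
    then show ?thesis
      using \<Phi>_derivation [OF derivation_param_diff \<omega>K, of j] Par
      by (simp add: vec_eq_iff \<Theta>_def homogeneous_param_diff log_derivative_param_diff)
        (simp add: param_diff_generic)
  qed
  show "\<omega> + \<eta> \<in> forms UNIV P k" if "\<eta> \<in> forms UNIV P k"
    using W.add_mem [OF \<omega> that] .
qed (simp_all add: assms \<Theta>_add forms_zero)

lemma open_forms_eq: "open_forms g k = \<Theta> ` forms UNIV P (k + 1)"
proof (intro equalityI subsetI)
  fix \<eta> assume "\<eta> \<in> open_forms g k"
  then show "\<eta> \<in> \<Theta> ` forms UNIV P (k + 1)"
    using \<Theta>_surj [of \<eta> "k + 1"] by auto
next
  fix \<eta> assume "\<eta> \<in> \<Theta> ` forms UNIV P (k + 1)"
  then show "\<eta> \<in> open_forms g k"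
    using \<Theta>_mem [of _ "k + 1"] by auto
qed

lemma open_nabla_\<Theta>: "\<omega> \<in> forms UNIV P k \<Longrightarrow> open_nabla g \<alpha> (\<Theta> \<omega>) = \<Theta> (torus_nabla a \<alpha> \<omega>)"
  by (simp add: open_nabla_eq_koszul torus_nabla_eq_koszul \<Theta>_koszul)

lemma weyl_complex_open:
  "weyl_complex (open_forms g) (open_nabla g \<alpha>) (free_act (\<lambda>c. to_fract (lconst c)) (open_gen_act g \<alpha>))"
  by (rule weyl_complex_image [OF weyl_complex_deg_ge [of "int cutoff"], of _ \<Theta> 1])
    (simp_all add: open_forms_eq \<Theta>_add open_nabla_\<Theta> \<Theta>_act)

text \<open>The kernel of \<open>\<Theta>\<close> is acyclic: the components containing
  \<open>t\<close> lie in the image of \<open>D t\<close>, and the primitive from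
  \<open>koszul_primitive\<close> has no such components, so it is again in the kernel.\<close>

lemma \<Theta>_kernel:
  assumes \<omega>: "\<omega> \<in> forms UNIV P k" "torus_nabla a \<alpha> \<omega> = 0" "\<Theta> \<omega> = 0"
  obtains \<zeta> where "\<zeta> \<in> forms UNIV P (k - 1)" "\<Theta> \<zeta> = 0" "\<omega> = torus_nabla a \<alpha> \<zeta>"
proof -
  have image: "\<omega> $ K \<in> D t ` P" if "t \<in> K" for K
  proof (rule \<Phi>_eq_0_imp)
    show "\<omega> $ K \<in> P"
      using \<omega>(1) by (simp add: forms_def)
    have "\<Theta> \<omega> $ (K - {t}) = 0"
      by (simp add: \<omega>(3))
    then show "\<Phi> (\<omega> $ K) = 0"
      using that by (simp add: \<Theta>_def insert_absorb)
  qed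
  have closed: "koszul UNIV D \<omega> = 0"
    using \<omega>(2) by (simp add: torus_nabla_eq_koszul)
  show thesis
  proof (rule koszul_primitive [OF deg_ge_zero deg_ge_uminus D_top_inj \<omega>(1) closed image deg_ge_add deg_ge_D])
    fix \<zeta> assume "\<zeta> \<in> forms UNIV P (k - 1)" "\<And>K. t \<in> K \<Longrightarrow> \<zeta> $ K = 0" "\<omega> = koszul UNIV D \<zeta>"
    then show thesis
      by (intro that [of \<zeta>]) (simp_all add: torus_nabla_eq_koszul \<Theta>_def vec_eq_iff)
  qed
qed

theorem cohomology_isomorphic:
  assumes nonint: "\<alpha> $ i \<notin> \<int>"
  shows "left_module_isomorphic weyl_algebra (torus_cohomology a \<alpha> k) (open_cohomology g \<alpha> (k - 1))"
proof -
  have nabla_nabla: "torus_nabla a \<alpha> (torus_nabla a \<alpha> \<omega>) = 0" for \<omega>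
    by (simp add: torus_nabla_eq_koszul koszul_koszul)
  have nabla_diff: "torus_nabla a \<alpha> (\<omega> - \<eta>) = torus_nabla a \<alpha> \<omega> - torus_nabla a \<alpha> \<eta>" for \<omega> \<eta>
    by (simp add: torus_nabla_eq_koszul koszul_diff)
  interpret W: weyl_complex "forms UNIV P" "torus_nabla a \<alpha>" "free_act lconst (torus_gen_act a)"
    by (rule weyl_complex_deg_ge)
  have truncate: "\<exists>\<xi>\<in>forms UNIV UNIV (l - 1). \<eta> - torus_nabla a \<alpha> \<xi> \<in> forms UNIV P l"
    if "\<eta> \<in> forms UNIV UNIV l" "torus_nabla a \<alpha> \<eta> \<in> forms UNIV P l'" for \<eta> l l'
  proof -
    have "koszul UNIV D \<eta> $ K \<in> P" for K
      using that(2) by (simp add: torus_nabla_eq_koszul forms_def)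
    then show ?thesis
      using koszul_truncate [OF nonint that(1)] unfolding torus_nabla_eq_koszul by blast
  qed
  have mem: "torus_nabla a \<alpha> \<xi> \<in> forms UNIV P l" if "\<xi> \<in> forms UNIV P (l - 1)" for \<xi> l
    using W.d_mem [OF that] by simp
  show ?thesis
    unfolding torus_cohomology_def open_cohomology_def torus_forms_def
  proof (rule left_module_isomorphic_cohomology [where D = "forms UNIV P" and \<Theta> = \<Theta>])
    show "weyl_complex (forms UNIV UNIV) (torus_nabla a \<alpha>) (free_act lconst (torus_gen_act a))"
      by (rule weyl_complex_torus) simp_all
    show "weyl_complex (open_forms g) (open_nabla g \<alpha>) (free_act (\<lambda>c. to_fract (lconst c)) (open_gen_act g \<alpha>))"
      by (rule weyl_complex_open)
    show "weyl_complex (forms UNIV P) (torus_nabla a \<alpha>) (free_act lconst (torus_gen_act a))"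
      by (rule weyl_complex_deg_ge)
    show "forms UNIV P k \<subseteq> forms UNIV UNIV k"
      by (rule forms_mono) simp
  next
    fix \<omega> assume \<omega>: "\<omega> \<in> forms UNIV UNIV k" "torus_nabla a \<alpha> \<omega> = 0"
    then obtain \<xi> where \<xi>: "\<xi> \<in> forms UNIV UNIV (k - 1)" "\<omega> - torus_nabla a \<alpha> \<xi> \<in> forms UNIV P k"
      using truncate [of \<omega> k k] W.zero_mem by auto
    then show "\<exists>\<omega>'\<in>forms UNIV P k. torus_nabla a \<alpha> \<omega>' = 0 \<and> \<omega> - \<omega>' \<in> torus_nabla a \<alpha> ` forms UNIV UNIV (k - 1)"
      using \<omega> by (intro bexI [OF _ \<xi>(2)]) (simp add: nabla_diff nabla_nabla)
  next
    fix \<omega> assume "\<omega> \<in> forms UNIV P k" "torus_nabla a \<alpha> \<omega> = 0"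
    then show "\<Theta> \<omega> \<in> open_forms g (k - 1) \<and> open_nabla g \<alpha> (\<Theta> \<omega>) = 0"
      using open_nabla_\<Theta> by (simp add: \<Theta>_mem)
  next
    fix \<omega> assume \<omega>: "\<omega> \<in> forms UNIV P k" "torus_nabla a \<alpha> \<omega> = 0"
    show "\<omega> \<in> torus_nabla a \<alpha> ` forms UNIV UNIV (k - 1)
        \<longleftrightarrow> \<Theta> \<omega> \<in> open_nabla g \<alpha> ` open_forms g (k - 1 - 1)"
    proof
      assume "\<omega> \<in> torus_nabla a \<alpha> ` forms UNIV UNIV (k - 1)"
      then obtain \<xi> where \<xi>: "\<xi> \<in> forms UNIV UNIV (k - 1)" "\<omega> = torus_nabla a \<alpha> \<xi>" by blast
      \<comment> \<open>The primitive is moved into the truncation by subtracting an exact form,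
        which does not affect its differential.\<close>
      then obtain \<xi>' where "\<xi> - torus_nabla a \<alpha> \<xi>' \<in> forms UNIV P (k - 1)"
        using truncate [of \<xi> "k - 1" k] \<omega>(1) by auto
      moreover from this have "\<Theta> \<omega> = open_nabla g \<alpha> (\<Theta> (\<xi> - torus_nabla a \<alpha> \<xi>'))"
        by (simp add: open_nabla_\<Theta> nabla_diff nabla_nabla \<xi>(2))
      ultimately show "\<Theta> \<omega> \<in> open_nabla g \<alpha> ` open_forms g (k - 1 - 1)"
        using \<Theta>_mem by blast
    next
      assume "\<Theta> \<omega> \<in> open_nabla g \<alpha> ` open_forms g (k - 1 - 1)"
      then obtain \<eta> where \<eta>: "\<eta> \<in> open_forms g (k - 1 - 1)" "\<Theta> \<omega> = open_nabla g \<alpha> \<eta>" by blast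
      \<comment> \<open>The primitive of \<open>\<Theta> \<omega>\<close> is lifted to
        \<open>\<xi>\<close>; subtracting its differential from \<open>\<omega>\<close> leaves a
        cocycle in the acyclic kernel.\<close>
      obtain \<xi> where \<xi>: "\<xi> \<in> forms UNIV P (k - 1)" "\<Theta> \<xi> = \<eta>"
        using \<Theta>_surj [OF \<eta>(1)] by blast
      have "\<Theta> (\<omega> - torus_nabla a \<alpha> \<xi>) = 0"
        using \<eta>(2) \<xi> by (simp add: \<Theta>_diff flip: open_nabla_\<Theta>)
      moreover have "\<omega> - torus_nabla a \<alpha> \<xi> \<in> forms UNIV P k"
        by (rule W.diff_mem [OF \<omega>(1) mem [OF \<xi>(1)]])
      ultimately obtain \<zeta> where "\<zeta> \<in> forms UNIV P (k - 1)" "\<omega> - torus_nabla a \<alpha> \<xi> = torus_nabla a \<alpha> \<zeta>"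
        using \<Theta>_kernel [of "\<omega> - torus_nabla a \<alpha> \<xi>" k] \<omega>(2) by (auto simp: nabla_diff nabla_nabla)
      then have "\<omega> = torus_nabla a \<alpha> (\<xi> + \<zeta>)" "\<xi> + \<zeta> \<in> forms UNIV P (k - 1)"
        using \<xi>(1) by (simp_all add: W.d_add W.add_mem diff_eq_eq add.commute)
      then show "\<omega> \<in> torus_nabla a \<alpha> ` forms UNIV UNIV (k - 1)"
        using forms_mono [of P UNIV UNIV "k - 1"] by blast
    qed
  next
    fix \<eta> assume \<eta>: "\<eta> \<in> open_forms g (k - 1)" "open_nabla g \<alpha> \<eta> = 0"
    \<comment> \<open>The lift of a cocycle may fail to be closed, but its differential lies in the
      kernel of \<open>\<Theta>\<close>, and a primitive \<open>\<zeta>\<close> within the kernel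
      corrects it.\<close>
    obtain \<omega> where \<omega>: "\<omega> \<in> forms UNIV P k" "\<Theta> \<omega> = \<eta>"
      using \<Theta>_surj [OF \<eta>(1)] by blast
    have "\<Theta> (torus_nabla a \<alpha> \<omega>) = 0"
      using \<omega> \<eta>(2) by (simp flip: open_nabla_\<Theta>)
    moreover have "torus_nabla a \<alpha> \<omega> \<in> forms UNIV P (k + 1)"
      by (rule W.d_mem [OF \<omega>(1)])
    ultimately obtain \<zeta> where \<zeta>: "\<zeta> \<in> forms UNIV P k" "\<Theta> \<zeta> = 0" "torus_nabla a \<alpha> \<omega> = torus_nabla a \<alpha> \<zeta>"
      using \<Theta>_kernel [of "torus_nabla a \<alpha> \<omega>" "k + 1"] by (auto simp: nabla_nabla)
    show "\<exists>\<omega>\<in>forms UNIV P k. torus_nabla a \<alpha> \<omega> = 0 \<and> \<Theta> \<omega> = \<eta>"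
      using W.diff_mem [OF \<omega>(1) \<zeta>(1)] by (intro bexI [of _ "\<omega> - \<zeta>"]) (simp_all add: nabla_diff \<zeta> \<Theta>_diff \<omega>(2))
  qed (simp_all add: \<Theta>_add \<Theta>_act)
qed

end

theorem theorem1p5:
  fixes a :: "'j::{finite,linorder} \<Rightarrow> int ^ 'n::{finite,linorder}"
    and \<alpha> :: "complex ^ 'n::{finite,linorder}"
    and g :: "('n, 'j) laurent"
  assumes "group_closure (range a) = UNIV"
    and "generic_laurent a = lmonom (axis top_idx 1) * g"
    and "g \<in> subtorus_ring"
    and "nonresonant (range a) \<alpha>"
  shows "\<forall>i. left_module_isomorphic weyl_algebra
           (torus_cohomology a \<alpha> i) (open_cohomology g \<alpha> (i - 1))"
proof -
  interpret torus_family a \<alpha> g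
    by standard (fact assms(2,3))+
  \<comment> \<open>All exponents have last coordinate 1, which ensures that the cone has a facet to
    which nonresonance applies.\<close>
  have pos: "v $ top_idx > 0" if "v \<in> range a" for v
    using that a_top by auto
  obtain i where "\<alpha> $ i \<notin> \<int>"
    by (rule nonresonant_imp_not_Ints [OF _ assms(1) pos assms(4)]) simp_all
  then show ?thesis
    by (intro allI cohomology_isomorphic)
qed

end
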